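(* Let $h/k$ be a field extension and $(h_n)_{n\in\mathbb{N}}$ an increasing sequence of subfields of $h$ containing $k$ with $h=\bigcup_nh_n$, such that for every $n$, $h_n/k$ is an outer Galois extension of finite degree $d_n$ with $\mathrm{Gal}(h_n/k)$ cyclic, generated by $\sigma_n$, and $\sigma_n|_{h_m}=\sigma_m$ for $m\le n$. Suppose that for all $n$, $d_{n+1}/d_n$ and $d_n$ are coprime. Let $\mathbf{k}\subset Z(k)$ be a commutative subfield. Then there exists a sequence $(l_n)_{n\in\mathbb{N}}$ of positive integers with $l_n\mid l_{n+1}$, $d_n\mid \frac{l_{n+1}}{l_n}-1$ and $d_n\mid l_n$ for all $n$. Moreover, for any such sequence, letting $H=\varinjlim h_n(t,\sigma_n)$ with transition morphisms $h_n(t,\sigma_n)\to h_{n+1}(t,\sigma_{n+1})$, $P(t)\mapsto P(t^{l_{n+1}/l_n})$ (identity on $h_n$): if $\mathrm{SIGP}_{\mathbf{k}}$ holds, then $\mathrm{IGP}_H$ holds.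
   Context: "Field" means a not necessarily commutative division ring; $Z(A)$ is the center of $A$. For a field $h$ and automorphism $\sigma$, $h(t,\sigma)$ is the field of fractions of the ring $h[t,\sigma]$ of polynomials $\sum a_it^i$ with $ta=\sigma(a)t$. $h/k$ is outer if the only inner automorphism of $h$ fixing $k$ pointwise is the identity; $\mathrm{Gal}(h/k)$ is the group of automorphisms of $h$ fixing $k$ pointwise and $h/k$ is Galois if its fixed field is $k$. $\mathrm{SIGP}_{\mathbf{k}}$ (for a commutative field $\mathbf{k}$): for every finite group $G$ there is a field $L$ with $\mathbf{k}(t)\subset L\subset\mathbf{k}((t))$ such that $L/\mathbf{k}(t)$ is Galois with group $G$. $\mathrm{IGP}_H$: every finite group is the Galois group of an outer Galois extension of $H$. *)

theory Defs
  imports "HOL-Algebra.Algebra"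
begin

(* "Field" = not necessarily commutative division ring, as an HOL-Algebra ring record *)
definition division_ring :: "('a,'m) ring_scheme \<Rightarrow> bool" where
  "division_ring R \<longleftrightarrow> ring R \<and> \<one>\<^bsub>R\<^esub> \<noteq> \<zero>\<^bsub>R\<^esub> \<and>
     (\<forall>x\<in>carrier R - {\<zero>\<^bsub>R\<^esub>}. x \<in> Units R)"

definition subdivring :: "'a set \<Rightarrow> ('a,'m) ring_scheme \<Rightarrow> bool" where
  "subdivring K R \<longleftrightarrow> subring K R \<and> (\<forall>x\<in>K. x \<noteq> \<zero>\<^bsub>R\<^esub> \<longrightarrow> inv\<^bsub>R\<^esub> x \<in> K)"

definition gen_divring :: "('a,'m) ring_scheme \<Rightarrow> 'a set \<Rightarrow> 'a set" where
  "gen_divring R S = \<Inter>{K. subdivring K R \<and> S \<subseteq> K}"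

definition ring_center :: "('a,'m) ring_scheme \<Rightarrow> 'a set" where
  "ring_center R = {z\<in>carrier R. \<forall>x\<in>carrier R. z \<otimes>\<^bsub>R\<^esub> x = x \<otimes>\<^bsub>R\<^esub> z}"

definition Gal :: "('a,'m) ring_scheme \<Rightarrow> 'a set \<Rightarrow> ('a \<Rightarrow> 'a) monoid" where
  "Gal R K = \<lparr>carrier = {g. g \<in> ring_iso R R \<and> g \<in> extensional (carrier R) \<and> (\<forall>x\<in>K. g x = x)},
              monoid.mult = (\<lambda>g f. compose (carrier R) g f),
              one = restrict id (carrier R)\<rparr>"

definition galois :: "('a,'m) ring_scheme \<Rightarrow> 'a set \<Rightarrow> bool" where
  "galois R K \<longleftrightarrow> {x\<in>carrier R. \<forall>g\<in>carrier (Gal R K). g x = x} = K"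

definition outer :: "('a,'m) ring_scheme \<Rightarrow> 'a set \<Rightarrow> bool" where
  "outer R K \<longleftrightarrow> (\<forall>u\<in>Units R.
      (\<forall>x\<in>K. u \<otimes>\<^bsub>R\<^esub> x \<otimes>\<^bsub>R\<^esub> inv\<^bsub>R\<^esub> u = x) \<longrightarrow>
      (\<forall>x\<in>carrier R. u \<otimes>\<^bsub>R\<^esub> x \<otimes>\<^bsub>R\<^esub> inv\<^bsub>R\<^esub> u = x))"

definition left_degree :: "('a,'m) ring_scheme \<Rightarrow> 'a set \<Rightarrow> 'a set \<Rightarrow> nat \<Rightarrow> bool" where
  "left_degree R K E d \<longleftrightarrow> (\<exists>B. finite B \<and> card B = d \<and> B \<subseteq> E \<and>
     (\<forall>a \<in> B \<rightarrow> K. (\<Oplus>\<^bsub>R\<^esub> b\<in>B. a b \<otimes>\<^bsub>R\<^esub> b) = \<zero>\<^bsub>R\<^esub> \<longrightarrow> (\<forall>b\<in>B. a b = \<zero>\<^bsub>R\<^esub>)) \<and>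
     (\<forall>x\<in>E. \<exists>a \<in> B \<rightarrow> K. x = (\<Oplus>\<^bsub>R\<^esub> b\<in>B. a b \<otimes>\<^bsub>R\<^esub> b)))"

(* skew polynomial ring K[t,s]: sum a_i t^i with t a = s(a) t; p i = coefficient of t^i *)
definition skewpoly :: "('a,'m) ring_scheme \<Rightarrow> 'a set \<Rightarrow> ('a \<Rightarrow> 'a) \<Rightarrow> (nat \<Rightarrow> 'a) ring" where
  "skewpoly R K s = \<lparr>carrier = {p. (\<forall>i. p i \<in> K) \<and> finite {i. p i \<noteq> \<zero>\<^bsub>R\<^esub>}},
     monoid.mult = (\<lambda>p q n. \<Oplus>\<^bsub>R\<^esub> i\<in>{..n}. p i \<otimes>\<^bsub>R\<^esub> (s ^^ i) (q (n - i))),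
     one = (\<lambda>i. if i = 0 then \<one>\<^bsub>R\<^esub> else \<zero>\<^bsub>R\<^esub>),
     ring.zero = (\<lambda>i. \<zero>\<^bsub>R\<^esub>),
     ring.add = (\<lambda>p q i. p i \<oplus>\<^bsub>R\<^esub> q i)\<rparr>"

definition stretch :: "('a,'m) ring_scheme \<Rightarrow> nat \<Rightarrow> (nat \<Rightarrow> 'a) \<Rightarrow> (nat \<Rightarrow> 'a)" where
  "stretch R r p = (\<lambda>n. if r dvd n then p (n div r) else \<zero>\<^bsub>R\<^esub>)"

(* H is (isomorphic to) the direct limit of the skew fields of fractions h_n(t,sigma_n)
   with transition maps P(t) |-> P(t^(l(n+1)/l n)):
   psi n embeds h_n[t,sigma_n] into H; the subfield of H generated by its image is
   (a copy of) the skew field of fractions h_n(t,sigma_n); the embeddings are compatible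
   with the transition maps, and H is the union of these copies. *)
definition is_skew_limit ::
  "('a,'m) ring_scheme \<Rightarrow> (nat \<Rightarrow> 'a set) \<Rightarrow> (nat \<Rightarrow> 'a \<Rightarrow> 'a) \<Rightarrow> (nat \<Rightarrow> nat)
    \<Rightarrow> ('b,'c) ring_scheme \<Rightarrow> (nat \<Rightarrow> (nat \<Rightarrow> 'a) \<Rightarrow> 'b) \<Rightarrow> bool" where
  "is_skew_limit h hs \<sigma> l H \<psi> \<longleftrightarrow> division_ring H \<and>
     (\<forall>n. \<psi> n \<in> ring_hom (skewpoly h (hs n) (\<sigma> n)) H \<and>
          inj_on (\<psi> n) (carrier (skewpoly h (hs n) (\<sigma> n)))) \<and>
     (\<forall>n. \<forall>p\<in>carrier (skewpoly h (hs n) (\<sigma> n)).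
          \<psi> (Suc n) (stretch h (l (Suc n) div l n) p) = \<psi> n p) \<and>
     (\<Union>n. gen_divring H (\<psi> n ` carrier (skewpoly h (hs n) (\<sigma> n)))) = carrier H"

definition laurent :: "('a,'m) ring_scheme \<Rightarrow> 'a set \<Rightarrow> (int \<Rightarrow> 'a) ring" where
  "laurent R K = \<lparr>carrier = {f. (\<forall>i. f i \<in> K) \<and> (\<exists>N. \<forall>i<N. f i = \<zero>\<^bsub>R\<^esub>)},
     monoid.mult = (\<lambda>f g n. \<Oplus>\<^bsub>R\<^esub> i\<in>{i. f i \<noteq> \<zero>\<^bsub>R\<^esub> \<and> g (n - i) \<noteq> \<zero>\<^bsub>R\<^esub>}. f i \<otimes>\<^bsub>R\<^esub> g (n - i)),
     one = (\<lambda>i. if i = 0 then \<one>\<^bsub>R\<^esub> else \<zero>\<^bsub>R\<^esub>),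
     ring.zero = (\<lambda>i. \<zero>\<^bsub>R\<^esub>),
     ring.add = (\<lambda>f g i. f i \<oplus>\<^bsub>R\<^esub> g i)\<rparr>"

definition rat_funs :: "('a,'m) ring_scheme \<Rightarrow> 'a set \<Rightarrow> (int \<Rightarrow> 'a) set" where
  "rat_funs R K = gen_divring (laurent R K)
     ((\<lambda>c i. if i = 0 then c else \<zero>\<^bsub>R\<^esub>) ` K \<union> {\<lambda>i. if i = 1 then \<one>\<^bsub>R\<^esub> else \<zero>\<^bsub>R\<^esub>})"

(* SIGP_K; finite groups are represented (up to isomorphism) with carrier in nat *)
definition SIGP :: "('a,'m) ring_scheme \<Rightarrow> 'a set \<Rightarrow> bool" where
  "SIGP R K \<longleftrightarrow> (\<forall>G :: nat monoid. group G \<and> finite (carrier G) \<longrightarrow>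
     (\<exists>L. subdivring L (laurent R K) \<and> rat_funs R K \<subseteq> L \<and>
          galois ((laurent R K)\<lparr>carrier := L\<rparr>) (rat_funs R K) \<and>
          Gal ((laurent R K)\<lparr>carrier := L\<rparr>) (rat_funs R K) \<cong> G))"

definition IGP :: "('b,'c) ring_scheme \<Rightarrow> bool" where
  "IGP H \<longleftrightarrow> (\<forall>G :: nat monoid. group G \<and> finite (carrier G) \<longrightarrow>
     (\<exists>(L :: 'b ring) f. division_ring L \<and> f \<in> ring_hom H L \<and> inj_on f (carrier H) \<and>
          outer L (f ` carrier H) \<and> galois L (f ` carrier H) \<and> Gal L (f ` carrier H) \<cong> G))"

end

theory Submission
  imports Defs
begin

text \<open>
  By Dedekind independence and Artin's lemma, valid over division rings because \<open>h\<^sub>n/k\<close> is outer, the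
  order of \<open>\<sigma>\<^sub>n\<close> is exactly \<open>d\<^sub>n\<close>; hence \<open>d\<^sub>n\<close> divides \<open>d\<^sub>n\<^sub>+\<^sub>1\<close> and \<open>l\<close> is found by the Chinese remainder
  theorem.

  In \<open>H\<close> the element \<open>T = t\<^sub>n^l\<^sub>n\<close> does not depend on \<open>n\<close> and is central. Writing \<open>t\<^sub>n = T^(1/l\<^sub>n)\<close>, the
  field \<open>H\<close> embeds into a division ring \<open>E\<close> of series \<open>\<Sum> a\<^sub>s T^s\<close> with rational exponents and
  left-finite support, where \<open>T^s a = \<tau>\<^sub>s(a) T^s\<close>, and \<open>kk((T))\<close> is central in \<open>E\<close>. Families in
  \<open>kk((T))\<close> that are independent over \<open>kk(T)\<close> stay independent over \<open>H\<close>: clear denominators and apply a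
  \<open>kk\<close>-linear functional to the coefficients of a relation. So for a Galois extension \<open>L/kk(T)\<close> inside
  \<open>kk((T))\<close> with group \<open>G\<close>, the compositum \<open>H L\<close> in \<open>E\<close> is \<open>H \<otimes> L\<close>; it is a division ring, outer because
  it is generated over \<open>H\<close> by central elements, and Galois over \<open>H\<close> with group \<open>G\<close>. As \<open>H\<close> is infinite,
  \<open>H L\<close> has the cardinality of \<open>H\<close> and can be copied onto the same type.
\<close>

section \<open>Linear algebra over division rings\<close>

text \<open>The field \<open>H\<close> is given only through the maps \<open>\<psi> n\<close> on
  skew polynomials, so no series ring comes with it. The ring \<open>E\<close> is therefore built
  from \<open>h\<close> alone, and \<open>H\<close> is carried into it by extending
  \<open>\<psi> n p \<mapsto> \<iota> n p\<close> to fractions, which the Euclidean algorithm for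
  skew polynomials allows. Rational exponents come from the limit: \<open>t\<^sub>n\<close> becomes
  the power of \<open>t\<^sub>n\<^sub>+\<^sub>1\<close> with exponent
  \<open>l (Suc n) div l n\<close>, and roots of one common \<open>T\<close> name all variables at
  once. Divisibility of \<open>l (Suc n) div l n - 1\<close> by \<open>d n\<close> says that both
  sides act alike on \<open>hs n\<close>, so that the action of \<open>T^s\<close> is well defined;
  \<open>d n dvd l n\<close> makes \<open>T\<close> commute with \<open>hs n\<close>. Coprimality
  reconciles the two demands: the factor from \<open>l n\<close> to \<open>l (Suc n)\<close> is
  chosen to be \<open>1\<close> modulo \<open>d n\<close> and a multiple of
  \<open>d (Suc n) div d n\<close>. Finite support below every bound keeps each coefficient of a
  product a finite sum and lets geometric series converge. The copy at the end is forced by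
  \<open>IGP\<close>, which asks for an extension on the type of \<open>H\<close>.\<close>

locale divring = ring R for R (structure) +
  assumes one_not_zero [simp]: "\<one> \<noteq> \<zero>"
    and nz_Units: "\<And>x. x \<in> carrier R \<Longrightarrow> x \<noteq> \<zero> \<Longrightarrow> x \<in> Units R"

lemma division_ring_iff_divring: "division_ring R \<longleftrightarrow> divring R"
  unfolding division_ring_def divring_def divring_axioms_def by auto

section \<open>Finite sums in a ring\<close>

context ring
begin

lemma finsum_swap:
  assumes "finite A" "finite B" "\<And>i j. i \<in> A \<Longrightarrow> j \<in> B \<Longrightarrow> f i j \<in> carrier R"
  shows "(\<Oplus>i\<in>A. \<Oplus>j\<in>B. f i j) = (\<Oplus>j\<in>B. \<Oplus>i\<in>A. f i j)"
  using assms(1,3)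
proof (induction A rule: finite_induct)
  case empty then show ?case by simp
next
  case (insert a A)
  have "(\<Oplus>j\<in>B. \<Oplus>i\<in>insert a A. f i j) = (\<Oplus>j\<in>B. f a j \<oplus> (\<Oplus>i\<in>A. f i j))"
    using insert by (intro finsum_cong') auto
  also have "\<dots> = (\<Oplus>j\<in>B. f a j) \<oplus> (\<Oplus>j\<in>B. \<Oplus>i\<in>A. f i j)"
    using insert by (intro finsum_addf) auto
  also have "\<dots> = (\<Oplus>i\<in>insert a A. \<Oplus>j\<in>B. f i j)"
    using insert by (subst finsum_insert) auto
  finally show ?case by simp
qed

lemma finsum_mem:
  assumes "finite A" "f \<in> A \<rightarrow> S" "S \<subseteq> carrier R" "\<zero> \<in> S"
    and "\<And>x y. x \<in> S \<Longrightarrow> y \<in> S \<Longrightarrow> x \<oplus> y \<in> S"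
  shows "(\<Oplus>i\<in>A. f i) \<in> S"
  using assms(1,2)
proof (induction A rule: finite_induct)
  case empty then show ?case using assms by simp
next
  case (insert a A)
  then show ?case using assms(3,5) by (subst finsum_insert) auto
qed

lemma finsum_subring:
  assumes "subring S R" "finite A" "f \<in> A \<rightarrow> S"
  shows "(\<Oplus>i\<in>A. f i) \<in> S"
  using finsum_mem[OF assms(2,3)] subringE[OF assms(1)] by blast

lemma finsum_mono_zero:
  assumes "finite B" "A \<subseteq> B" "\<And>i. i \<in> B - A \<Longrightarrow> f i = \<zero>" "f \<in> A \<rightarrow> carrier R"
  shows "(\<Oplus>i\<in>A. f i) = (\<Oplus>i\<in>B. f i)"
  by (rule add.finprod_mono_neutral_cong_left) (use assms in auto)

lemma finsum_delta:
  assumes "finite A" "a \<in> A" "f a \<in> carrier R" "\<And>i. i \<in> A \<Longrightarrow> i \<noteq> a \<Longrightarrow> f i = \<zero>"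
  shows "(\<Oplus>i\<in>A. f i) = f a"
proof -
  have "(\<Oplus>i\<in>{a}. f i) = (\<Oplus>i\<in>A. f i)"
    by (rule finsum_mono_zero) (use assms in auto)
  then show ?thesis using assms(3) by (simp add: finsum_insert)
qed

lemma finsum_uminus:
  assumes "finite A" "f \<in> A \<rightarrow> carrier R"
  shows "(\<Oplus>i\<in>A. \<ominus> f i) = \<ominus> (\<Oplus>i\<in>A. f i)"
  using assms
proof (induction A rule: finite_induct)
  case empty then show ?case by simp
next
  case (insert a A)
  then show ?case by (subst (1 2) finsum_insert) (auto simp: minus_add)
qed

lemma finsum_minusf:
  assumes "finite A" "f \<in> A \<rightarrow> carrier R" "g \<in> A \<rightarrow> carrier R"
  shows "(\<Oplus>i\<in>A. f i \<ominus> g i) = (\<Oplus>i\<in>A. f i) \<ominus> (\<Oplus>i\<in>A. g i)"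
proof -
  have "(\<Oplus>i\<in>A. f i \<ominus> g i) = (\<Oplus>i\<in>A. f i \<oplus> \<ominus> g i)" by (simp add: a_minus_def)
  also have "\<dots> = (\<Oplus>i\<in>A. f i) \<oplus> (\<Oplus>i\<in>A. \<ominus> g i)"
    using assms by (intro finsum_addf) auto
  finally show ?thesis using assms by (simp add: finsum_uminus a_minus_def)
qed

text \<open>Additivity is asked only on a subset \<open>D\<close>, because the maps to which this is
  applied, such as homomorphisms of a subfield or the twist \<open>\<tau> s\<close>, are known to
  respect sums only there. Preservation of zero follows by cancellation.\<close>

lemma finsum_additive:
  fixes S (structure)
  assumes "ring S" "finite A" "f \<in> A \<rightarrow> D" "D \<subseteq> carrier R" "\<zero> \<in> D"
    and "\<And>x y. x \<in> D \<Longrightarrow> y \<in> D \<Longrightarrow> x \<oplus> y \<in> D"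
    and "\<And>x. x \<in> D \<Longrightarrow> \<phi> x \<in> carrier S"
    and "\<And>x y. x \<in> D \<Longrightarrow> y \<in> D \<Longrightarrow> \<phi> (x \<oplus> y) = \<phi> x \<oplus>\<^bsub>S\<^esub> \<phi> y"
  shows "\<phi> (\<Oplus>i\<in>A. f i) = (\<Oplus>\<^bsub>S\<^esub>i\<in>A. \<phi> (f i))"
proof -
  interpret S: ring S by fact
  have z: "\<phi> \<zero> = \<zero>\<^bsub>S\<^esub>"
  proof -
    have "\<phi> \<zero> \<oplus>\<^bsub>S\<^esub> \<phi> \<zero> = \<phi> \<zero>" using assms(8)[OF assms(5) assms(5)] by simp
    then show ?thesis using assms(5,7) by simp
  qed
  show ?thesis using assms(2,3)
  proof (induction A rule: finite_induct)
    case empty then show ?case by (simp add: z)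
  next
    case (insert a A)
    have "(\<Oplus>i\<in>A. f i) \<in> D" by (rule finsum_mem) (use insert assms in auto)
    then have "\<phi> (f a \<oplus> (\<Oplus>i\<in>A. f i)) = \<phi> (f a) \<oplus>\<^bsub>S\<^esub> (\<Oplus>\<^bsub>S\<^esub>i\<in>A. \<phi> (f i))"
      using insert assms(8) by auto
    then show ?case using insert.hyps insert.prems assms(4,7)
      by (subst finsum_insert; (subst S.finsum_insert)?) (auto simp: Pi_def)
  qed
qed

text \<open>\<open>finsum\<close> folds over the carrier of its ring, so passing to a subring with
  the same operations is not a mere rewriting. Needed whenever a result about division rings is
  applied inside a subfield.\<close>

lemma finsum_carrier_update:
  assumes "subring S R" "finite A" "f \<in> A \<rightarrow> S"
  shows "(\<Oplus>\<^bsub>R\<lparr>carrier := S\<rparr>\<^esub>i\<in>A. f i) = (\<Oplus>i\<in>A. f i)"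
proof -
  interpret S: ring "R\<lparr>carrier := S\<rparr>" by (rule subring_is_ring) fact
  show ?thesis using assms(2,3)
  proof (induction A rule: finite_induct)
    case empty then show ?case using S.finsum_empty by simp
  next
    case (insert a A)
    have "(\<Oplus>i\<in>A. f i) \<in> S" by (rule finsum_subring) (use insert assms in auto)
    then show ?case using insert assms(1) subringE(1)[OF assms(1)]
      by (subst S.finsum_insert) (auto simp: finsum_insert Pi_def subset_eq)
  qed
qed

end

section \<open>Division rings and division subrings\<close>

context divring
begin

lemma zero_not_one [simp]: "\<zero> \<noteq> \<one>"
  using one_not_zero by metis

lemma inv_nz [simp]:
  assumes "x \<in> carrier R" "x \<noteq> \<zero>"
  shows "inv x \<in> carrier R" "inv x \<otimes> x = \<one>" "x \<otimes> inv x = \<one>" "inv x \<noteq> \<zero>"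
proof -
  have u: "x \<in> Units R" using assms nz_Units by auto
  show a: "inv x \<in> carrier R" and b: "inv x \<otimes> x = \<one>" and "x \<otimes> inv x = \<one>" using u by auto
  show "inv x \<noteq> \<zero>" using b assms by auto
qed

lemma integral_nz:
  assumes "x \<in> carrier R" "y \<in> carrier R" "x \<otimes> y = \<zero>"
  shows "x = \<zero> \<or> y = \<zero>"
proof (rule ccontr)
  assume n: "\<not> ?thesis"
  then have "inv x \<otimes> (x \<otimes> y) = y" using assms(1,2) by (simp add: m_assoc[symmetric])
  then show False using n assms by simp
qed

lemma mult_nz [simp]:
  assumes "x \<in> carrier R" "y \<in> carrier R" "x \<noteq> \<zero>" "y \<noteq> \<zero>"
  shows "x \<otimes> y \<noteq> \<zero>"
  using integral_nz assms by blast

lemma m_lcancel_nz: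
  assumes "x \<in> carrier R" "y \<in> carrier R" "z \<in> carrier R" "z \<noteq> \<zero>" "z \<otimes> x = z \<otimes> y"
  shows "x = y"
proof -
  have "inv z \<otimes> (z \<otimes> x) = inv z \<otimes> (z \<otimes> y)" using assms by simp
  then show ?thesis using assms(1-4) by (simp add: m_assoc[symmetric])
qed

lemma inv_unique_nz:
  assumes "x \<in> carrier R" "y \<in> carrier R" "x \<otimes> y = \<one>"
  shows "inv x = y"
proof -
  have x: "x \<noteq> \<zero>" using assms by auto
  have "x \<otimes> y = x \<otimes> inv x" using x assms by simp
  then show ?thesis using m_lcancel_nz[of y "inv x" x] x assms by auto
qed

lemma subdivring_divring:
  assumes "subdivring K R" shows "divring (R\<lparr>carrier := K\<rparr>)"
proof -
  have K: "subring K R" using assms unfolding subdivring_def by auto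
  interpret K: ring "R\<lparr>carrier := K\<rparr>" by (rule subring_is_ring[OF K])
  show ?thesis
  proof unfold_locales
    fix x assume "x \<in> carrier (R\<lparr>carrier := K\<rparr>)" "x \<noteq> \<zero>\<^bsub>R\<lparr>carrier := K\<rparr>\<^esub>"
    then have "x \<in> K" "x \<in> carrier R" "x \<noteq> \<zero>" "inv x \<in> K"
      using subringE(1)[OF K] assms by (auto simp: subdivring_def)
    then show "x \<in> Units (R\<lparr>carrier := K\<rparr>)"
      unfolding Units_def by (auto intro!: bexI[of _ "inv x"])
  qed simp
qed

lemma subdivring_inv_eq:
  assumes "subdivring K R" "x \<in> K" "x \<noteq> \<zero>"
  shows "inv\<^bsub>R\<lparr>carrier := K\<rparr>\<^esub> x = inv x"
proof -
  interpret K: divring "R\<lparr>carrier := K\<rparr>" by (rule subdivring_divring) fact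
  have "x \<in> carrier R" "inv x \<in> K"
    using assms subringE(1)[of K R] unfolding subdivring_def by auto
  then show ?thesis using assms K.inv_unique_nz[of x "inv x"] by simp
qed

lemma subdivringI:
  assumes "subring K R" "\<And>x. x \<in> K \<Longrightarrow> x \<noteq> \<zero> \<Longrightarrow> inv x \<in> K"
  shows "subdivring K R"
  using assms unfolding subdivring_def by auto

end

lemma subdivringE:
  assumes "subdivring K R"
  shows "subring K R" "K \<subseteq> carrier R" "\<zero>\<^bsub>R\<^esub> \<in> K" "\<one>\<^bsub>R\<^esub> \<in> K"
    and "\<And>x. x \<in> K \<Longrightarrow> \<ominus>\<^bsub>R\<^esub> x \<in> K"
    and "\<And>x y. x \<in> K \<Longrightarrow> y \<in> K \<Longrightarrow> x \<otimes>\<^bsub>R\<^esub> y \<in> K"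
    and "\<And>x y. x \<in> K \<Longrightarrow> y \<in> K \<Longrightarrow> x \<oplus>\<^bsub>R\<^esub> y \<in> K"
    and "\<And>x. x \<in> K \<Longrightarrow> x \<noteq> \<zero>\<^bsub>R\<^esub> \<Longrightarrow> inv\<^bsub>R\<^esub> x \<in> K"
  using assms subringE[of K R] unfolding subdivring_def by auto

text \<open>Turns statements about left coefficients into statements about right coefficients
  without a second proof; the sums are literally the same.\<close>

definition opp_ring :: "('a,'m) ring_scheme \<Rightarrow> ('a,'m) ring_scheme" where
  "opp_ring R = R\<lparr>monoid.mult := \<lambda>x y. y \<otimes>\<^bsub>R\<^esub> x\<rparr>"

lemma opp_ring_simps [simp]:
  "carrier (opp_ring R) = carrier R" "\<zero>\<^bsub>opp_ring R\<^esub> = \<zero>\<^bsub>R\<^esub>" "\<one>\<^bsub>opp_ring R\<^esub> = \<one>\<^bsub>R\<^esub>"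
  "x \<oplus>\<^bsub>opp_ring R\<^esub> y = x \<oplus>\<^bsub>R\<^esub> y" "x \<otimes>\<^bsub>opp_ring R\<^esub> y = y \<otimes>\<^bsub>R\<^esub> x"
  by (auto simp: opp_ring_def)

lemma finsum_opp_ring [simp]: "finsum (opp_ring R) = finsum R"
  by (rule ext)+ (simp add: finsum_def opp_ring_def)

lemma (in divring) divring_opp: "divring (opp_ring R)"
proof -
  interpret O: ring "opp_ring R"
  proof (intro ringI)
    show "abelian_group (opp_ring R)"
      by (intro abelian_groupI) (auto simp: a_ac intro: bexI[of _ "\<ominus> _"] l_neg)
    show "monoid (opp_ring R)" by (intro monoidI) (auto simp: m_assoc)
  qed (auto simp: l_distr r_distr)
  show ?thesis
  proof unfold_locales
    fix x assume "x \<in> carrier (opp_ring R)" "x \<noteq> \<zero>\<^bsub>opp_ring R\<^esub>"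
    then show "x \<in> Units (opp_ring R)"
      unfolding Units_def by (auto intro!: bexI[of _ "inv x"])
  qed simp
qed

context divring
begin

text \<open>Gaussian elimination, by induction on the equations, with the unknowns kept on the left
  of the coefficients.\<close>

lemma homogeneous_system:
  assumes "finite I" "finite J" "card I < card J"
    and "\<And>i j. i \<in> I \<Longrightarrow> j \<in> J \<Longrightarrow> a i j \<in> carrier R"
  shows "\<exists>x \<in> J \<rightarrow> carrier R. (\<exists>j\<in>J. x j \<noteq> \<zero>) \<and> (\<forall>i\<in>I. (\<Oplus>j\<in>J. x j \<otimes> a i j) = \<zero>)"
  using assms
proof (induction I arbitrary: J a rule: finite_induct)
  case empty
  then obtain j where "j \<in> J" by (metis card_gt_0_iff ex_in_conv card.empty)
  then show ?case by (intro bexI[of _ "\<lambda>_. \<one>"]) auto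
next
  case (insert i0 I)
  show ?case
  proof (cases "\<forall>j\<in>J. a i0 j = \<zero>")
    case True
    have "\<exists>x \<in> J \<rightarrow> carrier R. (\<exists>j\<in>J. x j \<noteq> \<zero>) \<and> (\<forall>i\<in>I. (\<Oplus>j\<in>J. x j \<otimes> a i j) = \<zero>)"
      using insert by (intro insert.IH) auto
    then obtain x where x: "x \<in> J \<rightarrow> carrier R" "\<exists>j\<in>J. x j \<noteq> \<zero>"
        "\<forall>i\<in>I. (\<Oplus>j\<in>J. x j \<otimes> a i j) = \<zero>" by blast
    have "(\<Oplus>j\<in>J. x j \<otimes> a i0 j) = \<zero>"
      by (rule add.finprod_one_eqI) (use True x(1) in \<open>auto simp: Pi_def\<close>)
    then show ?thesis using x by auto
  next
    case False
    then obtain j0 where j0: "j0 \<in> J" "a i0 j0 \<noteq> \<zero>" by auto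
    define J' where "J' = J - {j0}"
    have J: "J = insert j0 J'" "j0 \<notin> J'" "finite J'" using j0 insert.prems by (auto simp: J'_def)
    define p where "p = inv (a i0 j0)"
    have ac: "a i j \<in> carrier R" if "i \<in> insert i0 I" "j \<in> insert j0 J'" for i j
      using that insert.prems J by auto
    have p: "p \<in> carrier R" "p \<otimes> a i0 j0 = \<one>" using j0(2) ac by (auto simp: p_def)
    \<comment> \<open>Equation \<open>i0\<close> is solved for the unknown at \<open>j0\<close>,
      giving minus the sum of the \<open>x j \<otimes> a i0 j\<close>, multiplied by
      \<open>p\<close> on the right. Substitution into equation \<open>i\<close> leaves the
      coefficients \<open>a' i j\<close>; the order of the three factors is forced by the side of
      the unknowns.\<close>
    define a' where "a' i j = a i j \<ominus> a i0 j \<otimes> p \<otimes> a i j0" for i j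
    have "\<exists>x \<in> J' \<rightarrow> carrier R. (\<exists>j\<in>J'. x j \<noteq> \<zero>) \<and> (\<forall>i\<in>I. (\<Oplus>j\<in>J'. x j \<otimes> a' i j) = \<zero>)"
      using insert.prems insert.hyps p J ac by (intro insert.IH) (auto simp: a'_def)
    then obtain x where x: "x \<in> J' \<rightarrow> carrier R" "\<exists>j\<in>J'. x j \<noteq> \<zero>"
        "\<forall>i\<in>I. (\<Oplus>j\<in>J'. x j \<otimes> a' i j) = \<zero>" by blast
    have xc: "x j \<in> carrier R" if "j \<in> J'" for j using x(1) that by auto
    define s where "s = (\<Oplus>j\<in>J'. x j \<otimes> a i0 j)"
    have s: "s \<in> carrier R" using xc ac by (auto simp: s_def)
    define y where "y j = (if j = j0 then \<ominus> (s \<otimes> p) else x j)" for j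
    have sum: "(\<Oplus>j\<in>J. y j \<otimes> a i j) = \<ominus> (s \<otimes> p) \<otimes> a i j0 \<oplus> (\<Oplus>j\<in>J'. x j \<otimes> a i j)"
      if "i \<in> insert i0 I" for i
    proof -
      have "(\<Oplus>j\<in>J. y j \<otimes> a i j) = y j0 \<otimes> a i j0 \<oplus> (\<Oplus>j\<in>J'. y j \<otimes> a i j)"
        unfolding J(1) using that J xc ac s p by (subst finsum_insert) (auto simp: y_def)
      also have "(\<Oplus>j\<in>J'. y j \<otimes> a i j) = (\<Oplus>j\<in>J'. x j \<otimes> a i j)"
        using that J xc ac by (intro finsum_cong') (auto simp: y_def)
      finally show ?thesis by (simp add: y_def)
    qed
    have "(\<Oplus>j\<in>J. y j \<otimes> a i j) = \<zero>" if i: "i \<in> insert i0 I" for i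
    proof (cases "i = i0")
      case True
      have "\<ominus> (s \<otimes> p) \<otimes> a i0 j0 = \<ominus> s" using s p ac by (simp add: l_minus m_assoc)
      then show ?thesis using sum[OF i] True s by (simp add: s_def[symmetric] l_neg)
    next
      case False
      then have iI: "i \<in> I" using i by auto
      have "(\<Oplus>j\<in>J'. x j \<otimes> a' i j) = (\<Oplus>j\<in>J'. x j \<otimes> a i j \<ominus> (x j \<otimes> a i0 j) \<otimes> (p \<otimes> a i j0))"
        using iI xc ac p by (intro finsum_cong') (auto simp: a'_def a_minus_def r_distr r_minus m_assoc)
      also have "\<dots> = (\<Oplus>j\<in>J'. x j \<otimes> a i j) \<ominus> (\<Oplus>j\<in>J'. (x j \<otimes> a i0 j) \<otimes> (p \<otimes> a i j0))"
        using J iI xc ac p by (intro finsum_minusf) auto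
      also have "(\<Oplus>j\<in>J'. (x j \<otimes> a i0 j) \<otimes> (p \<otimes> a i j0)) = s \<otimes> (p \<otimes> a i j0)"
        unfolding s_def using J iI xc ac p by (intro finsum_ldistr[symmetric]) auto
      finally have e: "(\<Oplus>j\<in>J'. x j \<otimes> a i j) \<ominus> s \<otimes> (p \<otimes> a i j0) = \<zero>" using x(3) iI by simp
      have c: "(\<Oplus>j\<in>J'. x j \<otimes> a i j) \<in> carrier R" using xc ac i by auto
      have "\<ominus> (s \<otimes> p) \<otimes> a i j0 = \<ominus> (s \<otimes> (p \<otimes> a i j0))" using s p ac i by (simp add: l_minus m_assoc)
      then show ?thesis unfolding sum[OF i] using e c s p ac i by (simp add: a_minus_def a_comm)
    qed
    moreover have "y \<in> J \<rightarrow> carrier R" using xc s p by (auto simp: y_def J)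
    moreover have "\<exists>j\<in>J. y j \<noteq> \<zero>" using x(2) J by (auto simp: y_def)
    ultimately show ?thesis by blast
  qed
qed

end

lemma (in divring) homogeneous_system_right:
  assumes "finite I" "finite J" "card I < card J"
    and "\<And>i j. i \<in> I \<Longrightarrow> j \<in> J \<Longrightarrow> a i j \<in> carrier R"
  shows "\<exists>x \<in> J \<rightarrow> carrier R. (\<exists>j\<in>J. x j \<noteq> \<zero>) \<and> (\<forall>i\<in>I. (\<Oplus>j\<in>J. a i j \<otimes> x j) = \<zero>)"
  using divring.homogeneous_system[OF divring_opp, of I J a] assms by simp

lemma ring_hom_additive_finsum:
  assumes "ring R" "ring S" "\<phi> \<in> ring_hom R S" "finite A" "f \<in> A \<rightarrow> carrier R"
  shows "\<phi> (\<Oplus>\<^bsub>R\<^esub>i\<in>A. f i) = (\<Oplus>\<^bsub>S\<^esub>i\<in>A. \<phi> (f i))"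
proof -
  interpret R: ring R by fact
  show ?thesis
    by (rule R.finsum_additive[OF assms(2,4,5)])
       (auto intro: ring_hom_closed[OF assms(3)] ring_hom_add[OF assms(3)])
qed

section \<open>Artin's lemma, Dedekind independence, and the order of a generator\<close>

context divring
begin

text \<open>Among the nonzero solutions of the system with coefficients \<open>\<chi> i b\<close>,
  one of minimal support is scaled to contain the entry \<open>\<one>\<close>. For \<open>g\<close>
  in \<open>G\<close>, its difference from its image under \<open>g\<close> is again a solution, of
  smaller support, hence zero; so all entries are fixed. The index \<open>i0\<close> of the identity
  then gives the relation. The family \<open>\<chi>\<close> is abstract because it is used both for
  the powers of one automorphism and for a whole Galois group.\<close>

lemma artin_dependent:
  assumes I: "finite I" "i0 \<in> I" "\<And>x. x \<in> carrier R \<Longrightarrow> \<chi> i0 x = x"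
    and \<chi>: "\<And>i x. i \<in> I \<Longrightarrow> x \<in> carrier R \<Longrightarrow> \<chi> i x \<in> carrier R"
    and G: "\<And>g. g \<in> G \<Longrightarrow> g \<in> ring_hom R R"
    and perm: "\<And>g i. g \<in> G \<Longrightarrow> i \<in> I \<Longrightarrow> \<exists>i'\<in>I. \<forall>x\<in>carrier R. \<chi> i x = g (\<chi> i' x)"
    and B: "finite B" "B \<subseteq> carrier R" "card I < card B"
  shows "\<exists>a \<in> B \<rightarrow> {x \<in> carrier R. \<forall>g\<in>G. g x = x}.
           (\<exists>b\<in>B. a b \<noteq> \<zero>) \<and> (\<Oplus>b\<in>B. a b \<otimes> b) = \<zero>"
proof -
  define Sol where "Sol = {x \<in> B \<rightarrow> carrier R. (\<exists>b\<in>B. x b \<noteq> \<zero>) \<and> (\<forall>i\<in>I. (\<Oplus>b\<in>B. x b \<otimes> \<chi> i b) = \<zero>)}"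
  have "\<exists>x. x \<in> Sol"
    using homogeneous_system[OF I(1) B(1,3), of \<chi>] \<chi> B(2) by (auto simp: Sol_def subset_eq)
  then obtain x where x: "x \<in> Sol"
    and least: "\<And>y. y \<in> Sol \<Longrightarrow> card {b \<in> B. x b \<noteq> \<zero>} \<le> card {b \<in> B. y b \<noteq> \<zero>}"
    using ex_has_least_nat[of "\<lambda>x. x \<in> Sol" _ "\<lambda>x. card {b \<in> B. x b \<noteq> \<zero>}"] by blast
  have xc: "x b \<in> carrier R" if "b \<in> B" for b using x that by (auto simp: Sol_def)
  have xs: "(\<Oplus>b\<in>B. x b \<otimes> \<chi> i b) = \<zero>" if "i \<in> I" for i using x that by (auto simp: Sol_def)
  obtain b0 where b0: "b0 \<in> B" "x b0 \<noteq> \<zero>" using x by (auto simp: Sol_def)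
  have bc: "b \<in> carrier R" if "b \<in> B" for b using B that by auto
  define y where "y b = inv (x b0) \<otimes> x b" for b
  have yc: "y b \<in> carrier R" if "b \<in> B" for b using xc b0 that by (auto simp: y_def)
  have y1: "y b0 = \<one>" using xc b0 by (simp add: y_def)
  have ynz: "y b \<noteq> \<zero> \<longleftrightarrow> x b \<noteq> \<zero>" if "b \<in> B" for b using xc b0 that integral_nz[of "inv (x b0)" "x b"] by (auto simp: y_def)
  have ysum: "(\<Oplus>b\<in>B. y b \<otimes> \<chi> i b) = \<zero>" if i: "i \<in> I" for i
  proof -
    have "(\<Oplus>b\<in>B. y b \<otimes> \<chi> i b) = (\<Oplus>b\<in>B. inv (x b0) \<otimes> (x b \<otimes> \<chi> i b))"
      using xc b0 bc \<chi> i by (intro finsum_cong') (auto simp: y_def m_assoc)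
    also have "\<dots> = inv (x b0) \<otimes> (\<Oplus>b\<in>B. x b \<otimes> \<chi> i b)"
      using xc b0 bc \<chi> i B by (intro finsum_rdistr[symmetric]) auto
    finally show ?thesis using xs[OF i] xc b0 by simp
  qed
  have fix_y: "g (y b) = y b" if g: "g \<in> G" and b: "b \<in> B" for g b
  proof (rule ccontr)
    assume neq: "g (y b) \<noteq> y b"
    have gc: "g z \<in> carrier R" if "z \<in> carrier R" for z using ring_hom_closed[OF G[OF g] that] .
    define z where "z c = y c \<ominus> g (y c)" for c
    have zc: "z c \<in> carrier R" if "c \<in> B" for c using yc gc that by (auto simp: z_def)
    have gz: "g \<zero> = \<zero>" using ring_hom_zero[OF G[OF g]] ring_axioms by simp
    have zs: "(\<Oplus>c\<in>B. z c \<otimes> \<chi> i c) = \<zero>" if i: "i \<in> I" for i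
    proof -
      \<comment> \<open>As \<open>\<chi> i\<close> is \<open>g\<close> after
        \<open>\<chi> i'\<close>, applying \<open>g\<close> to equation \<open>i'\<close> yields
        equation \<open>i\<close> for the transformed coefficients.\<close>
      obtain i' where i': "i' \<in> I" "\<And>x. x \<in> carrier R \<Longrightarrow> \<chi> i x = g (\<chi> i' x)" using perm[OF g i] by blast
      have "(\<Oplus>c\<in>B. z c \<otimes> \<chi> i c) = (\<Oplus>c\<in>B. y c \<otimes> \<chi> i c \<ominus> g (y c) \<otimes> \<chi> i c)"
        using yc gc bc \<chi> i by (intro finsum_cong') (auto simp: z_def a_minus_def l_distr l_minus)
      also have "\<dots> = (\<Oplus>c\<in>B. y c \<otimes> \<chi> i c) \<ominus> (\<Oplus>c\<in>B. g (y c) \<otimes> \<chi> i c)"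
        using yc gc bc \<chi> i B by (intro finsum_minusf) auto
      also have "(\<Oplus>c\<in>B. g (y c) \<otimes> \<chi> i c) = (\<Oplus>c\<in>B. g (y c \<otimes> \<chi> i' c))"
        using yc gc bc \<chi> i' by (intro finsum_cong') (auto simp: ring_hom_mult[OF G[OF g]])
      also have "\<dots> = g (\<Oplus>c\<in>B. y c \<otimes> \<chi> i' c)"
        using yc bc \<chi> i' B by (intro ring_hom_additive_finsum[OF ring_axioms ring_axioms G[OF g], symmetric]) auto
      finally show ?thesis using ysum[OF i] ysum[OF i'(1)] gz by simp
    qed
    have zb: "z b \<noteq> \<zero>" using neq yc gc b by (auto simp: z_def)
    have zin: "z \<in> Sol" using zc zs zb b by (auto simp: Sol_def)
    have "{c \<in> B. z c \<noteq> \<zero>} \<subset> {c \<in> B. x c \<noteq> \<zero>}"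
    proof
      show "{c \<in> B. z c \<noteq> \<zero>} \<subseteq> {c \<in> B. x c \<noteq> \<zero>}"
      proof
        fix c assume "c \<in> {c \<in> B. z c \<noteq> \<zero>}"
        then have c: "c \<in> B" "z c \<noteq> \<zero>" by auto
        have "y c \<noteq> \<zero>" using c gz by (auto simp: z_def)
        then show "c \<in> {c \<in> B. x c \<noteq> \<zero>}" using c ynz by auto
      qed
      have "z b0 = \<zero>" using y1 ring_hom_one[OF G[OF g]] by (simp add: z_def)
      then show "{c \<in> B. z c \<noteq> \<zero>} \<noteq> {c \<in> B. x c \<noteq> \<zero>}" using b0 by auto
    qed
    then have "card {c \<in> B. z c \<noteq> \<zero>} < card {c \<in> B. x c \<noteq> \<zero>}" using B by (intro psubset_card_mono) auto
    then show False using least[OF zin] by simp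
  qed
  have "(\<Oplus>b\<in>B. y b \<otimes> b) = (\<Oplus>b\<in>B. y b \<otimes> \<chi> i0 b)"
    using yc bc I by (intro finsum_cong') auto
  then show ?thesis using ysum[OF I(2)] yc fix_y y1 b0 by (intro bexI[of _ y] conjI bexI[of _ b0]) auto
qed

text \<open>The usual argument with a shortest relation. Over a division ring it does not make two
  characters equal; it only provides a nonzero \<open>c\<close> that conjugates one into the
  other.\<close>

lemma dedekind_independent:
  assumes J: "finite J"
    and D: "\<one> \<in> D" "\<And>x y. x \<in> D \<Longrightarrow> y \<in> D \<Longrightarrow> x \<otimes> y \<in> D"
    and \<chi>c: "\<And>j x. j \<in> J \<Longrightarrow> x \<in> D \<Longrightarrow> \<chi> j x \<in> carrier R"
    and \<chi>1: "\<And>j. j \<in> J \<Longrightarrow> \<chi> j \<one> = \<one>"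
    and \<chi>m: "\<And>j x y. j \<in> J \<Longrightarrow> x \<in> D \<Longrightarrow> y \<in> D \<Longrightarrow> \<chi> j (x \<otimes> y) = \<chi> j x \<otimes> \<chi> j y"
    and a: "a \<in> J \<rightarrow> carrier R" "\<exists>j\<in>J. a j \<noteq> \<zero>" "\<And>x. x \<in> D \<Longrightarrow> (\<Oplus>j\<in>J. \<chi> j x \<otimes> a j) = \<zero>"
  shows "\<exists>i\<in>J. \<exists>j\<in>J. i \<noteq> j \<and> (\<exists>c\<in>carrier R. c \<noteq> \<zero> \<and> (\<forall>x\<in>D. \<chi> i x \<otimes> c = c \<otimes> \<chi> j x))"
proof -
  define Sol where "Sol = {a \<in> J \<rightarrow> carrier R. (\<exists>j\<in>J. a j \<noteq> \<zero>) \<and> (\<forall>x\<in>D. (\<Oplus>j\<in>J. \<chi> j x \<otimes> a j) = \<zero>)}"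
  have "a \<in> Sol" using a by (auto simp: Sol_def)
  then obtain x where x: "x \<in> Sol"
    and least: "\<And>y. y \<in> Sol \<Longrightarrow> card {b \<in> J. x b \<noteq> \<zero>} \<le> card {b \<in> J. y b \<noteq> \<zero>}"
    using ex_has_least_nat[of "\<lambda>x. x \<in> Sol" _ "\<lambda>x. card {b \<in> J. x b \<noteq> \<zero>}"] by blast
  have xc: "x b \<in> carrier R" if "b \<in> J" for b using x that by (auto simp: Sol_def)
  have xs: "(\<Oplus>j\<in>J. \<chi> j u \<otimes> x j) = \<zero>" if "u \<in> D" for u using x that by (auto simp: Sol_def)
  obtain j0 where j0: "j0 \<in> J" "x j0 \<noteq> \<zero>" using x by (auto simp: Sol_def)
  define p where "p = inv (x j0)"
  have p: "p \<in> carrier R" "p \<noteq> \<zero>" "x j0 \<otimes> p = \<one>" using xc j0 by (auto simp: p_def)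
  define y where "y b = x b \<otimes> p" for b
  have yc: "y b \<in> carrier R" if "b \<in> J" for b using xc p that by (auto simp: y_def)
  have ynz: "y b \<noteq> \<zero> \<longleftrightarrow> x b \<noteq> \<zero>" if "b \<in> J" for b using xc p that integral_nz[of "x b" p] by (auto simp: y_def)
  have ysum: "(\<Oplus>j\<in>J. \<chi> j u \<otimes> y j) = \<zero>" if i: "u \<in> D" for u
  proof -
    have "(\<Oplus>j\<in>J. \<chi> j u \<otimes> y j) = (\<Oplus>j\<in>J. (\<chi> j u \<otimes> x j) \<otimes> p)"
      using xc p \<chi>c i by (intro finsum_cong') (auto simp: y_def m_assoc)
    also have "\<dots> = (\<Oplus>j\<in>J. \<chi> j u \<otimes> x j) \<otimes> p"
      using xc p \<chi>c i J by (intro finsum_ldistr[symmetric]) auto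
    finally show ?thesis using xs[OF i] p by simp
  qed
  have comm: "\<chi> j v \<otimes> y j = y j \<otimes> \<chi> j0 v" if j: "j \<in> J" and v: "v \<in> D" for j v
  proof (rule ccontr)
    assume neq: "\<not> ?thesis"
    \<comment> \<open>The relation at \<open>u \<otimes> v\<close> minus the relation at
      \<open>u\<close> multiplied on the right by \<open>\<chi> j0 v\<close>. The normalised entry
      \<open>y j0 = \<one>\<close> makes the term at \<open>j0\<close> cancel.\<close>
    define z where "z j = \<chi> j v \<otimes> y j \<ominus> y j \<otimes> \<chi> j0 v" for j
    have zc: "z j \<in> carrier R" if "j \<in> J" for j using yc \<chi>c j0 v that by (auto simp: z_def)
    have zs: "(\<Oplus>j\<in>J. \<chi> j u \<otimes> z j) = \<zero>" if u: "u \<in> D" for u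
    proof -
      have "(\<Oplus>j\<in>J. \<chi> j u \<otimes> z j) = (\<Oplus>j\<in>J. \<chi> j (u \<otimes> v) \<otimes> y j \<ominus> (\<chi> j u \<otimes> y j) \<otimes> \<chi> j0 v)"
        using yc \<chi>c j0 v u \<chi>m by (intro finsum_cong') (auto simp: z_def a_minus_def r_distr r_minus m_assoc)
      also have "\<dots> = (\<Oplus>j\<in>J. \<chi> j (u \<otimes> v) \<otimes> y j) \<ominus> (\<Oplus>j\<in>J. (\<chi> j u \<otimes> y j) \<otimes> \<chi> j0 v)"
        using yc \<chi>c j0 v u D J by (intro finsum_minusf) auto
      also have "(\<Oplus>j\<in>J. (\<chi> j u \<otimes> y j) \<otimes> \<chi> j0 v) = (\<Oplus>j\<in>J. \<chi> j u \<otimes> y j) \<otimes> \<chi> j0 v"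
        using yc \<chi>c j0 v u J by (intro finsum_ldistr[symmetric]) auto
      finally show ?thesis using ysum[OF u] ysum[OF D(2)[OF u v]] \<chi>c j0 v by simp
    qed
    have zj: "z j \<noteq> \<zero>" using neq yc \<chi>c j v j0 by (auto simp: z_def)
    have zin: "z \<in> Sol" using zc zs zj j by (auto simp: Sol_def)
    have "{c \<in> J. z c \<noteq> \<zero>} \<subset> {c \<in> J. x c \<noteq> \<zero>}"
    proof
      show "{c \<in> J. z c \<noteq> \<zero>} \<subseteq> {c \<in> J. x c \<noteq> \<zero>}"
        using \<chi>c j0 v p by (auto simp: z_def y_def)
      have "z j0 = \<zero>" using j0 xc p \<chi>c v by (simp add: z_def y_def)
      then show "{c \<in> J. z c \<noteq> \<zero>} \<noteq> {c \<in> J. x c \<noteq> \<zero>}" using j0 by auto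
    qed
    then have "card {c \<in> J. z c \<noteq> \<zero>} < card {c \<in> J. x c \<noteq> \<zero>}" using J by (intro psubset_card_mono) auto
    then show False using least[OF zin] by simp
  qed
  \<comment> \<open>If only \<open>j0\<close> occurred, the relation evaluated at
    \<open>\<one>\<close> would read \<open>y j0 = \<zero>\<close>.\<close>
  have "\<exists>j\<in>J. j \<noteq> j0 \<and> y j \<noteq> \<zero>"
  proof (rule ccontr)
    assume n: "\<not> ?thesis"
    have "(\<Oplus>j\<in>J. \<chi> j \<one> \<otimes> y j) = \<chi> j0 \<one> \<otimes> y j0"
      by (rule finsum_delta) (use J j0 n yc \<chi>c D in auto)
    then show False using ysum[OF D(1)] \<chi>1[OF j0(1)] yc ynz j0 by auto
  qed
  then show ?thesis using comm yc j0(1) by blast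
qed

text \<open>With more homomorphisms than generators, linear algebra gives right coefficients
  \<open>a j\<close> for which the combination vanishes on \<open>B\<close>. As every
  \<open>\<chi> j\<close> fixes \<open>K\<close>, it vanishes on the whole left span of
  \<open>B\<close>, and Dedekind's argument applies.\<close>

lemma many_homs_conjugate:
  assumes J: "finite J" and B: "finite B" "B \<subseteq> D" "card B < card J"
    and D: "subring D R" and K: "K \<subseteq> D"
    and span: "\<And>x. x \<in> D \<Longrightarrow> \<exists>c\<in>B \<rightarrow> K. x = (\<Oplus>b\<in>B. c b \<otimes> b)"
    and \<chi>: "\<And>j. j \<in> J \<Longrightarrow> \<chi> j \<in> ring_hom (R\<lparr>carrier := D\<rparr>) R"
    and \<chi>K: "\<And>j x. j \<in> J \<Longrightarrow> x \<in> K \<Longrightarrow> \<chi> j x = x"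
  shows "\<exists>i\<in>J. \<exists>j\<in>J. i \<noteq> j \<and> (\<exists>c\<in>carrier R. c \<noteq> \<zero> \<and> (\<forall>x\<in>D. \<chi> i x \<otimes> c = c \<otimes> \<chi> j x))"
proof -
  note Dr = subringE[OF D]
  have \<chi>c: "\<chi> j x \<in> carrier R" if "j \<in> J" "x \<in> D" for j x
    using ring_hom_closed[OF \<chi>[OF that(1)]] that by auto
  have \<chi>m: "\<chi> j (x \<otimes> y) = \<chi> j x \<otimes> \<chi> j y" if "j \<in> J" "x \<in> D" "y \<in> D" for j x y
    using ring_hom_mult[OF \<chi>[OF that(1)]] that by auto
  have \<chi>a: "\<chi> j (x \<oplus> y) = \<chi> j x \<oplus> \<chi> j y" if "j \<in> J" "x \<in> D" "y \<in> D" for j x y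
    using ring_hom_add[OF \<chi>[OF that(1)]] that by auto
  obtain a where a: "a \<in> J \<rightarrow> carrier R" "\<exists>j\<in>J. a j \<noteq> \<zero>" "\<And>b. b \<in> B \<Longrightarrow> (\<Oplus>j\<in>J. \<chi> j b \<otimes> a j) = \<zero>"
    using homogeneous_system_right[OF B(1) J B(3), of "\<lambda>b j. \<chi> j b"] \<chi>c B(2) by (meson subsetD)
  have ac: "a j \<in> carrier R" if "j \<in> J" for j using a that by auto
  have "(\<Oplus>j\<in>J. \<chi> j x \<otimes> a j) = \<zero>" if x: "x \<in> D" for x
  proof -
    obtain c where c: "c \<in> B \<rightarrow> K" "x = (\<Oplus>b\<in>B. c b \<otimes> b)" using span[OF x] by blast
    have cK: "c b \<in> K" "c b \<in> D" "c b \<in> carrier R" "b \<in> D" "b \<in> carrier R" if "b \<in> B" for b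
      using c that K B Dr(1) by auto
    have "\<chi> j x \<otimes> a j = (\<Oplus>b\<in>B. c b \<otimes> (\<chi> j b \<otimes> a j))" if j: "j \<in> J" for j
    proof -
      have "\<chi> j x = (\<Oplus>b\<in>B. \<chi> j (c b \<otimes> b))" unfolding c(2)
        by (rule finsum_additive[OF ring_axioms B(1), of _ D])
           (use cK Dr \<chi>c \<chi>a j in auto)
      also have "\<dots> = (\<Oplus>b\<in>B. c b \<otimes> \<chi> j b)"
        using cK \<chi>c \<chi>m \<chi>K j by (intro finsum_cong') auto
      finally have "\<chi> j x \<otimes> a j = (\<Oplus>b\<in>B. (c b \<otimes> \<chi> j b) \<otimes> a j)"
        using cK \<chi>c j ac B by (simp add: finsum_ldistr Pi_def)
      also have "\<dots> = (\<Oplus>b\<in>B. c b \<otimes> (\<chi> j b \<otimes> a j))"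
        using cK \<chi>c ac j by (intro finsum_cong') (auto simp: m_assoc)
      finally show ?thesis .
    qed
    then have "(\<Oplus>j\<in>J. \<chi> j x \<otimes> a j) = (\<Oplus>j\<in>J. \<Oplus>b\<in>B. c b \<otimes> (\<chi> j b \<otimes> a j))"
      using cK \<chi>c ac x by (intro finsum_cong') auto
    also have "\<dots> = (\<Oplus>b\<in>B. \<Oplus>j\<in>J. c b \<otimes> (\<chi> j b \<otimes> a j))"
      using J B cK \<chi>c ac by (intro finsum_swap) auto
    also have "\<dots> = (\<Oplus>b\<in>B. c b \<otimes> (\<Oplus>j\<in>J. \<chi> j b \<otimes> a j))"
      using J B cK \<chi>c ac by (intro finsum_cong') (auto simp: finsum_rdistr Pi_def)
    also have "\<dots> = \<zero>" using a(3) cK by (intro add.finprod_one_eqI) auto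
    finally show ?thesis .
  qed
  then show ?thesis
    by (intro dedekind_independent[OF J Dr(3,6), of \<chi> a])
       (use \<chi>c \<chi>m ring_hom_one[OF \<chi>] a in auto)
qed

lemma ring_iso_funpow:
  assumes "s \<in> ring_iso R R" shows "(s ^^ i) \<in> ring_iso R R"
proof (induction i)
  case 0 show ?case by (auto simp: ring_iso_def ring_hom_def bij_betw_def)
next
  case (Suc i)
  then show ?case using assms unfolding funpow.simps by (intro ring_iso_set_trans)
qed

lemma funpow_dvd_id:
  assumes "\<And>x. x \<in> A \<Longrightarrow> (s ^^ e) x = x" "e dvd m" "x \<in> A"
  shows "(s ^^ m) x = x"
proof -
  obtain q where q: "m = e * q" using assms by auto
  have "((s ^^ e) ^^ q) x = x" by (induction q) (use assms in auto)
  then show ?thesis by (simp add: q funpow_mult mult.commute)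
qed

text \<open>Two of the powers of \<open>s\<close> with exponent at most \<open>card B\<close> are
  conjugate by some \<open>c\<close>. Both fix \<open>k\<close>, so \<open>c\<close> commutes with
  \<open>k\<close>, and outerness makes \<open>c\<close> central: the two powers agree, and the
  order is at most \<open>card B\<close>. Artin's lemma for the powers below the order gives the
  reverse inequality.\<close>

lemma cyclic_outer_order:
  assumes s: "s \<in> ring_iso R R" and fx: "{x \<in> carrier R. s x = x} = k"
    and out: "outer R k"
    and B: "finite B" "B \<subseteq> carrier R"
      "\<And>a. a \<in> B \<rightarrow> k \<Longrightarrow> (\<Oplus>b\<in>B. a b \<otimes> b) = \<zero> \<Longrightarrow> \<forall>b\<in>B. a b = \<zero>"
      "\<And>x. x \<in> carrier R \<Longrightarrow> \<exists>a\<in>B \<rightarrow> k. x = (\<Oplus>b\<in>B. a b \<otimes> b)"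
  shows "0 < card B" "\<And>x. x \<in> carrier R \<Longrightarrow> (s ^^ card B) x = x"
    and "\<And>m. (\<And>x. x \<in> carrier R \<Longrightarrow> (s ^^ m) x = x) \<Longrightarrow> card B dvd m"
proof -
  have si: "(s ^^ i) \<in> ring_iso R R" for i using ring_iso_funpow[OF s] .
  have sh: "(s ^^ i) \<in> ring_hom R R" and sbij: "bij_betw (s ^^ i) (carrier R) (carrier R)" for i
    using si[of i] by (auto simp: ring_iso_def)
  have sc: "(s ^^ i) x \<in> carrier R" if "x \<in> carrier R" for i x
    using ring_hom_closed[OF sh that] .
  have sk: "(s ^^ i) x = x" if "x \<in> k" for i x using that fx by (induction i) auto
  have kc: "k \<subseteq> carrier R" using fx by auto
  \<comment> \<open>The index set includes the bound itself: it has \<open>card B + 1\<close>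
    elements, one more than the spanning set.\<close>
  have "\<exists>i\<in>{..card B}. \<exists>j\<in>{..card B}. i \<noteq> j \<and> (\<exists>c\<in>carrier R. c \<noteq> \<zero> \<and> (\<forall>x\<in>carrier R. (s ^^ i) x \<otimes> c = c \<otimes> (s ^^ j) x))"
    by (rule many_homs_conjugate[OF _ B(1,2) _ carrier_is_subring kc B(4)]) (use sh sk in auto)
  then obtain i j c where ij: "i \<le> card B" "j \<le> card B" "i \<noteq> j" "c \<in> carrier R" "c \<noteq> \<zero>"
    and conj: "\<And>x. x \<in> carrier R \<Longrightarrow> (s ^^ i) x \<otimes> c = c \<otimes> (s ^^ j) x" by auto
  have cent: "c \<otimes> x = x \<otimes> c" if x: "x \<in> carrier R" for x
  proof -
    have "c \<otimes> y \<otimes> inv c = y" if y: "y \<in> k" for y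
    proof -
      have "c \<otimes> y = y \<otimes> c" using conj[of y] sk[OF y] y kc by auto
      then have "c \<otimes> y \<otimes> inv c = y \<otimes> (c \<otimes> inv c)" using ij y kc by (auto simp: m_assoc)
      then show ?thesis using ij y kc by auto
    qed
    then have e: "c \<otimes> x \<otimes> inv c = x" using out nz_Units ij x unfolding outer_def by blast
    have "c \<otimes> x = c \<otimes> x \<otimes> (inv c \<otimes> c)" using ij x by simp
    also have "\<dots> = (c \<otimes> x \<otimes> inv c) \<otimes> c" using ij(4,5) x by (simp add: m_assoc)
    finally show ?thesis using e by simp
  qed
  have eq: "(s ^^ i) x = (s ^^ j) x" if x: "x \<in> carrier R" for x
    using conj[OF x] cent[OF sc[OF x, of i]] m_lcancel_nz[OF sc[OF x] sc[OF x] ij(4,5), of i j] by simp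
  \<comment> \<open>The powers \<open>m\<close> and \<open>n + m\<close> agree; since the power
    \<open>m\<close> is surjective, it can be removed, which leaves the power \<open>n\<close> equal
    to the identity.\<close>
  define m n where "m = min i j" and "n = max i j - min i j"
  have mn: "max i j = n + m" "0 < n" "n \<le> card B" using ij by (auto simp: m_def n_def)
  have mx: "(s ^^ m) x = (s ^^ n) ((s ^^ m) x)" if x: "x \<in> carrier R" for x
  proof -
    have "(s ^^ m) x = (s ^^ (n + m)) x"
      using eq[OF x] mn(1) unfolding m_def by (metis max_def min_def)
    then show ?thesis by (simp add: funpow_add)
  qed
  have nid: "(s ^^ n) x = x" if x: "x \<in> carrier R" for x
  proof -
    obtain y where "y \<in> carrier R" "x = (s ^^ m) y" using sbij[of m] x by (auto simp: bij_betw_def)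
    then show ?thesis using mx[of y] by simp
  qed
  define e where "e = (LEAST e. 0 < e \<and> (\<forall>x\<in>carrier R. (s ^^ e) x = x))"
  have e: "0 < e" "\<And>x. x \<in> carrier R \<Longrightarrow> (s ^^ e) x = x"
    using LeastI[of "\<lambda>e. 0 < e \<and> (\<forall>x\<in>carrier R. (s ^^ e) x = x)" n] nid mn by (auto simp: e_def)
  have least: "\<not> (0 < m \<and> (\<forall>x\<in>carrier R. (s ^^ m) x = x))" if "m < e" for m
    using not_less_Least[of m] that unfolding e_def by blast
  have "e \<le> n" using nid mn unfolding e_def by (intro Least_le) auto
  then have le: "e \<le> card B" using mn by simp
  have "card B \<le> e"
  proof (rule ccontr)
    assume "\<not> card B \<le> e"
    then have lt: "card {..<e} < card B" by simp
    \<comment> \<open>Multiplication by \<open>s\<close> permutes the \<open>e\<close> powers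
      cyclically; exponent \<open>0\<close> is reached from \<open>e - 1\<close> because the power
      \<open>e\<close> is the identity.\<close>
    have perm: "\<exists>i'\<in>{..<e}. \<forall>x\<in>carrier R. (s ^^ i) x = g ((s ^^ i') x)" if "g \<in> {s}" "i \<in> {..<e}" for g i
    proof (cases i)
      case 0
      have "(s ^^ e) x = s ((s ^^ (e - 1)) x)" for x using e(1) by (cases e) auto
      then show ?thesis using that 0 e by (intro bexI[of _ "e - 1"]) auto
    next
      case (Suc i') then show ?thesis using that by (intro bexI[of _ i']) auto
    qed
    obtain a where a: "a \<in> B \<rightarrow> {x \<in> carrier R. \<forall>g\<in>{s}. g x = x}" "\<exists>b\<in>B. a b \<noteq> \<zero>" "(\<Oplus>b\<in>B. a b \<otimes> b) = \<zero>"
    proof -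
      have "\<exists>a \<in> B \<rightarrow> {x \<in> carrier R. \<forall>g\<in>{s}. g x = x}. (\<exists>b\<in>B. a b \<noteq> \<zero>) \<and> (\<Oplus>b\<in>B. a b \<otimes> b) = \<zero>"
        by (rule artin_dependent[OF _ _ _ sc _ perm B(1,2) lt, of 0]) (use e(1) sh[of 1] in auto)
      then show thesis using that by blast
    qed
    have "a \<in> B \<rightarrow> k" using a(1) fx by auto
    then show False using B(3) a by blast
  qed
  then have eB: "e = card B" using le by simp
  then show "0 < card B" "\<And>x. x \<in> carrier R \<Longrightarrow> (s ^^ card B) x = x" using e by auto
  show "card B dvd m" if m: "\<And>x. x \<in> carrier R \<Longrightarrow> (s ^^ m) x = x" for m
  proof (rule ccontr)
    assume n: "\<not> ?thesis"
    have "(s ^^ (m mod e)) x = x" if x: "x \<in> carrier R" for x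
    proof -
      have d: "(s ^^ (m div e * e)) y = y" if "y \<in> carrier R" for y
        using funpow_dvd_id[of "carrier R" e s "m div e * e" y] e that by auto
      have "(s ^^ m) x = (s ^^ (m mod e)) ((s ^^ (m div e * e)) x)"
        by (metis comp_apply funpow_add mod_div_mult_eq)
      then show ?thesis using d m x by simp
    qed
    then show False using least[of "m mod e"] e n eB by (auto simp: mod_eq_0_iff_dvd[symmetric])
  qed
qed

end

section \<open>Existence of the exponent sequence\<close>

lemma coprime_chain_exists:
  fixes d :: "nat \<Rightarrow> nat"
  assumes pos: "\<And>n. 0 < d n" and dv: "\<And>n. d n dvd d (Suc n)"
    and cop: "\<And>n. coprime (d (Suc n) div d n) (d n)"
  shows "\<exists>l :: nat \<Rightarrow> nat. \<forall>n. 0 < l n \<and> l n dvd l (Suc n) \<and>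
            d n dvd (l (Suc n) div l n - 1) \<and> d n dvd l n"
proof -
  have "\<exists>r>0. d n dvd (r - 1) \<and> (d (Suc n) div d n) dvd r" for n
  proof -
    let ?e = "d (Suc n) div d n"
    have e0: "0 < ?e" using pos dv[of n] by (auto elim!: dvdE simp: ) (metis pos mult_0_right neq0_conv)
    \<comment> \<open>Bezout in the natural numbers: the multiple \<open>?e * x\<close> of
      \<open>?e\<close> is \<open>1\<close> modulo \<open>d n\<close>, so it serves as the factor
      \<open>r\<close>.\<close>
    obtain x y where xy: "?e * x = d n * y + 1"
      using bezout_nat[of ?e "d n"] e0 cop[of n] by (auto simp: coprime_iff_gcd_eq_1)
    have "?e * x - 1 = d n * y" "0 < ?e * x" using xy by auto
    then show ?thesis by (intro exI[of _ "?e * x"]) auto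
  qed
  then obtain r where r: "\<And>n. r n > 0" "\<And>n. d n dvd (r n - 1)" "\<And>n. (d (Suc n) div d n) dvd r n" by metis
  \<comment> \<open>The start \<open>d 0\<close> makes the divisibility of \<open>l n\<close> by
    \<open>d n\<close> hold at \<open>0\<close>; each factor \<open>r n\<close> then supplies the
    missing quotient \<open>d (Suc n) div d n\<close>.\<close>
  define l where "l n = d 0 * (\<Prod>i<n. r i)" for n
  have ls: "l (Suc n) = l n * r n" for n by (simp add: l_def)
  have l0: "l n > 0" for n using pos r by (auto simp: l_def)
  have dl: "d n dvd l n" for n
  proof (induction n)
    case 0 show ?case by (simp add: l_def)
  next
    case (Suc n)
    have "d (Suc n) = d n * (d (Suc n) div d n)" using dv[of n] by simp
    then show ?case using Suc r(3)[of n] unfolding ls by (metis mult_dvd_mono)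
  qed
  show ?thesis using l0 dl ls r by (intro exI[of _ l]) auto
qed

section \<open>Galois groups under ring isomorphisms\<close>

lemma Gal_iff:
  "g \<in> carrier (Gal R K) \<longleftrightarrow> g \<in> ring_iso R R \<and> g \<in> extensional (carrier R) \<and> (\<forall>x\<in>K. g x = x)"
  by (simp add: Gal_def)

lemma Gal_simps [simp]:
  "g \<otimes>\<^bsub>Gal R K\<^esub> f = compose (carrier R) g f" "\<one>\<^bsub>Gal R K\<^esub> = restrict id (carrier R)"
  by (simp_all add: Gal_def)

lemma Gal_fix: "g \<in> carrier (Gal R K) \<Longrightarrow> x \<in> K \<Longrightarrow> g x = x"
  and Gal_hom: "g \<in> carrier (Gal R K) \<Longrightarrow> g \<in> ring_hom R R"
  and Gal_bij: "g \<in> carrier (Gal R K) \<Longrightarrow> bij_betw g (carrier R) (carrier R)"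
  and Gal_ext: "g \<in> carrier (Gal R K) \<Longrightarrow> g \<in> extensional (carrier R)"
  by (auto simp: Gal_iff ring_iso_def)

lemma Gal_closed: "g \<in> carrier (Gal R K) \<Longrightarrow> x \<in> carrier R \<Longrightarrow> g x \<in> carrier R"
  using ring_hom_closed[OF Gal_hom] .

text \<open>Elements of \<open>Gal\<close> are extensional, so composites and inverses occur there
  only restricted to the carrier. This passes the isomorphism property from the unrestricted maps to
  the restricted ones.\<close>

lemma ring_iso_cong:
  assumes "ring R" "f \<in> ring_iso R S" "\<And>x. x \<in> carrier R \<Longrightarrow> g x = f x"
  shows "g \<in> ring_iso R S"
proof -
  interpret ring R by fact
  have "bij_betw g (carrier R) (carrier S)"
    using assms bij_betw_cong[of "carrier R" g f "carrier S"] by (auto simp: ring_iso_def)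
  then show ?thesis using assms by (auto simp: ring_iso_def ring_hom_def Pi_def)
qed

lemma restrict_Gal_conjugate:
  assumes "ring R" "ring S" "j \<in> ring_iso R S" "K \<subseteq> carrier R" "g \<in> carrier (Gal R K)"
  shows "(\<lambda>y\<in>carrier S. j (g (inv_into (carrier R) j y))) \<in> carrier (Gal S (j ` K))"
proof -
  interpret R: ring R by fact
  have j': "inv_into (carrier R) j \<in> ring_iso S R" by (rule ring_iso_set_sym[OF assms(1,3)])
  have "(j \<circ> g) \<circ> inv_into (carrier R) j \<in> ring_iso S S"
    using assms j' by (intro ring_iso_set_trans[OF j'] ring_iso_set_trans[of g R R j S]) (auto simp: Gal_iff)
  then have 1: "(\<lambda>y\<in>carrier S. j (g (inv_into (carrier R) j y))) \<in> ring_iso S S"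
    by (rule ring_iso_cong[OF assms(2)]) auto
  have "inj_on j (carrier R)" "j ` carrier R = carrier S"
    using assms(3) by (auto simp: ring_iso_def bij_betw_def)
  then have "(\<lambda>y\<in>carrier S. j (g (inv_into (carrier R) j y))) (j x) = j x" if "x \<in> K" for x
    using that assms(4) Gal_fix[OF assms(5) that] by (auto simp: inv_into_f_f subset_eq)
  then show ?thesis using 1 by (auto simp: Gal_iff)
qed

lemma Gal_group:
  assumes "ring R" "K \<subseteq> carrier R" shows "group (Gal R K)"
proof (rule groupI)
  interpret R: ring R by fact
  fix f g assume f: "f \<in> carrier (Gal R K)" and g: "g \<in> carrier (Gal R K)"
  have "compose (carrier R) f g \<in> ring_iso R R"
    by (rule ring_iso_cong[OF assms(1) ring_iso_set_trans[of g R R f R]])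
       (use f g in \<open>auto simp: Gal_iff compose_def\<close>)
  then show "f \<otimes>\<^bsub>Gal R K\<^esub> g \<in> carrier (Gal R K)"
    using f g assms(2) by (auto simp: Gal_iff compose_def)
next
  interpret R: ring R by fact
  show "\<one>\<^bsub>Gal R K\<^esub> \<in> carrier (Gal R K)"
    using assms(2) ring_iso_cong[OF assms(1) ring_iso_set_refl, of "restrict id (carrier R)"]
    by (auto simp: Gal_iff)
next
  fix x y z assume "x \<in> carrier (Gal R K)" "y \<in> carrier (Gal R K)" "z \<in> carrier (Gal R K)"
  then show "x \<otimes>\<^bsub>Gal R K\<^esub> y \<otimes>\<^bsub>Gal R K\<^esub> z = x \<otimes>\<^bsub>Gal R K\<^esub> (y \<otimes>\<^bsub>Gal R K\<^esub> z)"
    by (auto simp: compose_def Gal_closed intro!: ext)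
next
  fix x assume x: "x \<in> carrier (Gal R K)"
  then show "\<one>\<^bsub>Gal R K\<^esub> \<otimes>\<^bsub>Gal R K\<^esub> x = x"
    using Gal_ext[OF x] by (auto simp: compose_def Gal_closed extensional_def intro!: ext)
  let ?y = "\<lambda>y\<in>carrier R. inv_into (carrier R) x y"
  have "?y \<in> ring_iso R R"
    by (rule ring_iso_cong[OF assms(1) ring_iso_set_sym[OF assms(1), of x]]) (use x in \<open>auto simp: Gal_iff\<close>)
  moreover have "?y k = k" if k: "k \<in> K" for k
    using Gal_fix[OF x k] Gal_bij[OF x] k assms(2)
    by (metis bij_betw_def inv_into_f_f restrict_apply' subsetD)
  ultimately have "?y \<in> carrier (Gal R K)" by (auto simp: Gal_iff)
  moreover have "?y \<otimes>\<^bsub>Gal R K\<^esub> x = \<one>\<^bsub>Gal R K\<^esub>"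
    using Gal_bij[OF x] Gal_closed[OF x] by (auto simp: compose_def bij_betw_def intro!: ext)
  ultimately show "\<exists>y\<in>carrier (Gal R K). y \<otimes>\<^bsub>Gal R K\<^esub> x = \<one>\<^bsub>Gal R K\<^esub>" by blast
qed

section \<open>Transport of Galois, outer and division properties along a ring isomorphism\<close>

context
  fixes R :: "('a,'m) ring_scheme" and S :: "('b,'n) ring_scheme" and j K
  assumes R: "ring R" and S: "ring S" and j: "j \<in> ring_iso R S" and K: "K \<subseteq> carrier R"
begin

interpretation R: ring R by (rule R)
interpretation S: ring S by (rule S)

private abbreviation "j' \<equiv> inv_into (carrier R) j"

lemma ring_iso_inv_facts:
  shows "j' \<in> ring_iso S R" "inj_on j (carrier R)" "j ` carrier R = carrier S"
    "\<And>x. x \<in> carrier R \<Longrightarrow> j x \<in> carrier S" "\<And>x. x \<in> carrier S \<Longrightarrow> j' x \<in> carrier R"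
    "\<And>x. x \<in> carrier R \<Longrightarrow> j' (j x) = x" "\<And>x. x \<in> carrier S \<Longrightarrow> j (j' x) = x"
    "j' ` j ` K = K"
proof -
  show 1: "j' \<in> ring_iso S R" by (rule ring_iso_set_sym[OF R j])
  show 2: "inj_on j (carrier R)" and 3: "j ` carrier R = carrier S" using j by (auto simp: ring_iso_def bij_betw_def)
  show "\<And>x. x \<in> carrier R \<Longrightarrow> j x \<in> carrier S" "\<And>x. x \<in> carrier S \<Longrightarrow> j' x \<in> carrier R"
    using 3 inv_into_into[of _ j "carrier R"] by (blast, metis)
  show "\<And>x. x \<in> carrier R \<Longrightarrow> j' (j x) = x" "\<And>x. x \<in> carrier S \<Longrightarrow> j (j' x) = x"
    using 2 3 by (simp, metis f_inv_into_f)
  then show "j' ` j ` K = K" using K by (simp add: image_image subset_eq)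
qed

lemma inv_into_inv_into: "x \<in> carrier R \<Longrightarrow> inv_into (carrier S) j' x = j x"
  by (metis ring_iso_inv_facts(1,4,6) bij_betw_def inv_into_f_f ring_iso_memE(5))

lemma Gal_conjugate_back:
  assumes "g \<in> carrier (Gal S (j ` K))"
  shows "(\<lambda>x\<in>carrier R. j' (g (j x))) \<in> carrier (Gal R K)"
proof -
  have "(\<lambda>y\<in>carrier R. j' (g (inv_into (carrier S) j' y))) \<in> carrier (Gal R (j' ` j ` K))"
    by (rule restrict_Gal_conjugate[OF S R ring_iso_inv_facts(1) _ assms]) (use K ring_iso_inv_facts(4) in auto)
  moreover have "(\<lambda>y\<in>carrier R. j' (g (inv_into (carrier S) j' y))) = (\<lambda>x\<in>carrier R. j' (g (j x)))"
    using inv_into_inv_into by (intro restrict_ext) simp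
  ultimately show ?thesis unfolding ring_iso_inv_facts(8) by simp
qed

lemma Gal_iso_image: "Gal R K \<cong> Gal S (j ` K)"
proof -
  let ?\<Phi> = "\<lambda>g. \<lambda>y\<in>carrier S. j (g (j' y))"
  let ?\<Psi> = "\<lambda>g. \<lambda>x\<in>carrier R. j' (g (j x))"
  have c: "?\<Phi> g \<in> carrier (Gal S (j ` K))" if "g \<in> carrier (Gal R K)" for g
    using restrict_Gal_conjugate[OF R S j K that] .
  have "?\<Phi> \<in> hom (Gal R K) (Gal S (j ` K))"
  proof (rule homI)
    fix f g assume f: "f \<in> carrier (Gal R K)" and g: "g \<in> carrier (Gal R K)"
    show "?\<Phi> (f \<otimes>\<^bsub>Gal R K\<^esub> g) = ?\<Phi> f \<otimes>\<^bsub>Gal S (j ` K)\<^esub> ?\<Phi> g"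
      by (auto simp: compose_def ring_iso_inv_facts(4-7) Gal_closed[OF g] Gal_closed[OF f] intro!: ext)
  qed (use c in auto)
  moreover have "bij_betw ?\<Phi> (carrier (Gal R K)) (carrier (Gal S (j ` K)))"
  proof (rule bij_betwI[of _ _ _ ?\<Psi>])
    show "?\<Phi> \<in> carrier (Gal R K) \<rightarrow> carrier (Gal S (j ` K))" using c by auto
    show "?\<Psi> \<in> carrier (Gal S (j ` K)) \<rightarrow> carrier (Gal R K)" using Gal_conjugate_back by auto
    show "?\<Psi> (?\<Phi> g) = g" if g: "g \<in> carrier (Gal R K)" for g
      using Gal_ext[OF g] Gal_closed[OF g] by (auto simp: ring_iso_inv_facts(4-7) extensional_def intro!: ext)
    show "?\<Phi> (?\<Psi> g) = g" if g: "g \<in> carrier (Gal S (j ` K))" for g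
      using Gal_ext[OF g] Gal_closed[OF g] by (auto simp: ring_iso_inv_facts(4-7) extensional_def intro!: ext)
  qed
  ultimately show ?thesis unfolding is_iso_def iso_def by auto
qed

lemma galois_image:
  assumes "galois R K" shows "galois S (j ` K)"
proof -
  have "y \<in> j ` K" if y: "y \<in> carrier S" "\<forall>g\<in>carrier (Gal S (j ` K)). g y = y" for y
  proof -
    have "g (j' y) = j' y" if g: "g \<in> carrier (Gal R K)" for g
    proof -
      have "(\<lambda>y\<in>carrier S. j (g (j' y))) y = y"
        using y restrict_Gal_conjugate[OF R S j K g] by blast
      then have "j' (j (g (j' y))) = j' y" using y(1) by simp
      then show ?thesis using y(1) Gal_closed[OF g] ring_iso_inv_facts(4-7) by simp
    qed
    then have "j' y \<in> K" using assms y(1) ring_iso_inv_facts(5) unfolding galois_def by blast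
    then show ?thesis using y(1) ring_iso_inv_facts(7) by (metis image_eqI)
  qed
  moreover have "j ` K \<subseteq> carrier S" using K ring_iso_inv_facts(4) by auto
  ultimately show ?thesis unfolding galois_def using Gal_fix[of _ S "j ` K"] by blast
qed

lemma outer_image:
  assumes "outer R K" shows "outer S (j ` K)"
  unfolding outer_def
proof (intro ballI impI)
  fix u x assume u: "u \<in> Units S" and fx: "\<forall>x\<in>j ` K. u \<otimes>\<^bsub>S\<^esub> x \<otimes>\<^bsub>S\<^esub> inv\<^bsub>S\<^esub> u = x" and x: "x \<in> carrier S"
  note hj = ring_iso_memE[OF j] and hj' = ring_iso_memE[OF ring_iso_inv_facts(1)]
  let ?u = "j' u" and ?v = "j' (inv\<^bsub>S\<^esub> u)"
  have uc: "u \<in> carrier S" "inv\<^bsub>S\<^esub> u \<in> carrier S" using u by auto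
  have v: "?u \<in> carrier R" "?v \<in> carrier R" "?u \<otimes>\<^bsub>R\<^esub> ?v = \<one>\<^bsub>R\<^esub>" "?v \<otimes>\<^bsub>R\<^esub> ?u = \<one>\<^bsub>R\<^esub>"
    using u uc hj'(1) hj'(2)[OF uc(1,2)] hj'(2)[OF uc(2,1)] hj'(4) by auto
  have uU: "?u \<in> Units R" and inv: "inv\<^bsub>R\<^esub> ?u = ?v" using v R.inv_char by (auto simp: Units_def)
  have tr: "?u \<otimes>\<^bsub>R\<^esub> j' y \<otimes>\<^bsub>R\<^esub> ?v = j' (u \<otimes>\<^bsub>S\<^esub> y \<otimes>\<^bsub>S\<^esub> inv\<^bsub>S\<^esub> u)" if "y \<in> carrier S" for y
    using uc that hj'(2) by auto
  have "?u \<otimes>\<^bsub>R\<^esub> y \<otimes>\<^bsub>R\<^esub> inv\<^bsub>R\<^esub> ?u = y" if y: "y \<in> K" for y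
    using tr[of "j y"] fx y K ring_iso_inv_facts(4,6) inv by (auto simp: subset_eq)
  then have "?u \<otimes>\<^bsub>R\<^esub> j' x \<otimes>\<^bsub>R\<^esub> inv\<^bsub>R\<^esub> ?u = j' x" using assms uU x ring_iso_inv_facts(5) unfolding outer_def by blast
  then have "j' (u \<otimes>\<^bsub>S\<^esub> x \<otimes>\<^bsub>S\<^esub> inv\<^bsub>S\<^esub> u) = j' x" using tr[OF x] inv by simp
  then have "j (j' (u \<otimes>\<^bsub>S\<^esub> x \<otimes>\<^bsub>S\<^esub> inv\<^bsub>S\<^esub> u)) = j (j' x)" by simp
  moreover have "u \<otimes>\<^bsub>S\<^esub> x \<otimes>\<^bsub>S\<^esub> inv\<^bsub>S\<^esub> u \<in> carrier S" using uc x by simp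
  ultimately show "u \<otimes>\<^bsub>S\<^esub> x \<otimes>\<^bsub>S\<^esub> inv\<^bsub>S\<^esub> u = x" using x ring_iso_inv_facts(7) by metis
qed

lemma divring_image:
  assumes "divring R" shows "divring S"
proof -
  interpret D: divring R by fact
  note hj = ring_iso_memE[OF j]
  show ?thesis
  proof unfold_locales
    have z: "j \<zero>\<^bsub>R\<^esub> = \<zero>\<^bsub>S\<^esub>" using j ring_hom_zero[OF _ R S] by (auto simp: ring_iso_def)
    show "\<one>\<^bsub>S\<^esub> \<noteq> \<zero>\<^bsub>S\<^esub>" using D.one_not_zero ring_iso_inv_facts(2) z hj(4) by (metis R.one_closed R.zero_closed inj_on_def)
    fix x assume x: "x \<in> carrier S" "x \<noteq> \<zero>\<^bsub>S\<^esub>"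
    then have "j' x \<noteq> \<zero>\<^bsub>R\<^esub>" "j' x \<in> carrier R" using z ring_iso_inv_facts(5,7) by metis+
    then have y: "inv\<^bsub>R\<^esub> (j' x) \<in> carrier R" "j' x \<otimes>\<^bsub>R\<^esub> inv\<^bsub>R\<^esub> (j' x) = \<one>\<^bsub>R\<^esub>" "inv\<^bsub>R\<^esub> (j' x) \<otimes>\<^bsub>R\<^esub> j' x = \<one>\<^bsub>R\<^esub>" by auto
    have "j (inv\<^bsub>R\<^esub> (j' x)) \<otimes>\<^bsub>S\<^esub> x = \<one>\<^bsub>S\<^esub>" "x \<otimes>\<^bsub>S\<^esub> j (inv\<^bsub>R\<^esub> (j' x)) = \<one>\<^bsub>S\<^esub>"
      using hj(2)[of "j' x" "inv\<^bsub>R\<^esub> (j' x)"] hj(2)[of "inv\<^bsub>R\<^esub> (j' x)" "j' x"] y x ring_iso_inv_facts(5,7) hj(4) by auto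
    then show "x \<in> Units S" using x y hj(1) by (auto simp: Units_def)
  qed
qed

end

section \<open>Composita with a central Galois extension\<close>

definition lin_indep :: "('a,'m) ring_scheme \<Rightarrow> 'a set \<Rightarrow> 'a set \<Rightarrow> bool" where
  "lin_indep R K B \<longleftrightarrow> (\<forall>a \<in> B \<rightarrow> K. (\<Oplus>\<^bsub>R\<^esub>b\<in>B. a b \<otimes>\<^bsub>R\<^esub> b) = \<zero>\<^bsub>R\<^esub> \<longrightarrow> (\<forall>b\<in>B. a b = \<zero>\<^bsub>R\<^esub>))"

lemma (in divring) lin_indep_insert_span:
  assumes K: "subdivring K R" and B: "finite B" "B \<subseteq> carrier R" "lin_indep R K B"
    and e: "e \<in> carrier R" "e \<notin> B" "\<not> lin_indep R K (insert e B)"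
  shows "\<exists>c \<in> B \<rightarrow> K. e = (\<Oplus>b\<in>B. c b \<otimes> b)"
proof -
  note Ks = subdivringE[OF K]
  obtain a where a: "a \<in> insert e B \<rightarrow> K" "(\<Oplus>b\<in>insert e B. a b \<otimes> b) = \<zero>" "\<exists>b\<in>insert e B. a b \<noteq> \<zero>"
    using e(3) unfolding lin_indep_def by blast
  have ac: "a b \<in> K" "a b \<in> carrier R" if "b \<in> insert e B" for b using a that Ks(2) by auto
  have bc: "b \<in> carrier R" if "b \<in> B" for b using B that by auto
  define s where "s = (\<Oplus>b\<in>B. a b \<otimes> b)"
  have s: "s \<in> carrier R" using ac bc by (auto simp: s_def)
  have sum: "a e \<otimes> e \<oplus> s = \<zero>"
    using a(2) finsum_insert[OF B(1) e(2), of "\<lambda>b. a b \<otimes> b"] ac bc e(1) by (auto simp: s_def Pi_def)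
  have ae: "a e \<noteq> \<zero>"
  proof
    assume z: "a e = \<zero>"
    then have "s = \<zero>" using sum s e by simp
    moreover have "a \<in> B \<rightarrow> K" using a(1) by auto
    ultimately have "\<forall>b\<in>B. a b = \<zero>" using B(3) unfolding lin_indep_def s_def by blast
    then show False using a(3) z by auto
  qed
  define p where "p = inv (a e)"
  have p: "p \<in> K" "p \<in> carrier R" "p \<otimes> a e = \<one>" using ae ac[of e] Ks(8) by (auto simp: p_def)
  have "\<ominus> s = a e \<otimes> e" using sum s e ac[of e] by (metis a_comm insertI1 m_closed minus_equality)
  then have "p \<otimes> (\<ominus> s) = e" using p e ac[of e] by (simp add: m_assoc[symmetric])
  moreover have "p \<otimes> (\<ominus> s) = (\<ominus> p) \<otimes> s" using p s by (simp add: l_minus r_minus)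
  moreover have "(\<ominus> p) \<otimes> s = (\<Oplus>b\<in>B. (\<ominus> p) \<otimes> (a b \<otimes> b))"
    unfolding s_def using p ac bc B by (intro finsum_rdistr) auto
  moreover have "\<dots> = (\<Oplus>b\<in>B. (\<ominus> p \<otimes> a b) \<otimes> b)"
    using p ac bc by (intro finsum_cong') (auto simp: m_assoc)
  ultimately show ?thesis using p ac Ks by (intro bexI[of _ "\<lambda>b. \<ominus> p \<otimes> a b"]) auto
qed

lemma (in divring) inv_unique_left:
  assumes "x \<in> carrier R" "y \<in> carrier R" "y \<otimes> x = \<one>"
  shows "inv x = y"
proof -
  have x: "x \<noteq> \<zero>" using assms by auto
  have "y = (y \<otimes> x) \<otimes> inv x" using x assms(1,2) by (simp add: m_assoc)
  then show ?thesis using x assms by simp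
qed

text \<open>\<open>disj\<close> is linear disjointness of \<open>L\<close> and \<open>H\<close> over
  \<open>F\<close>: it makes the multiplication map from the tensor product of \<open>H\<close> and
  \<open>L\<close> over \<open>F\<close> into \<open>E\<close> injective. Centrality of
  \<open>L\<close> in all of \<open>E\<close> makes this map multiplicative.\<close>

locale central_compositum = divring E for E (structure) +
  fixes H L F :: "'a set"
  assumes H: "subdivring H E" and L: "subdivring L E" and F: "subdivring F E"
    and FH: "F \<subseteq> H" and FL: "F \<subseteq> L"
    and central: "\<And>x y. x \<in> L \<Longrightarrow> y \<in> carrier E \<Longrightarrow> x \<otimes> y = y \<otimes> x"
    and disj: "\<And>B. finite B \<Longrightarrow> B \<subseteq> L \<Longrightarrow> lin_indep E F B \<Longrightarrow> lin_indep E H B"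
    and finGal: "finite (carrier (Gal (E\<lparr>carrier := L\<rparr>) F))"
    and gal: "galois (E\<lparr>carrier := L\<rparr>) F"
begin

abbreviation "A \<equiv> carrier (Gal (E\<lparr>carrier := L\<rparr>) F)"

lemmas Hs = subdivringE[OF H] and Ls = subdivringE[OF L] and Fs = subdivringE[OF F]

lemma Hc [simp]: "x \<in> H \<Longrightarrow> x \<in> carrier E" and Lc [simp]: "x \<in> L \<Longrightarrow> x \<in> carrier E"
  using Hs(2) Ls(2) by auto

sublocale Lr: divring "E\<lparr>carrier := L\<rparr>"
  rewrites "carrier (E\<lparr>carrier := L\<rparr>) = L" and "monoid.mult (E\<lparr>carrier := L\<rparr>) = monoid.mult E"
    and "ring.add (E\<lparr>carrier := L\<rparr>) = ring.add E" and "monoid.one (E\<lparr>carrier := L\<rparr>) = monoid.one E" and "ring.zero (E\<lparr>carrier := L\<rparr>) = ring.zero E"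
  using subdivring_divring[OF L] by simp_all

lemma Gal_grp: "group (Gal (E\<lparr>carrier := L\<rparr>) F)"
  by (rule Gal_group) (use Lr.ring_axioms FL in auto)

lemma A_facts:
  assumes "g \<in> A"
  shows "\<And>x. x \<in> L \<Longrightarrow> g x \<in> L" "\<And>x. x \<in> F \<Longrightarrow> g x = x" "g \<one> = \<one>"
    "\<And>x y. x \<in> L \<Longrightarrow> y \<in> L \<Longrightarrow> g (x \<otimes> y) = g x \<otimes> g y"
    "\<And>x y. x \<in> L \<Longrightarrow> y \<in> L \<Longrightarrow> g (x \<oplus> y) = g x \<oplus> g y"
    "g \<in> extensional L" "bij_betw g L L"
  using Gal_closed[OF assms] Gal_fix[OF assms] ring_hom_mult[OF Gal_hom[OF assms]]
    ring_hom_add[OF Gal_hom[OF assms]] ring_hom_one[OF Gal_hom[OF assms]] Gal_ext[OF assms]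
    Gal_bij[OF assms] by auto

lemma A_eqI:
  assumes "f \<in> A" "g \<in> A" "\<And>x. x \<in> L \<Longrightarrow> f x = g x" shows "f = g"
  using A_facts(6)[OF assms(1)] A_facts(6)[OF assms(2)] assms(3) by (intro extensionalityI)

text \<open>The permutation hypothesis of \<open>artin_dependent\<close> for the whole group: the
  required factor is the inverse of \<open>g\<close> followed on the right by \<open>i\<close> in
  the group product.\<close>

lemma A_factor:
  assumes "g \<in> A" "i \<in> A"
  shows "\<exists>i'\<in>A. \<forall>x\<in>L. i x = g (i' x)"
proof -
  interpret G: group "Gal (E\<lparr>carrier := L\<rparr>) F" by (rule Gal_grp)
  define i' where "i' = inv\<^bsub>Gal (E\<lparr>carrier := L\<rparr>) F\<^esub> g \<otimes>\<^bsub>Gal (E\<lparr>carrier := L\<rparr>) F\<^esub> i"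
  have "i' \<in> A" using assms by (auto simp: i'_def simp del: Gal_simps)
  moreover have "g \<otimes>\<^bsub>Gal (E\<lparr>carrier := L\<rparr>) F\<^esub> i' = i"
    using assms by (simp add: i'_def G.m_assoc[symmetric] del: Gal_simps)
  then have "\<forall>x\<in>L. i x = g (i' x)" by (auto simp: compose_def)
  ultimately show ?thesis by blast
qed

text \<open>Artin's lemma with the Galois group as index set. The fixed field is \<open>F\<close>
  because the extension is Galois, so a larger set would be dependent over \<open>F\<close>.\<close>

lemma card_indep_le:
  assumes B: "finite B" "B \<subseteq> L" "lin_indep E F B"
  shows "card B \<le> card A"
proof (rule ccontr)
  assume "\<not> ?thesis"
  then have lt: "card A < card B" by simp
  interpret G: group "Gal (E\<lparr>carrier := L\<rparr>) F" by (rule Gal_grp)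
  have "\<exists>a \<in> B \<rightarrow> {x \<in> L. \<forall>g\<in>A. g x = x}. (\<exists>b\<in>B. a b \<noteq> \<zero>) \<and> (\<Oplus>\<^bsub>E\<lparr>carrier := L\<rparr>\<^esub>b\<in>B. a b \<otimes> b) = \<zero>"
  proof (rule Lr.artin_dependent[where \<chi> = "\<lambda>g. g" and I = A and ?i0.0 = "\<one>\<^bsub>Gal (E\<lparr>carrier := L\<rparr>) F\<^esub>"])
    show "\<exists>i'\<in>A. \<forall>x\<in>L. i x = g (i' x)" if "g \<in> A" "i \<in> A" for g i using A_factor that .
    show "finite A" "finite B" "B \<subseteq> L" "card A < card B" using finGal B lt by simp_all
    show "\<one>\<^bsub>Gal (E\<lparr>carrier := L\<rparr>) F\<^esub> \<in> A" by (rule G.one_closed)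
    show "\<one>\<^bsub>Gal (E\<lparr>carrier := L\<rparr>) F\<^esub> x = x" if "x \<in> L" for x using that by simp
    show "g x \<in> L" if "g \<in> A" "x \<in> L" for g x using A_facts(1) that .
    show "g \<in> ring_hom (E\<lparr>carrier := L\<rparr>) (E\<lparr>carrier := L\<rparr>)" if "g \<in> A" for g using Gal_hom[OF that] .
  qed
  moreover have "{x \<in> L. \<forall>g\<in>A. g x = x} = F" using gal unfolding galois_def by simp
  ultimately obtain a where a: "a \<in> B \<rightarrow> F" "\<exists>b\<in>B. a b \<noteq> \<zero>" "(\<Oplus>\<^bsub>E\<lparr>carrier := L\<rparr>\<^esub>b\<in>B. a b \<otimes> b) = \<zero>" by auto
  have "(\<Oplus>\<^bsub>E\<lparr>carrier := L\<rparr>\<^esub>b\<in>B. a b \<otimes> b) = (\<Oplus>b\<in>B. a b \<otimes> b)"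
    by (rule finsum_carrier_update[OF Ls(1) B(1)]) (use a(1) B(2) FL Ls(6) in \<open>auto simp: Pi_iff subset_eq\<close>)
  then show False using a B(3) unfolding lin_indep_def by auto
qed

lemma basis_exists:
  "\<exists>B. finite B \<and> B \<subseteq> L \<and> lin_indep E F B \<and> (\<forall>x\<in>L. \<exists>c\<in>B \<rightarrow> F. x = (\<Oplus>b\<in>B. c b \<otimes> b))"
proof -
  let ?P = "\<lambda>B. finite B \<and> B \<subseteq> L \<and> lin_indep E F B"
  have e: "?P {}" by (simp add: lin_indep_def)
  \<comment> \<open>A basis is taken as an independent set of maximal size; the bound is put in
    strict form for the maximum principle that follows.\<close>
  have "\<forall>B. ?P B \<longrightarrow> card B < Suc (card A)" using card_indep_le by (simp add: less_Suc_eq_le)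
  then have "\<exists>B. ?P B \<and> (\<forall>C. ?P C \<longrightarrow> card C \<le> card B)" by (rule ex_has_greatest_nat[of ?P, OF e])
  then obtain B where B: "?P B" and mx: "\<And>C. ?P C \<Longrightarrow> card C \<le> card B" by blast
  have "\<exists>c\<in>B \<rightarrow> F. x = (\<Oplus>b\<in>B. c b \<otimes> b)" if x: "x \<in> L" for x
  proof (cases "x \<in> B")
    case True
    let ?c = "\<lambda>b. if b = x then \<one> else \<zero>"
    have bc: "b \<in> carrier E" if "b \<in> B" for b using B that by auto
    have "(\<Oplus>b\<in>B. ?c b \<otimes> b) = ?c x \<otimes> x"
      by (rule finsum_delta) (use B True bc in auto)
    then show ?thesis using Fs x by (intro bexI[of _ ?c]) auto
  next
    case False
    have "\<not> lin_indep E F (insert x B)" using mx[of "insert x B"] B False x by auto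
    then show ?thesis using lin_indep_insert_span[OF F _ _ _ _ False] B x Ls(2) by auto
  qed
  then show ?thesis using B by blast
qed

end

section \<open>The compositum in terms of a basis\<close>

locale compositum_basis = central_compositum +
  fixes B
  assumes Bf: "finite B" and BL: "B \<subseteq> L" and Bi: "lin_indep E F B"
    and Bs: "\<And>x. x \<in> L \<Longrightarrow> \<exists>c\<in>B \<rightarrow> F. x = (\<Oplus>b\<in>B. c b \<otimes> b)"
begin

text \<open>The compositum of \<open>H\<close> and \<open>L\<close>, introduced as a left vector
  space over \<open>H\<close>; that it is a ring, and then a division ring, is shown below.\<close>

definition "M = {(\<Oplus>b\<in>B. c b \<otimes> b) | c. c \<in> B \<rightarrow> H}"

lemma Bc [simp]: "b \<in> B \<Longrightarrow> b \<in> carrier E" and Bl [simp]: "b \<in> B \<Longrightarrow> b \<in> L" using BL by auto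

lemma Mc: "x \<in> M \<Longrightarrow> x \<in> carrier E"
  unfolding M_def by (auto simp: Pi_def)

lemma M_I: "c \<in> B \<rightarrow> H \<Longrightarrow> (\<Oplus>b\<in>B. c b \<otimes> b) \<in> M"
  by (auto simp: M_def)

lemma M_E:
  assumes "x \<in> M" obtains c where "c \<in> B \<rightarrow> H" "x = (\<Oplus>b\<in>B. c b \<otimes> b)"
  using assms by (auto simp: M_def)

lemma sum_add:
  assumes "c \<in> B \<rightarrow> H" "c' \<in> B \<rightarrow> H" "\<And>b. b \<in> B \<Longrightarrow> u b \<in> carrier E"
  shows "(\<Oplus>b\<in>B. c b \<otimes> u b) \<oplus> (\<Oplus>b\<in>B. c' b \<otimes> u b) = (\<Oplus>b\<in>B. (c b \<oplus> c' b) \<otimes> u b)"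
proof -
  have c: "c b \<in> carrier E" "c' b \<in> carrier E" if "b \<in> B" for b
    using funcset_mem[OF assms(1) that] funcset_mem[OF assms(2) that] by auto
  have "(\<Oplus>b\<in>B. (c b \<oplus> c' b) \<otimes> u b) = (\<Oplus>b\<in>B. c b \<otimes> u b \<oplus> c' b \<otimes> u b)"
    using c assms(3) by (intro finsum_cong') (auto simp: l_distr)
  also have "\<dots> = (\<Oplus>b\<in>B. c b \<otimes> u b) \<oplus> (\<Oplus>b\<in>B. c' b \<otimes> u b)"
    using c assms(3) by (intro finsum_addf) auto
  finally show ?thesis by simp
qed

lemma sum_lmult:
  assumes "c \<in> B \<rightarrow> H" "h \<in> H" "\<And>b. b \<in> B \<Longrightarrow> u b \<in> carrier E"
  shows "h \<otimes> (\<Oplus>b\<in>B. c b \<otimes> u b) = (\<Oplus>b\<in>B. (h \<otimes> c b) \<otimes> u b)"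
proof -
  have c: "c b \<in> carrier E" "h \<in> carrier E" if "b \<in> B" for b using funcset_mem[OF assms(1) that] assms(2) that by auto
  have "h \<otimes> (\<Oplus>b\<in>B. c b \<otimes> u b) = (\<Oplus>b\<in>B. h \<otimes> (c b \<otimes> u b))"
    using Bf c assms by (intro finsum_rdistr) auto
  also have "\<dots> = (\<Oplus>b\<in>B. (h \<otimes> c b) \<otimes> u b)"
    using c assms(3) by (intro finsum_cong') (auto simp: m_assoc)
  finally show ?thesis .
qed

lemma M_add: assumes "x \<in> M" "y \<in> M" shows "x \<oplus> y \<in> M"
proof -
  obtain c c' where c: "c \<in> B \<rightarrow> H" "x = (\<Oplus>b\<in>B. c b \<otimes> b)" "c' \<in> B \<rightarrow> H" "y = (\<Oplus>b\<in>B. c' b \<otimes> b)"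
    using assms by (elim M_E)
  have "(\<lambda>b. c b \<oplus> c' b) \<in> B \<rightarrow> H" using c(1,3) Hs(7) by (simp add: Pi_iff)
  then show ?thesis using sum_add[OF c(1,3), of "\<lambda>b. b"] c M_I by auto
qed

lemma M_lmult: assumes "x \<in> M" "h \<in> H" shows "h \<otimes> x \<in> M"
proof -
  obtain c where c: "c \<in> B \<rightarrow> H" "x = (\<Oplus>b\<in>B. c b \<otimes> b)" using assms by (elim M_E)
  have "(\<lambda>b. h \<otimes> c b) \<in> B \<rightarrow> H" using c(1) Hs(6) assms by (simp add: Pi_iff)
  then show ?thesis using sum_lmult[OF c(1) assms(2), of "\<lambda>b. b"] c M_I by auto
qed

lemma LM: "x \<in> L \<Longrightarrow> x \<in> M"
proof -
  assume "x \<in> L"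
  then obtain c where "c \<in> B \<rightarrow> F" "x = (\<Oplus>b\<in>B. c b \<otimes> b)" using Bs by blast
  then show "x \<in> M" using FH M_I[of c] by auto
qed

lemma HM: "x \<in> H \<Longrightarrow> x \<in> M"
  using M_lmult[OF LM[OF Ls(4)], of x] by simp

text \<open>Additively, \<open>M\<close> is generated by the products of an element of
  \<open>H\<close> and one of \<open>L\<close>. Additive statements reduce to such products, where
  centrality of \<open>L\<close> allows the factors to be rearranged, without coordinates.\<close>

lemma M_induct [consumes 1, case_names prod add]:
  assumes x: "x \<in> M" and P: "\<And>h e. h \<in> H \<Longrightarrow> e \<in> L \<Longrightarrow> P (h \<otimes> e)"
    and add: "\<And>x y. x \<in> M \<Longrightarrow> y \<in> M \<Longrightarrow> P x \<Longrightarrow> P y \<Longrightarrow> P (x \<oplus> y)"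
  shows "P x"
proof -
  obtain c where c: "c \<in> B \<rightarrow> H" "x = (\<Oplus>b\<in>B. c b \<otimes> b)" using x by (elim M_E)
  have z: "\<zero> \<in> M" "P \<zero>" using P[OF Hs(3) Ls(4)] LM[OF Ls(3)] by auto
  have "(\<Oplus>b\<in>B. c b \<otimes> b) \<in> {x \<in> M. P x}"
    by (rule finsum_mem[OF Bf]) (use c(1) z P add M_add M_lmult LM Mc in \<open>auto simp: Pi_iff\<close>)
  then show ?thesis using c by simp
qed

lemma prod_rearrange:
  assumes "h \<in> carrier E" "e \<in> L" "h' \<in> carrier E" "e' \<in> carrier E"
  shows "(h \<otimes> e) \<otimes> (h' \<otimes> e') = (h \<otimes> h') \<otimes> (e \<otimes> e')"
proof -
  have "(h \<otimes> e) \<otimes> (h' \<otimes> e') = h \<otimes> (e \<otimes> h') \<otimes> e'" using assms by (simp add: m_assoc)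
  also have "\<dots> = h \<otimes> (h' \<otimes> e) \<otimes> e'" using central[of e h'] assms by simp
  finally show ?thesis using assms by (simp add: m_assoc)
qed

lemma M_mult: assumes x: "x \<in> M" and y: "y \<in> M" shows "x \<otimes> y \<in> M"
  using x
proof (induction x rule: M_induct)
  case (prod h e)
  show ?case using y
  proof (induction y rule: M_induct)
    case (prod h' e')
    then show ?case using \<open>h \<in> H\<close> \<open>e \<in> L\<close> M_lmult[OF LM[OF Ls(6)[of e e']] Hs(6)[of h h']]
      by (subst prod_rearrange) auto
  next
    case (add x y) then show ?case using \<open>h \<in> H\<close> \<open>e \<in> L\<close> by (simp add: r_distr Mc M_add)
  qed
next
  case (add x x') then show ?case using y by (simp add: l_distr Mc M_add)
qed

lemma M_subring: "subring M E"
proof (rule subringI)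
  show "\<ominus> x \<in> M" if "x \<in> M" for x
  proof -
    have "\<ominus> x = \<ominus> \<one> \<otimes> x" using that Mc by (simp add: l_minus)
    then show ?thesis using M_lmult[OF that Hs(5)[OF Hs(4)]] by simp
  qed
qed (use Mc M_add M_mult LM Ls in auto)

text \<open>In a polynomial relation of \<open>x\<close> over \<open>H\<close>, a zero constant term
  lets a factor \<open>x\<close> be cancelled on the right, which lowers the degree. Once the
  constant term is nonzero, solving for it shows the inverse of \<open>x\<close> as an element of
  \<open>H\<close> times a sum of terms \<open>h x^i\<close>.\<close>

lemma inv_mem_of_relation:
  assumes x: "x \<in> M" "x \<noteq> \<zero>"
  shows "y \<in> {..n::nat} \<rightarrow> H \<Longrightarrow> (\<exists>i\<le>n. y i \<noteq> \<zero>) \<Longrightarrow> (\<Oplus>i\<in>{..n}. y i \<otimes> x [^] i) = \<zero> \<Longrightarrow> inv x \<in> M"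
proof (induction n arbitrary: y)
  case 0
  then have "y 0 \<in> carrier E" by auto
  then show ?case using 0 by simp
next
  case (Suc n)
  have xc: "x \<in> carrier E" using x Mc by auto
  have yH: "y i \<in> H" if "i \<le> Suc n" for i using Suc.prems(1) that by auto
  have yc: "y i \<in> carrier E" if "i \<le> Suc n" for i using yH[OF that] by simp
  define s where "s = (\<Oplus>i\<in>{..n}. y (Suc i) \<otimes> x [^] i)"
  have pM: "x [^] (i::nat) \<in> M" for i by (induction i) (use x M_mult LM Ls in auto)
  have sM: "s \<in> M" unfolding s_def
    by (rule finsum_subring[OF M_subring]) (use yH pM M_lmult in auto)
  have "(\<Oplus>i\<in>{..n}. y (Suc i) \<otimes> x [^] Suc i) = (\<Oplus>i\<in>{..n}. (y (Suc i) \<otimes> x [^] i) \<otimes> x)"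
    using xc yc by (intro finsum_cong') (auto simp: m_assoc)
  also have "\<dots> = s \<otimes> x" unfolding s_def using xc yc by (intro finsum_ldistr[symmetric]) auto
  finally have e: "s \<otimes> x \<oplus> y 0 = \<zero>"
    using Suc.prems(3) xc yc by (subst (asm) finsum_Suc2) auto
  show ?case
  proof (cases "y 0 = \<zero>")
    case True
    then have "s = \<zero>" using e sM Mc xc integral_nz[of s x] x by auto
    moreover have "\<exists>i\<le>n. y (Suc i) \<noteq> \<zero>" using Suc.prems(2) True by (metis Suc_le_mono not0_implies_Suc)
    ultimately show ?thesis using Suc.IH[of "\<lambda>i. y (Suc i)"] yH by (auto simp: s_def)
  next
    case False
    define p where "p = inv (y 0)"
    have p: "p \<in> H" "p \<in> carrier E" "p \<otimes> y 0 = \<one>" using False yc[of 0] yH[of 0] Hs(8) by (auto simp: p_def)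
    have sc: "s \<in> carrier E" using sM Mc by auto
    have "\<ominus> (s \<otimes> x) = y 0" using e sc xc yc[of 0] by (metis a_comm m_closed minus_equality le0)
    then have "p \<otimes> (\<ominus> (s \<otimes> x)) = \<one>" using p by simp
    then have "(\<ominus> p \<otimes> s) \<otimes> x = \<one>" using p sc xc by (simp add: m_assoc l_minus r_minus)
    then have "inv x = \<ominus> p \<otimes> s" using x xc p sc by (intro inv_unique_left) auto
    then show ?thesis using M_lmult[OF sM Hs(5)[OF p(1)]] by simp
  qed
qed

text \<open>The powers of \<open>x\<close> with exponents from \<open>0\<close> to
  \<open>card B\<close> are one more than the coordinates available over \<open>H\<close>, so they
  satisfy a nontrivial left relation.\<close>

lemma M_subdivring: "subdivring M E"
proof (rule subdivringI[OF M_subring])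
  fix x assume x: "x \<in> M" "x \<noteq> \<zero>"
  have xc: "x \<in> carrier E" using x Mc by auto
  interpret Hr: divring "E\<lparr>carrier := H\<rparr>" by (rule subdivring_divring[OF H])
  have pM: "x [^] (i::nat) \<in> M" for i by (induction i) (use x M_mult LM Ls in auto)
  then have "\<exists>c. c \<in> B \<rightarrow> H \<and> x [^] i = (\<Oplus>b\<in>B. c b \<otimes> b)" for i :: nat by (metis M_E)
  then obtain c where c: "\<And>i::nat. c i \<in> B \<rightarrow> H" "\<And>i. x [^] i = (\<Oplus>b\<in>B. c i b \<otimes> b)" by metis
  have cH: "c i b \<in> H" if "b \<in> B" for i b using c(1)[of i] that by auto
  have "\<exists>y\<in>{..card B} \<rightarrow> H. (\<exists>j\<in>{..card B}. y j \<noteq> \<zero>) \<and>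
          (\<forall>b\<in>B. (\<Oplus>\<^bsub>E\<lparr>carrier := H\<rparr>\<^esub>i\<in>{..card B}. y i \<otimes> c i b) = \<zero>)"
    using Hr.homogeneous_system[of B "{..card B}" "\<lambda>b i. c i b"] Bf cH by simp
  then obtain y where y: "y \<in> {..card B} \<rightarrow> H" "\<exists>j\<le>card B. y j \<noteq> \<zero>"
    and ys: "\<And>b. b \<in> B \<Longrightarrow> (\<Oplus>\<^bsub>E\<lparr>carrier := H\<rparr>\<^esub>i\<in>{..card B}. y i \<otimes> c i b) = \<zero>" by auto
  have yH: "y i \<in> H" if "i \<le> card B" for i using y(1) that by auto
  have ys': "(\<Oplus>i\<in>{..card B}. y i \<otimes> c i b) = \<zero>" if "b \<in> B" for b
    using ys[OF that] finsum_carrier_update[OF Hs(1), of "{..card B}" "\<lambda>i. y i \<otimes> c i b"] yH cH[OF that] Hs(6) by auto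
  have "(\<Oplus>i\<in>{..card B}. y i \<otimes> x [^] i) = (\<Oplus>i\<in>{..card B}. \<Oplus>b\<in>B. (y i \<otimes> c i b) \<otimes> b)"
    using yH cH c sum_lmult[of _ _ "\<lambda>b. b"] by (intro finsum_cong') auto
  also have "\<dots> = (\<Oplus>b\<in>B. \<Oplus>i\<in>{..card B}. (y i \<otimes> c i b) \<otimes> b)"
    using yH cH Bf by (intro finsum_swap) auto
  also have "\<dots> = (\<Oplus>b\<in>B. (\<Oplus>i\<in>{..card B}. y i \<otimes> c i b) \<otimes> b)"
    using yH cH by (intro finsum_cong') (auto simp: finsum_ldistr Pi_def)
  also have "\<dots> = \<zero>" using ys' by (intro add.finprod_one_eqI) auto
  finally show "inv x \<in> M" using inv_mem_of_relation[OF x y] by blast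
qed

definition "cf x = (SOME c. c \<in> B \<rightarrow> H \<and> x = (\<Oplus>b\<in>B. c b \<otimes> b))"

lemma cf: assumes "x \<in> M" shows "cf x \<in> B \<rightarrow> H" "x = (\<Oplus>b\<in>B. cf x b \<otimes> b)"
proof -
  have "\<exists>c. c \<in> B \<rightarrow> H \<and> x = (\<Oplus>b\<in>B. c b \<otimes> b)" using assms by (auto simp: M_def)
  from someI_ex[OF this] show "cf x \<in> B \<rightarrow> H" "x = (\<Oplus>b\<in>B. cf x b \<otimes> b)"
    by (simp_all add: cf_def[symmetric])
qed

text \<open>Linear disjointness enters here: the basis of \<open>L\<close> over \<open>F\<close>
  stays independent over \<open>H\<close>, so the choice made in \<open>cf\<close> is forced on
  \<open>B\<close>.\<close>

lemma cf_unique: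
  assumes c: "c \<in> B \<rightarrow> H" "x = (\<Oplus>b\<in>B. c b \<otimes> b)" and b: "b \<in> B" shows "cf x b = c b"
proof -
  have x: "x \<in> M" using c M_I by auto
  have c1: "cf x b \<in> carrier E" "c b \<in> carrier E" "cf x b \<in> H" "c b \<in> H" if "b \<in> B" for b 
    using funcset_mem[OF cf(1)[OF x] that] funcset_mem[OF c(1) that] by auto
  have "(\<Oplus>b\<in>B. (cf x b \<ominus> c b) \<otimes> b) = (\<Oplus>b\<in>B. cf x b \<otimes> b \<ominus> c b \<otimes> b)"
    using c1 by (intro finsum_cong') (auto simp: a_minus_def l_distr l_minus)
  also have "\<dots> = (\<Oplus>b\<in>B. cf x b \<otimes> b) \<ominus> (\<Oplus>b\<in>B. c b \<otimes> b)"
    using c1 Bf by (intro finsum_minusf) auto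
  also have "\<dots> = x \<ominus> x" using cf(2)[OF x] c(2) by simp
  finally have "(\<Oplus>b\<in>B. (cf x b \<ominus> c b) \<otimes> b) = \<zero>" using Mc[OF x] by simp
  moreover have "(\<lambda>b. cf x b \<ominus> c b) \<in> B \<rightarrow> H" using c1 Hs(5,7) by (auto simp: a_minus_def)
  ultimately have "\<forall>b\<in>B. cf x b \<ominus> c b = \<zero>"
    using disj[OF Bf BL Bi] unfolding lin_indep_def by (elim ballE[of _ _ "\<lambda>b. cf x b \<ominus> c b"]) auto
  then have "cf x b \<ominus> c b = \<zero>" using b by blast
  then show ?thesis using c1[OF b] by simp
qed

text \<open>The identity of \<open>H\<close> tensored with \<open>g\<close>, written in
  coordinates.\<close>

definition "ext g x = (\<Oplus>b\<in>B. cf x b \<otimes> g b)"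

lemma ext_closed: assumes g: "g \<in> A" and x: "x \<in> M" shows "ext g x \<in> M"
  unfolding ext_def
  by (rule finsum_subring[OF M_subring Bf]) (use cf(1)[OF x] M_lmult[OF LM[OF A_facts(1)[OF g Bl]]] in \<open>auto simp: Pi_iff\<close>)

lemma ext_add: assumes g: "g \<in> A" and x: "x \<in> M" "y \<in> M" shows "ext g (x \<oplus> y) = ext g x \<oplus> ext g y"
proof -
  have c: "cf x b \<in> H" "cf y b \<in> H" if "b \<in> B" for b using cf(1)[OF x(1)] cf(1)[OF x(2)] that by auto
  have "cf (x \<oplus> y) b = cf x b \<oplus> cf y b" if "b \<in> B" for b
    by (rule cf_unique[OF _ _ that])
       (use sum_add[OF cf(1)[OF x(1)] cf(1)[OF x(2)], of "\<lambda>b. b"] cf(2)[OF x(1)] cf(2)[OF x(2)] c Hs in auto)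
  then have "ext g (x \<oplus> y) = (\<Oplus>b\<in>B. (cf x b \<oplus> cf y b) \<otimes> g b)"
    unfolding ext_def using A_facts(1)[OF g] c by (intro finsum_cong') auto
  also have "\<dots> = ext g x \<oplus> ext g y" unfolding ext_def
    using sum_add[OF cf(1)[OF x(1)] cf(1)[OF x(2)], of g] A_facts(1)[OF g] by auto
  finally show ?thesis .
qed

text \<open>Removes the basis from the definition of \<open>ext\<close>: the coordinates of
  \<open>e\<close> lie in \<open>F\<close>, which \<open>g\<close> fixes, so applying
  \<open>g\<close> to the basis elements amounts to applying it to \<open>e\<close>.
  Multiplicativity follows from this form.\<close>

lemma ext_prod: assumes g: "g \<in> A" and h: "h \<in> H" and e: "e \<in> L" shows "ext g (h \<otimes> e) = h \<otimes> g e"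
proof -
  obtain f where f: "f \<in> B \<rightarrow> F" "e = (\<Oplus>b\<in>B. f b \<otimes> b)" using Bs[OF e] by blast
  have fF: "f b \<in> F" "f b \<in> H" "f b \<in> L" if "b \<in> B" for b using f(1) that FH FL by auto
  have fH: "f \<in> B \<rightarrow> H" using fF by auto
  have "cf (h \<otimes> e) b = h \<otimes> f b" if "b \<in> B" for b
    by (rule cf_unique[OF _ _ that]) (use sum_lmult[OF fH h, of "\<lambda>b. b"] f(2) fF h Hs in auto)
  then have "ext g (h \<otimes> e) = (\<Oplus>b\<in>B. (h \<otimes> f b) \<otimes> g b)"
    unfolding ext_def using A_facts(1)[OF g] fF h by (intro finsum_cong') auto
  also have "\<dots> = h \<otimes> (\<Oplus>b\<in>B. f b \<otimes> g b)" using sum_lmult[OF fH h, of g] A_facts(1)[OF g] by auto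
  also have "(\<Oplus>b\<in>B. f b \<otimes> g b) = (\<Oplus>b\<in>B. g (f b \<otimes> b))"
    using A_facts[OF g] fF by (intro finsum_cong') auto
  also have "\<dots> = g e" unfolding f(2)
    by (rule finsum_additive[OF ring_axioms Bf, of _ L, symmetric]) (use fF Ls A_facts[OF g] in auto)
  finally show ?thesis .
qed

lemma ext_L: "g \<in> A \<Longrightarrow> e \<in> L \<Longrightarrow> ext g e = g e"
  using ext_prod[of g \<one> e] Hs(4) A_facts(1)[of g e] by simp

lemma ext_H: "g \<in> A \<Longrightarrow> h \<in> H \<Longrightarrow> ext g h = h"
  using ext_prod[of g h \<one>] Ls(4) A_facts(3)[of g] by simp

lemma ext_mult: assumes g: "g \<in> A" and x: "x \<in> M" and y: "y \<in> M" shows "ext g (x \<otimes> y) = ext g x \<otimes> ext g y"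
  using x
proof (induction x rule: M_induct)
  case (prod h e)
  show ?case using y
  proof (induction y rule: M_induct)
    case (prod h' e')
    have "ext g (h \<otimes> e \<otimes> (h' \<otimes> e')) = ext g ((h \<otimes> h') \<otimes> (e \<otimes> e'))"
      using prod \<open>h \<in> H\<close> \<open>e \<in> L\<close> by (subst prod_rearrange) auto
    also have "\<dots> = (h \<otimes> h') \<otimes> (g e \<otimes> g e')"
      using prod \<open>h \<in> H\<close> \<open>e \<in> L\<close> A_facts[OF g] Hs Ls by (simp add: ext_prod[OF g])
    also have "\<dots> = (h \<otimes> g e) \<otimes> (h' \<otimes> g e')"
      using prod \<open>h \<in> H\<close> \<open>e \<in> L\<close> A_facts[OF g] by (subst prod_rearrange) auto
    finally show ?case using prod \<open>h \<in> H\<close> \<open>e \<in> L\<close> by (simp add: ext_prod[OF g])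
  next
    case (add x y)
    have he: "h \<otimes> e \<in> M" using \<open>h \<in> H\<close> \<open>e \<in> L\<close> M_lmult LM by auto
    then show ?case using add g by (simp add: r_distr ext_add M_mult ext_closed Mc)
  qed
next
  case (add x x') then show ?case using y g by (simp add: l_distr ext_add M_mult ext_closed Mc)
qed

abbreviation "GM \<equiv> carrier (Gal (E\<lparr>carrier := M\<rparr>) H)"

lemma Mring: "divring (E\<lparr>carrier := M\<rparr>)"
  by (rule subdivring_divring[OF M_subdivring])

lemma restrict_ext_Gal: assumes g: "g \<in> A" shows "(\<lambda>x\<in>M. ext g x) \<in> GM"
proof -
  interpret G: group "Gal (E\<lparr>carrier := L\<rparr>) F" by (rule Gal_grp)
  define g' where "g' = inv\<^bsub>Gal (E\<lparr>carrier := L\<rparr>) F\<^esub> g"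
  have g': "g' \<in> A" using g by (auto simp: g'_def simp del: Gal_simps)
  have comp: "g' (g x) = x" "g (g' x) = x" if "x \<in> L" for x
  proof -
    have "compose L g' g = restrict id L" "compose L g g' = restrict id L"
      using G.l_inv[OF g] G.r_inv[OF g] by (auto simp: g'_def)
    then show "g' (g x) = x" "g (g' x) = x" using that by (metis compose_eq id_apply restrict_apply')+
  qed
  \<comment> \<open>Bijectivity comes from extending the inverse automorphism too; on a product both
    extensions act only on the factor from \<open>L\<close>.\<close>
  have ext_inv: "ext f (ext f' x) = x" if f: "f \<in> A" "f' \<in> A" "\<And>x. x \<in> L \<Longrightarrow> f (f' x) = x" and x: "x \<in> M" for f f' x
    using x
  proof (induction x rule: M_induct)
    case (prod h e) then show ?case using f A_facts(1)[of f' e] by (simp add: ext_prod)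
  next
    case (add x y) then show ?case using f by (simp add: ext_add ext_closed)
  qed
  have "bij_betw (ext g) M M"
    by (rule bij_betwI[of _ _ _ "ext g'"]) (use ext_closed g g' comp ext_inv in auto)
  then have b: "bij_betw (\<lambda>x\<in>M. ext g x) M M" by (simp cong: bij_betw_cong)
  have "(\<lambda>x\<in>M. ext g x) \<in> ring_iso (E\<lparr>carrier := M\<rparr>) (E\<lparr>carrier := M\<rparr>)"
    by (rule ring_iso_memI) (use b g ext_closed ext_mult ext_add M_mult M_add ext_L[OF g Ls(4)] A_facts(3)[OF g] LM Ls(4) in auto)
  then show ?thesis using ext_H[OF g] HM by (auto simp: Gal_iff)
qed

lemma GM_facts:
  assumes "g \<in> GM"
  shows "\<And>x. x \<in> M \<Longrightarrow> g x \<in> M" "\<And>x. x \<in> H \<Longrightarrow> g x = x" "g \<one> = \<one>"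
    "\<And>x y. x \<in> M \<Longrightarrow> y \<in> M \<Longrightarrow> g (x \<otimes> y) = g x \<otimes> g y"
    "\<And>x y. x \<in> M \<Longrightarrow> y \<in> M \<Longrightarrow> g (x \<oplus> y) = g x \<oplus> g y"
    "g \<in> extensional M" "bij_betw g M M"
  using Gal_closed[OF assms] Gal_fix[OF assms] ring_hom_mult[OF Gal_hom[OF assms]]
    ring_hom_add[OF Gal_hom[OF assms]] ring_hom_one[OF Gal_hom[OF assms]] Gal_ext[OF assms]
    Gal_bij[OF assms] by auto

text \<open>That \<open>g\<close> maps \<open>L\<close> to itself is the point. Otherwise its
  restriction, together with the group of \<open>L\<close>, gives more homomorphisms from
  \<open>L\<close> to \<open>M\<close> over \<open>F\<close> than the dimension, and two distinct
  ones are conjugate. But all of them have values that commute with \<open>M\<close>, so conjugate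
  ones are equal.\<close>

lemma restrict_L_Gal: assumes g: "g \<in> GM" shows "restrict g L \<in> A"
proof (rule ccontr)
  assume n: "restrict g L \<notin> A"
  interpret Mr: divring "E\<lparr>carrier := M\<rparr>" by (rule Mring)
  note gf = GM_facts[OF g]
  let ?J = "insert (restrict g L) A"
  have LsubM: "subring L (E\<lparr>carrier := M\<rparr>)"
    by (rule Mr.ring_incl_imp_subring) (use LM Lr.ring_axioms in auto)
  have span: "\<exists>c\<in>B \<rightarrow> F. x = (\<Oplus>\<^bsub>E\<lparr>carrier := M\<rparr>\<^esub>b\<in>B. c b \<otimes>\<^bsub>E\<lparr>carrier := M\<rparr>\<^esub> b)" if x: "x \<in> L" for x
  proof -
    obtain c where c: "c \<in> B \<rightarrow> F" "x = (\<Oplus>b\<in>B. c b \<otimes> b)" using Bs[OF x] by blast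
    have "(\<Oplus>\<^bsub>E\<lparr>carrier := M\<rparr>\<^esub>b\<in>B. c b \<otimes> b) = (\<Oplus>b\<in>B. c b \<otimes> b)"
      by (rule finsum_carrier_update[OF M_subring Bf]) (use c(1) FH M_lmult[OF LM[OF Bl]] in \<open>auto simp: Pi_iff\<close>)
    then show ?thesis using c by (intro bexI[of _ c]) auto
  qed
  have "\<exists>i\<in>?J. \<exists>j\<in>?J. i \<noteq> j \<and> (\<exists>c\<in>carrier (E\<lparr>carrier := M\<rparr>). c \<noteq> \<zero>\<^bsub>E\<lparr>carrier := M\<rparr>\<^esub> \<and>
       (\<forall>x\<in>L. i x \<otimes>\<^bsub>E\<lparr>carrier := M\<rparr>\<^esub> c = c \<otimes>\<^bsub>E\<lparr>carrier := M\<rparr>\<^esub> j x))"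
  proof (rule Mr.many_homs_conjugate[OF _ Bf BL _ LsubM FL span])
    show "finite ?J" using finGal by simp
    show "card B < card ?J" using card_indep_le[OF Bf BL Bi] n finGal by simp
    fix j assume j: "j \<in> ?J"
    show "j \<in> ring_hom (E\<lparr>carrier := M, carrier := L\<rparr>) (E\<lparr>carrier := M\<rparr>)"
    proof (cases "j = restrict g L")
      case True
      show ?thesis unfolding True using gf LM Ls by (intro ring_hom_memI) auto
    next
      case False
      then have "j \<in> A" using j by auto
      then show ?thesis using A_facts[of j] LM Ls by (intro ring_hom_memI) auto
    qed
    show "j x = x" if "x \<in> F" for x
    proof (cases "j = restrict g L")
      case True
      have "x \<in> L" "x \<in> H" using that FH FL by auto
      then show ?thesis using True gf(2) by simp
    next
      case False
      then show ?thesis using j A_facts(2)[of j] that by auto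
    qed
  qed
  then obtain i j c where ij: "i \<in> ?J" "j \<in> ?J" "i \<noteq> j" "c \<in> M" "c \<noteq> \<zero>"
    and conj: "\<And>x. x \<in> L \<Longrightarrow> i x \<otimes> c = c \<otimes> j x"
    by (elim bexE conjE) (use that in simp)
  have vals: "i' x \<in> M" "i' x \<otimes> c = c \<otimes> i' x" if i': "i' \<in> ?J" and x: "x \<in> L" for i' x
  proof -
    show "i' x \<in> M" using i' gf(1) A_facts(1)[of i'] LM x by auto
    show "i' x \<otimes> c = c \<otimes> i' x"
    proof (cases "i' = restrict g L")
      case True
      \<comment> \<open>Surjectivity of \<open>g\<close> on \<open>M\<close> is what makes
        \<open>g x\<close> commute with every \<open>c\<close>: it suffices that \<open>x\<close>
        commutes with a preimage.\<close>
      obtain c' where c': "c' \<in> M" "c = g c'" using gf(7) ij(4) by (auto simp: bij_betw_def)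
      then show ?thesis using True x gf(4)[of x c'] gf(4)[of c' x] LM central[of x c'] Mc by auto
    next
      case False then show ?thesis using i' A_facts(1)[of i'] x central Mc ij by auto
    qed
  qed
  have "i x = j x" if x: "x \<in> L" for x
    using conj[OF x] vals[OF ij(1) x] vals[OF ij(2) x] Mc ij(4,5) m_lcancel_nz[of "i x" "j x" c] by auto
  moreover have "i \<in> extensional L" "j \<in> extensional L" using ij(1,2) A_facts(6) by auto
  ultimately have "i = j" by (intro extensionalityI)
  then show False using ij by simp
qed

text \<open>Restriction to \<open>L\<close> is the isomorphism. It is injective because
  \<open>H\<close> and \<open>L\<close> generate \<open>M\<close>, and \<open>ext\<close> provides
  preimages.\<close>

lemma Gal_M_iso: "Gal (E\<lparr>carrier := M\<rparr>) H \<cong> Gal (E\<lparr>carrier := L\<rparr>) F"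
proof -
  let ?\<rho> = "\<lambda>g. restrict g L"
  have "?\<rho> \<in> hom (Gal (E\<lparr>carrier := M\<rparr>) H) (Gal (E\<lparr>carrier := L\<rparr>) F)"
  proof (rule homI)
    fix f g assume f: "f \<in> GM" and g: "g \<in> GM"
    have "g x \<in> L" if "x \<in> L" for x using A_facts(1)[OF restrict_L_Gal[OF g] that] that by simp
    then show "?\<rho> (f \<otimes>\<^bsub>Gal (E\<lparr>carrier := M\<rparr>) H\<^esub> g) = ?\<rho> f \<otimes>\<^bsub>Gal (E\<lparr>carrier := L\<rparr>) F\<^esub> ?\<rho> g"
      using LM by (auto simp: compose_def intro!: ext)
  qed (rule restrict_L_Gal)
  moreover have "bij_betw ?\<rho> GM A"
    unfolding bij_betw_def
  proof
    show "inj_on ?\<rho> GM"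
    proof (rule inj_onI)
      fix f g assume f: "f \<in> GM" and g: "g \<in> GM" and eq: "restrict f L = restrict g L"
      have eqL: "f x = g x" if "x \<in> L" for x using fun_cong[OF eq, of x] that by simp
      have "f x = g x" if "x \<in> M" for x using that
      proof (induction x rule: M_induct)
        case (prod h e)
        then show ?case using GM_facts(2,4)[OF f] GM_facts(2,4)[OF g] eqL HM LM by simp
      next
        case (add x y) then show ?case using GM_facts(5)[OF f] GM_facts(5)[OF g] by simp
      qed
      then show "f = g" using GM_facts(6)[OF f] GM_facts(6)[OF g] by (intro extensionalityI)
    qed
    show "?\<rho> ` GM = A"
    proof
      show "?\<rho> ` GM \<subseteq> A" using restrict_L_Gal by auto
      show "A \<subseteq> ?\<rho> ` GM"
      proof
        fix g assume g: "g \<in> A"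
        have "restrict (\<lambda>x\<in>M. ext g x) L = g"
          using A_facts(6)[OF g] ext_L[OF g] LM by (intro extensionalityI[of _ L]) auto
        then show "g \<in> ?\<rho> ` GM" using restrict_ext_Gal[OF g] by (metis image_eqI)
      qed
    qed
  qed
  ultimately show ?thesis unfolding is_iso_def iso_def by auto
qed

lemma outer_M: "outer (E\<lparr>carrier := M\<rparr>) H"
  unfolding outer_def
proof (intro ballI impI)
  fix u x assume u: "u \<in> Units (E\<lparr>carrier := M\<rparr>)" and x: "x \<in> carrier (E\<lparr>carrier := M\<rparr>)"
    and fx: "\<forall>x\<in>H. u \<otimes>\<^bsub>E\<lparr>carrier := M\<rparr>\<^esub> x \<otimes>\<^bsub>E\<lparr>carrier := M\<rparr>\<^esub> inv\<^bsub>E\<lparr>carrier := M\<rparr>\<^esub> u = x"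
  interpret Mr: divring "E\<lparr>carrier := M\<rparr>" by (rule Mring)
  define v where "v = inv\<^bsub>E\<lparr>carrier := M\<rparr>\<^esub> u"
  have uv: "u \<in> M" "v \<in> M" "u \<otimes> v = \<one>" "u \<in> carrier E" "v \<in> carrier E"
    using u Mr.Units_closed[OF u] Mr.Units_inv_closed[OF u] Mr.Units_r_inv[OF u] Mc by (auto simp: v_def)
  have xM: "x \<in> M" using x by simp
  have "u \<otimes> x \<otimes> v = x" using xM
  proof (induction x rule: M_induct)
    case (prod h e)
    have "u \<otimes> (h \<otimes> e) \<otimes> v = u \<otimes> h \<otimes> (e \<otimes> v)" using prod uv by (simp add: m_assoc)
    also have "\<dots> = (u \<otimes> h \<otimes> v) \<otimes> e" using prod uv central[of e v] by (simp add: m_assoc)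
    finally show ?case using fx prod by (simp add: v_def)
  next
    case (add x y) then show ?case using uv Mc by (simp add: r_distr l_distr)
  qed
  then show "u \<otimes>\<^bsub>E\<lparr>carrier := M\<rparr>\<^esub> x \<otimes>\<^bsub>E\<lparr>carrier := M\<rparr>\<^esub> inv\<^bsub>E\<lparr>carrier := M\<rparr>\<^esub> u = x" by (simp add: v_def)
qed

text \<open>Composition with an element of the finite group permutes the summands, so the trace is a
  fixed element.\<close>

lemma trace_in_F: assumes e: "e \<in> L" shows "(\<Oplus>g\<in>A. g e) \<in> F"
proof -
  interpret G: group "Gal (E\<lparr>carrier := L\<rparr>) F" by (rule Gal_grp)
  have tL: "(\<Oplus>g\<in>A. g e) \<in> L" by (rule finsum_subring[OF Ls(1) finGal]) (use A_facts(1) e in auto)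
  have "f (\<Oplus>g\<in>A. g e) = (\<Oplus>g\<in>A. g e)" if f: "f \<in> A" for f
  proof -
    let ?m = "\<lambda>g. compose L f g"
    have inj: "inj_on ?m A" using G.inj_on_cmult[OF f] by simp
    have sub: "?m ` A \<subseteq> A" using G.m_closed[OF f] by auto
    have img: "?m ` A = A" using endo_inj_surj[OF finGal sub inj] .
    have "f (\<Oplus>g\<in>A. g e) = (\<Oplus>g\<in>A. f (g e))"
      by (rule finsum_additive[OF ring_axioms finGal, of _ L]) (use Ls A_facts[OF f] A_facts(1) e in auto)
    also have "\<dots> = (\<Oplus>g\<in>A. (?m g) e)"
      using A_facts(1)[OF f] A_facts(1) e by (intro finsum_cong') (auto simp: compose_def)
    also have "\<dots> = (\<Oplus>g\<in>?m ` A. g e)"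
      using inj A_facts(1) e sub by (intro finsum_reindex[symmetric]) (auto simp: img)
    finally show ?thesis by (simp add: img)
  qed
  then show ?thesis using gal tL unfolding galois_def by auto
qed

text \<open>A vanishing trace is a Dedekind relation with all coefficients \<open>\<one>\<close>.
  The conjugate pair it produces would coincide, since the values lie in \<open>L\<close> and
  commute with \<open>c\<close>.\<close>

lemma trace_nonzero: "\<exists>e\<in>L. (\<Oplus>g\<in>A. g e) \<noteq> \<zero>"
proof (rule ccontr)
  assume n: "\<not> ?thesis"
  interpret G: group "Gal (E\<lparr>carrier := L\<rparr>) F" by (rule Gal_grp)
  have "(\<Oplus>g\<in>A. g x \<otimes> \<one>) = \<zero>" if x: "x \<in> L" for x
  proof -
    have "(\<Oplus>g\<in>A. g x \<otimes> \<one>) = (\<Oplus>g\<in>A. g x)" using A_facts(1) x by (intro finsum_cong') auto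
    then show ?thesis using n x by auto
  qed
  then have "\<exists>i\<in>A. \<exists>j\<in>A. i \<noteq> j \<and> (\<exists>c\<in>carrier E. c \<noteq> \<zero> \<and> (\<forall>x\<in>L. i x \<otimes> c = c \<otimes> j x))"
    using G.one_closed by (intro dedekind_independent[OF finGal Ls(4,6), of "\<lambda>g. g" "\<lambda>_. \<one>"]) (auto simp: A_facts simp del: Gal_simps)
  then obtain i j c where ij: "i \<in> A" "j \<in> A" "i \<noteq> j" "c \<in> carrier E" "c \<noteq> \<zero>"
    and conj: "\<And>x. x \<in> L \<Longrightarrow> i x \<otimes> c = c \<otimes> j x" by blast
  have "i x = j x" if x: "x \<in> L" for x
  proof -
    have c: "i x \<in> L" "j x \<in> L" using A_facts(1) ij x by auto
    have "c \<otimes> i x = c \<otimes> j x" using conj[OF x] central[OF c(1) ij(4)] by simp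
    then show ?thesis using m_lcancel_nz[of "i x" "j x" c] ij c by simp
  qed
  then show False using A_eqI[OF ij(1,2)] ij(3) by simp
qed

text \<open>If \<open>x\<close> is fixed and \<open>e \<in> L\<close> has nonzero trace \<open>t\<close>, then \<open>x t\<close> is the trace of \<open>x e\<close>, and traces
  lie in \<open>H\<close>.\<close>

lemma galois_M: "galois (E\<lparr>carrier := M\<rparr>) H"
proof -
  have "x \<in> H" if x: "x \<in> M" and fx: "\<And>g. g \<in> GM \<Longrightarrow> g x = x" for x
  proof -
    have extx: "ext g x = x" if "g \<in> A" for g using fx[OF restrict_ext_Gal[OF that]] x by simp
    obtain e where e: "e \<in> L" "(\<Oplus>g\<in>A. g e) \<noteq> \<zero>" using trace_nonzero by blast
    define t where "t = (\<Oplus>g\<in>A. g e)"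
    have t: "t \<in> H" "t \<in> carrier E" "t \<noteq> \<zero>" using trace_in_F[OF e(1)] e FH by (auto simp: t_def)
    have tr: "(\<Oplus>g\<in>A. ext g y) \<in> H" if "y \<in> M" for y using that
    proof (induction y rule: M_induct)
      case (prod h e)
      have "(\<Oplus>g\<in>A. ext g (h \<otimes> e)) = (\<Oplus>g\<in>A. h \<otimes> g e)"
        using prod A_facts(1) ext_prod by (intro finsum_cong') auto
      also have "\<dots> = h \<otimes> (\<Oplus>g\<in>A. g e)" using prod A_facts(1) finGal by (intro finsum_rdistr[symmetric]) auto
      finally show ?case using prod trace_in_F[of e] FH Hs(6) by auto
    next
      case (add x y)
      have "(\<Oplus>g\<in>A. ext g (x \<oplus> y)) = (\<Oplus>g\<in>A. ext g x \<oplus> ext g y)"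
        using add ext_add ext_closed Mc by (intro finsum_cong') auto
      also have "\<dots> = (\<Oplus>g\<in>A. ext g x) \<oplus> (\<Oplus>g\<in>A. ext g y)"
        using add ext_closed Mc by (intro finsum_addf) auto
      finally show ?case using add Hs(7) by auto
    qed
    have "(\<Oplus>g\<in>A. ext g (x \<otimes> e)) = (\<Oplus>g\<in>A. x \<otimes> g e)"
      using x e LM Mc A_facts(1) by (intro finsum_cong') (auto simp: ext_mult ext_L extx)
    also have "\<dots> = x \<otimes> t" unfolding t_def using x e Mc A_facts(1) finGal by (intro finsum_rdistr[symmetric]) auto
    finally have "x \<otimes> t \<in> H" using tr[of "x \<otimes> e"] M_mult[OF x LM[OF e(1)]] by simp
    then have "(x \<otimes> t) \<otimes> inv t \<in> H" using t Hs(6,8) by blast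
    then show "x \<in> H" using t x Mc by (simp add: m_assoc)
  qed
  then show ?thesis unfolding galois_def using HM Gal_fix[of _ "E\<lparr>carrier := M\<rparr>" H] by auto
qed

end

text \<open>The description of \<open>M\<close> as the span of a finite set is part of the
  conclusion because the size of \<open>M\<close> has to be bounded by that of \<open>H\<close>
  later.\<close>

theorem (in central_compositum) compositum_galois:
  "\<exists>M B. subdivring M E \<and> H \<subseteq> M \<and> outer (E\<lparr>carrier := M\<rparr>) H \<and> galois (E\<lparr>carrier := M\<rparr>) H \<and>
     Gal (E\<lparr>carrier := M\<rparr>) H \<cong> Gal (E\<lparr>carrier := L\<rparr>) F \<and> finite B \<and> B \<subseteq> L \<and>
     M = {(\<Oplus>b\<in>B. c b \<otimes> b) | c. c \<in> B \<rightarrow> H}"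
proof -
  obtain B where B: "finite B" "B \<subseteq> L" "lin_indep E F B" "\<And>x. x \<in> L \<Longrightarrow> \<exists>c\<in>B \<rightarrow> F. x = (\<Oplus>b\<in>B. c b \<otimes> b)"
    using basis_exists by blast
  interpret compositum_basis E H L F B by unfold_locales (use B in auto)
  show ?thesis
    using M_subdivring HM outer_M galois_M Gal_M_iso B(1,2) M_def by (intro exI[of _ M] exI[of _ B]) blast
qed

section \<open>Twisted series\<close>

text \<open>A series is its coefficient function. The last condition on the carrier is
  left-finiteness of the support. The parameters allow two uses: coefficients in \<open>h\<close>
  with the twist of the tower, and coefficients in \<open>kk\<close> with integral exponents and no
  twist, which is the field \<open>kk((T))\<close>.\<close>

definition tseries :: "('a,'m) ring_scheme \<Rightarrow> 'a set \<Rightarrow> rat set \<Rightarrow> (rat \<Rightarrow> 'a \<Rightarrow> 'a) \<Rightarrow> (rat \<Rightarrow> 'a) ring" where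
  "tseries R K \<Gamma> \<tau> = \<lparr>carrier = {f. (\<forall>s. f s \<in> K) \<and> (\<forall>s. f s \<noteq> \<zero>\<^bsub>R\<^esub> \<longrightarrow> s \<in> \<Gamma>) \<and>
        (\<forall>x. finite {s. f s \<noteq> \<zero>\<^bsub>R\<^esub> \<and> s \<le> x})},
     monoid.mult = (\<lambda>f g r. \<Oplus>\<^bsub>R\<^esub>s\<in>{s. f s \<noteq> \<zero>\<^bsub>R\<^esub> \<and> g (r - s) \<noteq> \<zero>\<^bsub>R\<^esub>}. f s \<otimes>\<^bsub>R\<^esub> \<tau> s (g (r - s))),
     one = (\<lambda>s. if s = 0 then \<one>\<^bsub>R\<^esub> else \<zero>\<^bsub>R\<^esub>),
     ring.zero = (\<lambda>s. \<zero>\<^bsub>R\<^esub>),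
     ring.add = (\<lambda>f g s. f s \<oplus>\<^bsub>R\<^esub> g s)\<rparr>"

lemma tseries_simps [simp]:
  "\<one>\<^bsub>tseries R K \<Gamma> \<tau>\<^esub> = (\<lambda>s. if s = 0 then \<one>\<^bsub>R\<^esub> else \<zero>\<^bsub>R\<^esub>)"
  "\<zero>\<^bsub>tseries R K \<Gamma> \<tau>\<^esub> = (\<lambda>s. \<zero>\<^bsub>R\<^esub>)"
  "f \<oplus>\<^bsub>tseries R K \<Gamma> \<tau>\<^esub> g = (\<lambda>s. f s \<oplus>\<^bsub>R\<^esub> g s)"
  by (simp_all add: tseries_def)

lemma tseries_carrier:
  "f \<in> carrier (tseries R K \<Gamma> \<tau>) \<longleftrightarrow> (\<forall>s. f s \<in> K) \<and> (\<forall>s. f s \<noteq> \<zero>\<^bsub>R\<^esub> \<longrightarrow> s \<in> \<Gamma>) \<and>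
        (\<forall>x. finite {s. f s \<noteq> \<zero>\<^bsub>R\<^esub> \<and> s \<le> x})"
  by (simp add: tseries_def)

lemma tseries_mult:
  "(f \<otimes>\<^bsub>tseries R K \<Gamma> \<tau>\<^esub> g) r = (\<Oplus>\<^bsub>R\<^esub>s\<in>{s. f s \<noteq> \<zero>\<^bsub>R\<^esub> \<and> g (r - s) \<noteq> \<zero>\<^bsub>R\<^esub>}. f s \<otimes>\<^bsub>R\<^esub> \<tau> s (g (r - s)))"
  by (simp add: tseries_def)

text \<open>Each \<open>\<tau> s\<close> has to be a homomorphism, but the law for
  \<open>\<tau> (s + t)\<close> is demanded on \<open>\<Gamma>\<close> only: in the tower the action
  is extended by the identity outside \<open>\<Gamma>\<close>, where that law may fail.\<close>

locale twisted_series = divring R for R (structure) +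
  fixes K :: "'a set" and \<Gamma> :: "rat set" and \<tau> :: "rat \<Rightarrow> 'a \<Rightarrow> 'a"
  assumes K: "subdivring K R"
    and \<Gamma>0: "0 \<in> \<Gamma>" and \<Gamma>_add: "\<And>s t. s \<in> \<Gamma> \<Longrightarrow> t \<in> \<Gamma> \<Longrightarrow> s + t \<in> \<Gamma>"
    and \<Gamma>_neg: "\<And>s. s \<in> \<Gamma> \<Longrightarrow> - s \<in> \<Gamma>"
    and \<tau>_closed: "\<And>s x. x \<in> K \<Longrightarrow> \<tau> s x \<in> K"
    and \<tau>_add: "\<And>s x y. x \<in> K \<Longrightarrow> y \<in> K \<Longrightarrow> \<tau> s (x \<oplus> y) = \<tau> s x \<oplus> \<tau> s y"
    and \<tau>_mult: "\<And>s x y. x \<in> K \<Longrightarrow> y \<in> K \<Longrightarrow> \<tau> s (x \<otimes> y) = \<tau> s x \<otimes> \<tau> s y"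
    and \<tau>_one: "\<And>s. \<tau> s \<one> = \<one>"
    and \<tau>_0: "\<And>x. x \<in> K \<Longrightarrow> \<tau> 0 x = x"
    and \<tau>_comp: "\<And>s t x. s \<in> \<Gamma> \<Longrightarrow> t \<in> \<Gamma> \<Longrightarrow> x \<in> K \<Longrightarrow> \<tau> (s + t) x = \<tau> s (\<tau> t x)"
begin

abbreviation "S \<equiv> tseries R K \<Gamma> \<tau>"

lemmas Ks = subdivringE[OF K]

lemma Kc [simp]: "x \<in> K \<Longrightarrow> x \<in> carrier R" using Ks(2) by auto

lemma \<tau>_zero: "\<tau> s \<zero> = \<zero>"
proof -
  have "\<tau> s \<zero> \<oplus> \<tau> s \<zero> = \<tau> s \<zero>" using \<tau>_add[of \<zero> \<zero> s] Ks by simp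
  then show ?thesis using \<tau>_closed[of \<zero> s] Ks(3) by simp
qed

context
  notes \<tau>_zero [simp]
begin

lemma SK: "f \<in> carrier S \<Longrightarrow> f s \<in> K" and S\<Gamma>: "f \<in> carrier S \<Longrightarrow> f s \<noteq> \<zero> \<Longrightarrow> s \<in> \<Gamma>"
  and Sfin: "f \<in> carrier S \<Longrightarrow> finite {s. f s \<noteq> \<zero> \<and> s \<le> x}"
  by (auto simp: tseries_carrier)

lemma Sc [simp]: "f \<in> carrier S \<Longrightarrow> f s \<in> carrier R" using SK by auto

lemma \<tau>c [simp]: "f \<in> carrier S \<Longrightarrow> \<tau> t (f s) \<in> carrier R" using SK \<tau>_closed by auto

lemma lower_bound:
  assumes "f \<in> carrier S" obtains a where "\<And>s. f s \<noteq> \<zero> \<Longrightarrow> a \<le> s"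
proof -
  \<comment> \<open>The element \<open>0\<close> keeps \<open>Min\<close> meaningful when there are
    no negative exponents and is itself a bound for the positive ones.\<close>
  let ?A = "insert 0 {s. f s \<noteq> \<zero> \<and> s \<le> 0}"
  have fin: "finite ?A" using Sfin[OF assms] by simp
  have "Min ?A \<le> s" if "f s \<noteq> \<zero>" for s
  proof (cases "s \<le> 0")
    case True then show ?thesis using fin that by (intro Min_le) auto
  next
    case False
    have "Min ?A \<le> 0" using fin by (intro Min_le) auto
    then show ?thesis using False by simp
  qed
  then show thesis by (rule that)
qed

lemma mult_support_finite:
  assumes f: "f \<in> carrier S" and g: "g \<in> carrier S"
  shows "finite {s. f s \<noteq> \<zero> \<and> g (r - s) \<noteq> \<zero>}"
proof -
  obtain b where b: "\<And>s. g s \<noteq> \<zero> \<Longrightarrow> b \<le> s" using lower_bound[OF g] by blast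
  have "{s. f s \<noteq> \<zero> \<and> g (r - s) \<noteq> \<zero>} \<subseteq> {s. f s \<noteq> \<zero> \<and> s \<le> r - b}" using b by force
  then show ?thesis using Sfin[OF f] finite_subset by blast
qed

text \<open>The defining sum runs over a set that depends on both series. Any finite superset may
  replace it, so that several products can be computed over a common index set.\<close>

lemma mult_eq:
  assumes f: "f \<in> carrier S" and g: "g \<in> carrier S"
    and A: "finite A" "\<And>s. f s \<noteq> \<zero> \<Longrightarrow> g (r - s) \<noteq> \<zero> \<Longrightarrow> s \<in> A"
  shows "(f \<otimes>\<^bsub>S\<^esub> g) r = (\<Oplus>s\<in>A. f s \<otimes> \<tau> s (g (r - s)))"
  unfolding tseries_mult
proof (rule finsum_mono_zero)
  fix s assume "s \<in> A - {s. f s \<noteq> \<zero> \<and> g (r - s) \<noteq> \<zero>}"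
  then consider "f s = \<zero>" | "g (r - s) = \<zero>" by auto
  then show "f s \<otimes> \<tau> s (g (r - s)) = \<zero>" by cases (use f g in auto)
qed (use A f g in auto)

lemma mult_support:
  assumes "(f \<otimes>\<^bsub>S\<^esub> g) r \<noteq> \<zero>" obtains s where "f s \<noteq> \<zero>" "g (r - s) \<noteq> \<zero>"
proof -
  have "{s. f s \<noteq> \<zero> \<and> g (r - s) \<noteq> \<zero>} \<noteq> {}"
  proof
    assume "{s. f s \<noteq> \<zero> \<and> g (r - s) \<noteq> \<zero>} = {}"
    then have "(f \<otimes>\<^bsub>S\<^esub> g) r = (\<Oplus>s\<in>{}. f s \<otimes> \<tau> s (g (r - s)))" by (simp only: tseries_mult)
    then show False using assms by simp
  qed
  then show thesis using that by auto
qed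

lemma S_mult_closed:
  assumes f: "f \<in> carrier S" and g: "g \<in> carrier S" shows "f \<otimes>\<^bsub>S\<^esub> g \<in> carrier S"
  unfolding tseries_carrier
proof (intro conjI allI impI)
  fix r
  show "(f \<otimes>\<^bsub>S\<^esub> g) r \<in> K" unfolding tseries_mult
    by (rule finsum_subring[OF Ks(1) mult_support_finite[OF f g]]) (use SK f g \<tau>_closed Ks(6) in auto)
  show "r \<in> \<Gamma>" if nz: "(f \<otimes>\<^bsub>S\<^esub> g) r \<noteq> \<zero>"
  proof -
    obtain s where "f s \<noteq> \<zero>" "g (r - s) \<noteq> \<zero>" using mult_support[OF nz] by blast
    then have "s + (r - s) \<in> \<Gamma>" using S\<Gamma> f g by (intro \<Gamma>_add) auto
    then show ?thesis by simp
  qed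
next
  fix x
  obtain a b where a: "\<And>s. f s \<noteq> \<zero> \<Longrightarrow> a \<le> s" and b: "\<And>s. g s \<noteq> \<zero> \<Longrightarrow> b \<le> s"
    using lower_bound[OF f] lower_bound[OF g] by metis
  have "{s. (f \<otimes>\<^bsub>S\<^esub> g) s \<noteq> \<zero> \<and> s \<le> x} \<subseteq>
      (\<lambda>(s,t). s + t) ` ({s. f s \<noteq> \<zero> \<and> s \<le> x - b} \<times> {t. g t \<noteq> \<zero> \<and> t \<le> x - a})"
  proof
    fix r assume "r \<in> {s. (f \<otimes>\<^bsub>S\<^esub> g) s \<noteq> \<zero> \<and> s \<le> x}"
    then have r: "(f \<otimes>\<^bsub>S\<^esub> g) r \<noteq> \<zero>" "r \<le> x" by auto
    obtain s where "f s \<noteq> \<zero>" "g (r - s) \<noteq> \<zero>" using mult_support[OF r(1)] by blast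
    then show "r \<in> (\<lambda>(s,t). s + t) ` ({s. f s \<noteq> \<zero> \<and> s \<le> x - b} \<times> {t. g t \<noteq> \<zero> \<and> t \<le> x - a})"
      using a[of s] b[of "r - s"] r(2) by (intro image_eqI[of _ _ "(s, r - s)"]) auto
  qed
  moreover have "finite \<dots>" using Sfin[OF f] Sfin[OF g] by auto
  ultimately show "finite {s. (f \<otimes>\<^bsub>S\<^esub> g) s \<noteq> \<zero> \<and> s \<le> x}" by (rule finite_subset)
qed

lemma \<tau>_finsum:
  assumes "finite A" "f \<in> A \<rightarrow> K" shows "\<tau> s (\<Oplus>i\<in>A. f i) = (\<Oplus>i\<in>A. \<tau> s (f i))"
  by (rule finsum_additive[OF ring_axioms assms]) (use Ks \<tau>_closed \<tau>_add in auto)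

text \<open>Both sides are the same finite double sum, over the exponent \<open>s\<close> taken from
  \<open>f\<close> and the exponent \<open>u\<close> of the product of \<open>f\<close> and
  \<open>g\<close>.\<close>

lemma S_assoc:
  assumes f: "f \<in> carrier S" and g: "g \<in> carrier S" and h: "h \<in> carrier S"
  shows "f \<otimes>\<^bsub>S\<^esub> g \<otimes>\<^bsub>S\<^esub> h = f \<otimes>\<^bsub>S\<^esub> (g \<otimes>\<^bsub>S\<^esub> h)"
proof
  fix r
  obtain a b c where a: "\<And>s. f s \<noteq> \<zero> \<Longrightarrow> a \<le> s" and b: "\<And>s. g s \<noteq> \<zero> \<Longrightarrow> b \<le> s" and c: "\<And>s. h s \<noteq> \<zero> \<Longrightarrow> c \<le> s"
    using lower_bound[OF f] lower_bound[OF g] lower_bound[OF h] by metis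
  \<comment> \<open>With lower bounds \<open>b\<close> and \<open>c\<close> for the supports of
    \<open>g\<close> and \<open>h\<close>, an exponent of \<open>f\<close> above
    \<open>r - b - c\<close> cannot contribute to the coefficient at \<open>r\<close>;
    \<open>Sg\<close> is bounded in the same way.\<close>
  define Sf where "Sf = {s. f s \<noteq> \<zero> \<and> s \<le> r - b - c}"
  define Sg where "Sg = {s. g s \<noteq> \<zero> \<and> s \<le> r - a - c}"
  define U where "U = (\<lambda>(s,t). s + t) ` (Sf \<times> Sg)"
  have fin: "finite Sf" "finite Sg" "finite U" using Sfin[OF f] Sfin[OF g] by (auto simp: Sf_def Sg_def U_def)
  let ?T = "\<lambda>u s. f s \<otimes> \<tau> s (g (u - s)) \<otimes> \<tau> u (h (r - u))"
  have Tc: "?T u s \<in> carrier R" for u s using f g h by simp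
  have "(f \<otimes>\<^bsub>S\<^esub> g \<otimes>\<^bsub>S\<^esub> h) r = (\<Oplus>u\<in>U. (f \<otimes>\<^bsub>S\<^esub> g) u \<otimes> \<tau> u (h (r - u)))"
  proof (rule mult_eq[OF S_mult_closed[OF f g] h fin(3)])
    fix u assume u: "(f \<otimes>\<^bsub>S\<^esub> g) u \<noteq> \<zero>" and hu: "h (r - u) \<noteq> \<zero>"
    obtain s where s: "f s \<noteq> \<zero>" "g (u - s) \<noteq> \<zero>" using mult_support[OF u] by blast
    then have "s \<in> Sf" "u - s \<in> Sg" using a[OF s(1)] b[OF s(2)] c[OF hu] by (auto simp: Sf_def Sg_def)
    then show "u \<in> U" unfolding U_def by (intro image_eqI[of _ _ "(s, u - s)"]) auto
  qed
  also have "\<dots> = (\<Oplus>u\<in>U. \<Oplus>s\<in>Sf. ?T u s)"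
  proof (rule finsum_cong')
    fix u assume "u \<in> U"
    show "(f \<otimes>\<^bsub>S\<^esub> g) u \<otimes> \<tau> u (h (r - u)) = (\<Oplus>s\<in>Sf. ?T u s)"
    proof (cases "h (r - u) = \<zero>")
      case True
      have "(\<Oplus>s\<in>Sf. ?T u s) = \<zero>" by (rule add.finprod_one_eqI) (use True f g in simp)
      then show ?thesis using True S_mult_closed[OF f g] by simp
    next
      case False
      have "(f \<otimes>\<^bsub>S\<^esub> g) u = (\<Oplus>s\<in>Sf. f s \<otimes> \<tau> s (g (u - s)))"
        by (rule mult_eq[OF f g fin(1)]) (use b c[OF False] in \<open>force simp: Sf_def\<close>)
      then show ?thesis using fin f g h by (simp add: finsum_ldistr)
    qed
  qed (use Tc in auto)
  also have "\<dots> = (\<Oplus>s\<in>Sf. \<Oplus>u\<in>U. ?T u s)" using fin Tc by (intro finsum_swap) auto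
  also have "\<dots> = (\<Oplus>s\<in>Sf. f s \<otimes> \<tau> s ((g \<otimes>\<^bsub>S\<^esub> h) (r - s)))"
  proof (rule finsum_cong')
    fix s assume s: "s \<in> Sf"
    let ?V = "(\<lambda>u. u - s) ` U"
    have "(g \<otimes>\<^bsub>S\<^esub> h) (r - s) = (\<Oplus>v\<in>?V. g v \<otimes> \<tau> v (h (r - s - v)))"
    proof (rule mult_eq[OF g h])
      fix v assume v: "g v \<noteq> \<zero>" "h (r - s - v) \<noteq> \<zero>"
      have "a \<le> s" using a s by (auto simp: Sf_def)
      then have "v \<in> Sg" using c[OF v(2)] v by (auto simp: Sg_def)
      then have "s + v \<in> U" using s unfolding U_def by (intro image_eqI[of _ _ "(s, v)"]) auto
      then show "v \<in> ?V" by (intro image_eqI[of _ _ "s + v"]) auto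
    qed (use fin in auto)
    also have "\<dots> = (\<Oplus>u\<in>U. g (u - s) \<otimes> \<tau> (u - s) (h (r - u)))"
      using g h by (subst finsum_reindex) (auto simp: inj_on_def)
    finally have "\<tau> s ((g \<otimes>\<^bsub>S\<^esub> h) (r - s)) = (\<Oplus>u\<in>U. \<tau> s (g (u - s) \<otimes> \<tau> (u - s) (h (r - u))))"
      using fin SK[OF g] SK[OF h] \<tau>_closed Ks(6) by (simp add: \<tau>_finsum)
    also have "\<dots> = (\<Oplus>u\<in>U. \<tau> s (g (u - s)) \<otimes> \<tau> u (h (r - u)))"
    proof (rule finsum_cong')
      fix u assume "u \<in> U"
      show "\<tau> s (g (u - s) \<otimes> \<tau> (u - s) (h (r - u))) = \<tau> s (g (u - s)) \<otimes> \<tau> u (h (r - u))"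
      \<comment> \<open>The composition law needs both indices in \<open>\<Gamma>\<close>. A nonzero
        coefficient guarantees this for \<open>u - s\<close>; a zero one makes the two sides
        vanish.\<close>
      proof (cases "g (u - s) = \<zero>")
        case True then show ?thesis using h by simp
      next
        case False
        have "s \<in> \<Gamma>" "u - s \<in> \<Gamma>" using S\<Gamma>[OF f] S\<Gamma>[OF g False] s by (auto simp: Sf_def)
        then have "\<tau> u (h (r - u)) = \<tau> s (\<tau> (u - s) (h (r - u)))" using \<tau>_comp[of s "u - s" "h (r - u)"] SK[OF h] by simp
        then show ?thesis using \<tau>_mult SK[OF g] SK[OF h] \<tau>_closed by simp
      qed
    qed (use g h in auto)
    finally show "(\<Oplus>u\<in>U. ?T u s) = f s \<otimes> \<tau> s ((g \<otimes>\<^bsub>S\<^esub> h) (r - s))"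
      using fin f g h by (simp add: finsum_rdistr m_assoc)
  qed (use f S_mult_closed[OF g h] in auto)
  also have "\<dots> = (f \<otimes>\<^bsub>S\<^esub> (g \<otimes>\<^bsub>S\<^esub> h)) r"
  proof (rule mult_eq[OF f S_mult_closed[OF g h] fin(1), symmetric])
    fix s assume s: "f s \<noteq> \<zero>" "(g \<otimes>\<^bsub>S\<^esub> h) (r - s) \<noteq> \<zero>"
    obtain v where v: "g v \<noteq> \<zero>" "h (r - s - v) \<noteq> \<zero>" using mult_support[OF s(2)] by blast
    show "s \<in> Sf" using b[OF v(1)] c[OF v(2)] s by (auto simp: Sf_def)
  qed
  finally show "(f \<otimes>\<^bsub>S\<^esub> g \<otimes>\<^bsub>S\<^esub> h) r = (f \<otimes>\<^bsub>S\<^esub> (g \<otimes>\<^bsub>S\<^esub> h)) r" .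
qed

section \<open>Monomials and the ring laws for twisted series\<close>

definition "monom_at a s = (\<lambda>r. if r = s then a else \<zero>)"

lemma monom_closed: "a \<in> K \<Longrightarrow> s \<in> \<Gamma> \<Longrightarrow> monom_at a s \<in> carrier S"
  using Ks(3) by (auto simp: tseries_carrier monom_at_def intro: finite_subset[of _ "{s}"])

lemma monom_mult:
  assumes "a \<in> K" "s \<in> \<Gamma>" "f \<in> carrier S"
  shows "(monom_at a s \<otimes>\<^bsub>S\<^esub> f) r = a \<otimes> \<tau> s (f (r - s))"
proof -
  have "(monom_at a s \<otimes>\<^bsub>S\<^esub> f) r = (\<Oplus>t\<in>{s}. monom_at a s t \<otimes> \<tau> t (f (r - t)))"
    by (rule mult_eq[OF monom_closed[OF assms(1,2)] assms(3)]) (auto simp: monom_at_def split: if_splits)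
  then show ?thesis using assms by (simp add: monom_at_def finsum_insert)
qed

lemma S_one: "\<one>\<^bsub>S\<^esub> = monom_at \<one> 0" by (auto simp: monom_at_def)

lemma S_add_closed:
  assumes f: "f \<in> carrier S" and g: "g \<in> carrier S" shows "f \<oplus>\<^bsub>S\<^esub> g \<in> carrier S"
proof -
  have "finite {s. f s \<oplus> g s \<noteq> \<zero> \<and> s \<le> x}" for x
    by (rule finite_subset[of _ "{s. f s \<noteq> \<zero> \<and> s \<le> x} \<union> {s. g s \<noteq> \<zero> \<and> s \<le> x}"]) (use Sfin f g in auto)
  moreover have "s \<in> \<Gamma>" if "f s \<oplus> g s \<noteq> \<zero>" for s
  proof (rule ccontr)
    assume "s \<notin> \<Gamma>"
    then have "f s = \<zero>" "g s = \<zero>" using S\<Gamma>[OF f] S\<Gamma>[OF g] by blast+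
    then show False using that by simp
  qed
  ultimately show ?thesis using SK[OF f] SK[OF g] Ks(7) by (simp add: tseries_carrier)
qed

lemma S_uminus_closed:
  assumes f: "f \<in> carrier S" shows "(\<lambda>s. \<ominus> f s) \<in> carrier S"
proof -
  have "\<ominus> f s \<noteq> \<zero> \<longleftrightarrow> f s \<noteq> \<zero>" for s using Sc[OF f, of s] by (metis minus_minus minus_zero)
  then show ?thesis using SK[OF f] Ks(5) Sfin[OF f] S\<Gamma>[OF f] by (simp add: tseries_carrier)
qed

lemma S_l_distr:
  assumes f: "f \<in> carrier S" and g: "g \<in> carrier S" and h: "h \<in> carrier S"
  shows "(f \<oplus>\<^bsub>S\<^esub> g) \<otimes>\<^bsub>S\<^esub> h = f \<otimes>\<^bsub>S\<^esub> h \<oplus>\<^bsub>S\<^esub> g \<otimes>\<^bsub>S\<^esub> h"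
proof
  fix r
  let ?A = "{s. f s \<noteq> \<zero> \<and> h (r - s) \<noteq> \<zero>} \<union> {s. g s \<noteq> \<zero> \<and> h (r - s) \<noteq> \<zero>}"
  have A: "finite ?A" using mult_support_finite f g h by auto
  have "((f \<oplus>\<^bsub>S\<^esub> g) \<otimes>\<^bsub>S\<^esub> h) r = (\<Oplus>s\<in>?A. (f \<oplus>\<^bsub>S\<^esub> g) s \<otimes> \<tau> s (h (r - s)))"
    by (rule mult_eq[OF S_add_closed[OF f g] h A]) auto
  also have "\<dots> = (\<Oplus>s\<in>?A. f s \<otimes> \<tau> s (h (r - s)) \<oplus> g s \<otimes> \<tau> s (h (r - s)))"
    using f g h by (intro finsum_cong') (auto simp: l_distr)
  also have "\<dots> = (\<Oplus>s\<in>?A. f s \<otimes> \<tau> s (h (r - s))) \<oplus> (\<Oplus>s\<in>?A. g s \<otimes> \<tau> s (h (r - s)))"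
    using f g h by (intro finsum_addf) auto
  also have "(\<Oplus>s\<in>?A. f s \<otimes> \<tau> s (h (r - s))) = (f \<otimes>\<^bsub>S\<^esub> h) r" by (rule mult_eq[OF f h A, symmetric]) auto
  also have "(\<Oplus>s\<in>?A. g s \<otimes> \<tau> s (h (r - s))) = (g \<otimes>\<^bsub>S\<^esub> h) r" by (rule mult_eq[OF g h A, symmetric]) auto
  finally show "((f \<oplus>\<^bsub>S\<^esub> g) \<otimes>\<^bsub>S\<^esub> h) r = (f \<otimes>\<^bsub>S\<^esub> h \<oplus>\<^bsub>S\<^esub> g \<otimes>\<^bsub>S\<^esub> h) r" by simp
qed

lemma S_r_distr:
  assumes f: "f \<in> carrier S" and g: "g \<in> carrier S" and h: "h \<in> carrier S"
  shows "h \<otimes>\<^bsub>S\<^esub> (f \<oplus>\<^bsub>S\<^esub> g) = h \<otimes>\<^bsub>S\<^esub> f \<oplus>\<^bsub>S\<^esub> h \<otimes>\<^bsub>S\<^esub> g"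
proof
  fix r
  let ?A = "{s. h s \<noteq> \<zero> \<and> f (r - s) \<noteq> \<zero>} \<union> {s. h s \<noteq> \<zero> \<and> g (r - s) \<noteq> \<zero>}"
  have A: "finite ?A" using mult_support_finite f g h by auto
  have "(h \<otimes>\<^bsub>S\<^esub> (f \<oplus>\<^bsub>S\<^esub> g)) r = (\<Oplus>s\<in>?A. h s \<otimes> \<tau> s ((f \<oplus>\<^bsub>S\<^esub> g) (r - s)))"
    by (rule mult_eq[OF h S_add_closed[OF f g] A]) auto
  also have "\<dots> = (\<Oplus>s\<in>?A. h s \<otimes> \<tau> s (f (r - s)) \<oplus> h s \<otimes> \<tau> s (g (r - s)))"
    using f g h SK[OF f] SK[OF g] by (intro finsum_cong') (auto simp: r_distr \<tau>_add)
  also have "\<dots> = (\<Oplus>s\<in>?A. h s \<otimes> \<tau> s (f (r - s))) \<oplus> (\<Oplus>s\<in>?A. h s \<otimes> \<tau> s (g (r - s)))"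
    using f g h by (intro finsum_addf) auto
  also have "(\<Oplus>s\<in>?A. h s \<otimes> \<tau> s (f (r - s))) = (h \<otimes>\<^bsub>S\<^esub> f) r" by (rule mult_eq[OF h f A, symmetric]) auto
  also have "(\<Oplus>s\<in>?A. h s \<otimes> \<tau> s (g (r - s))) = (h \<otimes>\<^bsub>S\<^esub> g) r" by (rule mult_eq[OF h g A, symmetric]) auto
  finally show "(h \<otimes>\<^bsub>S\<^esub> (f \<oplus>\<^bsub>S\<^esub> g)) r = (h \<otimes>\<^bsub>S\<^esub> f \<oplus>\<^bsub>S\<^esub> h \<otimes>\<^bsub>S\<^esub> g) r" by simp
qed

lemma S_ring: "ring S"
proof (rule ringI)
  show "abelian_group S"
  proof (rule abelian_groupI)
    show "\<zero>\<^bsub>S\<^esub> \<in> carrier S" using Ks(3) by (simp add: tseries_carrier)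
    fix x assume x: "x \<in> carrier S"
    show "\<exists>y\<in>carrier S. y \<oplus>\<^bsub>S\<^esub> x = \<zero>\<^bsub>S\<^esub>"
      by (rule bexI[OF _ S_uminus_closed[OF x]]) (use x in \<open>simp add: l_neg\<close>)
    show "\<zero>\<^bsub>S\<^esub> \<oplus>\<^bsub>S\<^esub> x = x" using x by simp
  qed (use S_add_closed in \<open>auto simp: a_ac fun_eq_iff\<close>)
  show "monoid S"
  proof (rule monoidI)
    have one: "\<one>\<^bsub>S\<^esub> \<in> carrier S" unfolding S_one by (rule monom_closed) (use Ks \<Gamma>0 in auto)
    show "\<one>\<^bsub>S\<^esub> \<in> carrier S" by (rule one)
    fix f assume f: "f \<in> carrier S"
    show "\<one>\<^bsub>S\<^esub> \<otimes>\<^bsub>S\<^esub> f = f"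
      unfolding S_one using monom_mult[OF Ks(4) \<Gamma>0 f] f \<tau>_0[OF SK[OF f]] by (simp add: fun_eq_iff)
    show "f \<otimes>\<^bsub>S\<^esub> \<one>\<^bsub>S\<^esub> = f"
    proof
      fix r
      have "(f \<otimes>\<^bsub>S\<^esub> \<one>\<^bsub>S\<^esub>) r = (\<Oplus>s\<in>{r}. f s \<otimes> \<tau> s (\<one>\<^bsub>S\<^esub> (r - s)))"
        by (rule mult_eq[OF f one]) (auto split: if_splits)
      then show "(f \<otimes>\<^bsub>S\<^esub> \<one>\<^bsub>S\<^esub>) r = f r" using f by (simp add: \<tau>_one finsum_insert)
    qed
  qed (use S_mult_closed S_assoc in auto)
qed (use S_l_distr S_r_distr in auto)

end

sublocale S: ring S by (rule S_ring)

context
  notes \<tau>_zero [simp]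
begin

lemma S_minus: "f \<in> carrier S \<Longrightarrow> \<ominus>\<^bsub>S\<^esub> f = (\<lambda>s. \<ominus> f s)"
  by (rule S.minus_equality) (use S_uminus_closed in \<open>auto simp: l_neg\<close>)

text \<open>If the left factor has no negative exponents, the coefficient at \<open>r\<close> sees
  only the coefficients of the right factor up to \<open>r\<close>. This lets a limit be replaced by
  a partial sum.\<close>

lemma mult_local:
  assumes u: "\<And>s. u s \<noteq> \<zero> \<Longrightarrow> 0 \<le> s" and uv: "u \<in> carrier S" "v \<in> carrier S" "v' \<in> carrier S"
    and e: "\<And>t. t \<le> r \<Longrightarrow> v t = v' t"
  shows "(u \<otimes>\<^bsub>S\<^esub> v) r = (u \<otimes>\<^bsub>S\<^esub> v') r"
proof -
  have eq: "u s \<noteq> \<zero> \<Longrightarrow> v (r - s) = v' (r - s)" for s using u[of s] e[of "r - s"] by simp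
  then have "{s. u s \<noteq> \<zero> \<and> v (r - s) \<noteq> \<zero>} = {s. u s \<noteq> \<zero> \<and> v' (r - s) \<noteq> \<zero>}" by auto
  then show ?thesis unfolding tseries_mult
    by (intro finsum_cong') (use uv eq in auto)
qed

text \<open>The support of the power \<open>k\<close> of \<open>g\<close> starts at
  \<open>k \<epsilon>\<close> or later, so each coefficient of the geometric series becomes constant
  after finitely many partial sums.\<close>

lemma geometric_inverse:
  assumes g: "g \<in> carrier S" and \<epsilon>: "0 < \<epsilon>" "\<And>s. g s \<noteq> \<zero> \<Longrightarrow> \<epsilon> \<le> s"
  shows "\<exists>b\<in>carrier S. (\<one>\<^bsub>S\<^esub> \<ominus>\<^bsub>S\<^esub> g) \<otimes>\<^bsub>S\<^esub> b = \<one>\<^bsub>S\<^esub>"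
proof -
  define P where "P N = (\<Oplus>\<^bsub>S\<^esub>k\<in>{..<N}. g [^]\<^bsub>S\<^esub> k)" for N :: nat
  have Pc: "P N \<in> carrier S" for N using g by (auto simp: P_def)
  have PS: "P (Suc N) = P N \<oplus>\<^bsub>S\<^esub> g [^]\<^bsub>S\<^esub> N" for N
    unfolding P_def lessThan_Suc using g by (subst S.finsum_insert) (auto simp del: tseries_simps intro: S.a_comm)
  have pow: "(g [^]\<^bsub>S\<^esub> (k::nat)) r \<noteq> \<zero> \<Longrightarrow> of_nat k * \<epsilon> \<le> r" for k r
  proof (induction k arbitrary: r)
    case 0 then show ?case by (auto split: if_splits)
  next
    case (Suc k)
    then have "(g [^]\<^bsub>S\<^esub> k \<otimes>\<^bsub>S\<^esub> g) r \<noteq> \<zero>" by simp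
    then obtain s where s: "(g [^]\<^bsub>S\<^esub> k) s \<noteq> \<zero>" "g (r - s) \<noteq> \<zero>" by (rule mult_support)
    then show ?case using Suc.IH[OF s(1)] \<epsilon>(2)[OF s(2)] by (simp add: algebra_simps)
  qed
  have stable: "P M r = P N r" if "N \<le> M" "r < of_nat N * \<epsilon>" for M N r
    using that(1)
  proof (induction M rule: dec_induct)
    case base show ?case by simp
  next
    case (step M)
    have "of_nat N * \<epsilon> \<le> of_nat M * \<epsilon>" using step.hyps \<epsilon>(1) by simp
    then have "(g [^]\<^bsub>S\<^esub> M) r = \<zero>" using pow[of M r] that(2) by fastforce
    then show ?case using step.IH Sc[OF Pc[of N]] by (simp add: PS)
  qed
  have ex: "\<exists>N::nat. r < of_nat N * \<epsilon>" for r :: rat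
  proof -
    obtain N :: nat where "r / \<epsilon> < of_nat N" using reals_Archimedean2 by blast
    then show ?thesis using \<epsilon>(1) by (auto simp: field_simps)
  qed
  \<comment> \<open>The number of terms that determines the coefficient at \<open>r\<close>; all
    later powers start above \<open>r\<close>.\<close>
  define Nr where "Nr r = (LEAST N::nat. r < of_nat N * \<epsilon>)" for r :: rat
  have Nr: "r < of_nat (Nr r) * \<epsilon>" for r using LeastI_ex[OF ex[of r]] by (simp add: Nr_def)
  define b where "b r = P (Nr r) r" for r
  have bP: "b r = P N r" if "r < of_nat N * \<epsilon>" for r N
  proof -
    have "Nr r \<le> N" using that by (auto simp: Nr_def intro: Least_le)
    from stable[OF this Nr] show ?thesis unfolding b_def by (rule sym)
  qed
  have bc: "b \<in> carrier S"
    unfolding tseries_carrier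
  proof (intro conjI allI impI)
    show "b s \<in> K" for s using SK[OF Pc] by (simp add: b_def)
    show "s \<in> \<Gamma>" if "b s \<noteq> \<zero>" for s using S\<Gamma>[OF Pc] that by (auto simp: b_def)
    show "finite {s. b s \<noteq> \<zero> \<and> s \<le> x}" for x
    proof -
      obtain N where "x < of_nat N * \<epsilon>" using ex by blast
      then have "{s. b s \<noteq> \<zero> \<and> s \<le> x} \<subseteq> {s. P N s \<noteq> \<zero> \<and> s \<le> x}" using bP[of _ N] by force
      then show ?thesis using Sfin[OF Pc] finite_subset by blast
    qed
  qed
  have tel: "(\<one>\<^bsub>S\<^esub> \<ominus>\<^bsub>S\<^esub> g) \<otimes>\<^bsub>S\<^esub> P N = \<one>\<^bsub>S\<^esub> \<ominus>\<^bsub>S\<^esub> g [^]\<^bsub>S\<^esub> N" for N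
  proof (induction N)
    case 0 show ?case using g by (simp add: P_def a_minus_def S.r_neg del: tseries_simps)
  next
    case (Suc N)
    define q where "q = g [^]\<^bsub>S\<^esub> N"
    have q: "q \<in> carrier S" using g by (simp add: q_def)
    have comm: "g \<otimes>\<^bsub>S\<^esub> q = q \<otimes>\<^bsub>S\<^esub> g" unfolding q_def using S.nat_pow_Suc2[OF g, of N] by simp
    have "(\<one>\<^bsub>S\<^esub> \<ominus>\<^bsub>S\<^esub> g) \<otimes>\<^bsub>S\<^esub> P (Suc N) = (\<one>\<^bsub>S\<^esub> \<ominus>\<^bsub>S\<^esub> q) \<oplus>\<^bsub>S\<^esub> (\<one>\<^bsub>S\<^esub> \<ominus>\<^bsub>S\<^esub> g) \<otimes>\<^bsub>S\<^esub> q"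
      using Suc Pc g q unfolding PS q_def[symmetric] by (simp add: S.r_distr del: tseries_simps)
    also have "(\<one>\<^bsub>S\<^esub> \<ominus>\<^bsub>S\<^esub> g) \<otimes>\<^bsub>S\<^esub> q = q \<ominus>\<^bsub>S\<^esub> q \<otimes>\<^bsub>S\<^esub> g"
      using g q by (simp add: S.l_distr S.l_minus a_minus_def comm del: tseries_simps)
    also have "(\<one>\<^bsub>S\<^esub> \<ominus>\<^bsub>S\<^esub> q) \<oplus>\<^bsub>S\<^esub> (q \<ominus>\<^bsub>S\<^esub> q \<otimes>\<^bsub>S\<^esub> g) = \<one>\<^bsub>S\<^esub> \<ominus>\<^bsub>S\<^esub> q \<otimes>\<^bsub>S\<^esub> g"
    proof -
      have "\<ominus>\<^bsub>S\<^esub> q \<oplus>\<^bsub>S\<^esub> (q \<oplus>\<^bsub>S\<^esub> \<ominus>\<^bsub>S\<^esub> (q \<otimes>\<^bsub>S\<^esub> g)) = \<ominus>\<^bsub>S\<^esub> (q \<otimes>\<^bsub>S\<^esub> g)"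
        using g q by (simp add: S.a_assoc[symmetric] S.l_neg del: tseries_simps)
      then show ?thesis using g q by (simp add: a_minus_def S.a_assoc del: tseries_simps)
    qed
    finally show ?case by (simp add: q_def del: tseries_simps)
  qed
  have wc: "\<one>\<^bsub>S\<^esub> \<ominus>\<^bsub>S\<^esub> g \<in> carrier S" using g by (simp del: tseries_simps)
  have w: "(\<one>\<^bsub>S\<^esub> \<ominus>\<^bsub>S\<^esub> g) s = (if s = 0 then \<one> else \<zero>) \<ominus> g s" if "g \<in> carrier S" for s g
    unfolding a_minus_def using that by (simp add: S_minus)
  have wpos: "0 \<le> s" if "(\<one>\<^bsub>S\<^esub> \<ominus>\<^bsub>S\<^esub> g) s \<noteq> \<zero>" for s
    using that \<epsilon>(1) \<epsilon>(2)[of s] unfolding w[OF g] by (cases "g s = \<zero>"; cases "s = 0") (auto simp: a_minus_def)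
  have "((\<one>\<^bsub>S\<^esub> \<ominus>\<^bsub>S\<^esub> g) \<otimes>\<^bsub>S\<^esub> b) r = \<one>\<^bsub>S\<^esub> r" for r
  proof -
    define N where "N = Nr r"
    have N: "r < of_nat N * \<epsilon>" using Nr by (simp add: N_def)
    have "((\<one>\<^bsub>S\<^esub> \<ominus>\<^bsub>S\<^esub> g) \<otimes>\<^bsub>S\<^esub> b) r = ((\<one>\<^bsub>S\<^esub> \<ominus>\<^bsub>S\<^esub> g) \<otimes>\<^bsub>S\<^esub> P N) r"
      by (rule mult_local[OF wpos wc bc Pc]) (use bP N in auto)
    also have "\<dots> = \<one>\<^bsub>S\<^esub> r \<ominus> (g [^]\<^bsub>S\<^esub> N) r" unfolding tel using w[of "g [^]\<^bsub>S\<^esub> N"] g by simp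
    also have "(g [^]\<^bsub>S\<^esub> N) r = \<zero>" using pow[of N r] N by fastforce
    finally show ?thesis by (simp add: a_minus_def)
  qed
  then show ?thesis using bc by blast
qed

text \<open>Dividing by the leading monomial on the left leaves a series \<open>u\<close> with
  constant term \<open>\<one>\<close> and no negative exponents, that is \<open>\<one>\<close> minus
  a series with support bounded away from \<open>0\<close>.\<close>

lemma right_inverse:
  assumes f: "f \<in> carrier S" "f \<noteq> \<zero>\<^bsub>S\<^esub>"
  shows "\<exists>b\<in>carrier S. f \<otimes>\<^bsub>S\<^esub> b = \<one>\<^bsub>S\<^esub>"
proof -
  obtain s1 where s1: "f s1 \<noteq> \<zero>" using f(2) by auto
  define s0 where "s0 = Min {s. f s \<noteq> \<zero> \<and> s \<le> s1}"
  have "s0 \<in> {s. f s \<noteq> \<zero> \<and> s \<le> s1}" unfolding s0_def using Sfin[OF f(1), of s1] s1 by (intro Min_in) auto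
  then have s0: "f s0 \<noteq> \<zero>" "s0 \<le> s1" by auto
  have below: "f s = \<zero>" if "s < s0" for s
  proof (rule ccontr)
    assume "f s \<noteq> \<zero>"
    then have "s0 \<le> s" unfolding s0_def using Sfin[OF f(1), of s1] that s0 by (intro Min_le) auto
    then show False using that by simp
  qed
  have G: "s0 \<in> \<Gamma>" "- s0 \<in> \<Gamma>" using S\<Gamma>[OF f(1) s0(1)] \<Gamma>_neg by auto
  define a where "a = f s0"
  have a: "a \<in> K" "a \<noteq> \<zero>" "inv a \<in> K" using SK[OF f(1)] s0 Ks(8) by (auto simp: a_def)
  define c where "c = monom_at a s0"
  \<comment> \<open>The inverse of \<open>a T^s0\<close> is \<open>T^(-s0)\<close> times the inverse
    of \<open>a\<close>; moving the coefficient to the left of the power applies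
    \<open>\<tau> (- s0)\<close> to it.\<close>
  define c' where "c' = monom_at (\<tau> (- s0) (inv a)) (- s0)"
  have ia: "\<tau> (- s0) (inv a) \<in> K" using a \<tau>_closed by auto
  have cc: "c \<in> carrier S" "c' \<in> carrier S" using monom_closed a G ia by (auto simp: c_def c'_def)
  have inv1: "c \<otimes>\<^bsub>S\<^esub> c' = \<one>\<^bsub>S\<^esub>"
  proof
    fix r
    have "\<tau> s0 (\<tau> (- s0) (inv a)) = inv a" using \<tau>_comp[OF G a(3)] \<tau>_0[OF a(3)] by simp
    then show "(c \<otimes>\<^bsub>S\<^esub> c') r = \<one>\<^bsub>S\<^esub> r"
      unfolding c_def monom_mult[OF a(1) G(1) cc(2)] using a by (auto simp: c'_def monom_at_def)
  qed
  define u where "u = c' \<otimes>\<^bsub>S\<^esub> f"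
  have u: "u \<in> carrier S" using cc f by (simp add: u_def)
  have ur: "u r = \<tau> (- s0) (inv a) \<otimes> \<tau> (- s0) (f (r + s0))" for r
    unfolding u_def c'_def using monom_mult[OF ia G(2) f(1)] by simp
  have u0: "u 0 = \<one>" using \<tau>_mult[OF a(3) a(1), of "- s0", symmetric] a \<tau>_one by (simp add: ur a_def[symmetric])
  have uneg: "u r = \<zero>" if "r < 0" for r using below[of "r + s0"] that ia by (simp add: ur)
  define g where "g = \<one>\<^bsub>S\<^esub> \<ominus>\<^bsub>S\<^esub> u"
  have g: "g \<in> carrier S" using u by (simp add: g_def del: tseries_simps)
  have gs: "g s = (if s = 0 then \<one> else \<zero>) \<ominus> u s" for s
    unfolding g_def a_minus_def using u by (simp add: S_minus)
  have gpos: "0 < s" if "g s \<noteq> \<zero>" for s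
    using that u0 uneg[of s] unfolding gs by (cases "s < 0"; cases "s = 0") (auto simp: a_minus_def r_neg)
  \<comment> \<open>A positive lower bound for the support of \<open>g\<close>: only the finitely
    many exponents up to \<open>1\<close> matter, and \<open>1\<close> itself covers the rest and
    the empty case.\<close>
  define \<epsilon> where "\<epsilon> = Min (insert 1 {s. g s \<noteq> \<zero> \<and> s \<le> 1})"
  have fin: "finite (insert 1 {s. g s \<noteq> \<zero> \<and> s \<le> 1})" using Sfin[OF g] by simp
  have \<epsilon>0: "0 < \<epsilon>" unfolding \<epsilon>_def using fin gpos by (subst Min_gr_iff) auto
  have \<epsilon>s: "\<epsilon> \<le> s" if "g s \<noteq> \<zero>" for s
  proof (cases "s \<le> 1")
    case True then show ?thesis unfolding \<epsilon>_def using fin that by (intro Min_le) auto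
  next
    case False
    have "\<epsilon> \<le> 1" unfolding \<epsilon>_def using fin by (intro Min_le) auto
    then show ?thesis using False by simp
  qed
  obtain b where b: "b \<in> carrier S" "(\<one>\<^bsub>S\<^esub> \<ominus>\<^bsub>S\<^esub> g) \<otimes>\<^bsub>S\<^esub> b = \<one>\<^bsub>S\<^esub>" using geometric_inverse[OF g \<epsilon>0 \<epsilon>s] by blast
  have "\<one>\<^bsub>S\<^esub> \<ominus>\<^bsub>S\<^esub> g = u" unfolding g_def using u
    by (simp add: a_minus_def S.minus_add S.a_assoc[symmetric] S.r_neg del: tseries_simps)
  then have ub: "c' \<otimes>\<^bsub>S\<^esub> f \<otimes>\<^bsub>S\<^esub> b = \<one>\<^bsub>S\<^esub>" using b(2) by (simp add: u_def)
  have fb: "f \<otimes>\<^bsub>S\<^esub> b = c"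
  proof -
    have "c \<otimes>\<^bsub>S\<^esub> (c' \<otimes>\<^bsub>S\<^esub> f \<otimes>\<^bsub>S\<^esub> b) = (c \<otimes>\<^bsub>S\<^esub> c') \<otimes>\<^bsub>S\<^esub> (f \<otimes>\<^bsub>S\<^esub> b)"
      using cc f b by (simp add: S.m_assoc del: tseries_simps)
    then show ?thesis using ub inv1 cc f b by (simp del: tseries_simps)
  qed
  have "f \<otimes>\<^bsub>S\<^esub> (b \<otimes>\<^bsub>S\<^esub> c') = \<one>\<^bsub>S\<^esub>"
    using inv1 cc f b by (simp add: S.m_assoc[symmetric] fb del: tseries_simps)
  then show ?thesis using b cc by (intro bexI[of _ "b \<otimes>\<^bsub>S\<^esub> c'"]) auto
qed

lemma S_divring: "divring S"
proof
  show one_zero: "\<one>\<^bsub>S\<^esub> \<noteq> \<zero>\<^bsub>S\<^esub>"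
  proof
    assume "\<one>\<^bsub>S\<^esub> = \<zero>\<^bsub>S\<^esub>"
    from fun_cong[OF this, of 0] show False by simp
  qed
  fix x assume x: "x \<in> carrier S" "x \<noteq> \<zero>\<^bsub>S\<^esub>"
  obtain y where y: "y \<in> carrier S" "x \<otimes>\<^bsub>S\<^esub> y = \<one>\<^bsub>S\<^esub>" using right_inverse[OF x] by blast
  have y0: "y \<noteq> \<zero>\<^bsub>S\<^esub>"
  proof
    assume "y = \<zero>\<^bsub>S\<^esub>"
    then have "x \<otimes>\<^bsub>S\<^esub> y = \<zero>\<^bsub>S\<^esub>" using S.r_null[OF x(1)] by (simp del: tseries_simps)
    then show False using y one_zero by (simp del: tseries_simps)
  qed
  obtain z where z: "z \<in> carrier S" "y \<otimes>\<^bsub>S\<^esub> z = \<one>\<^bsub>S\<^esub>" using right_inverse[OF y(1) y0] by blast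
  \<comment> \<open>The right inverse \<open>y\<close> of \<open>x\<close> has a right inverse as
    well, which must be \<open>x\<close>; so \<open>y\<close> is a two-sided inverse.\<close>
  have "x = x \<otimes>\<^bsub>S\<^esub> (y \<otimes>\<^bsub>S\<^esub> z)" using x z by (simp del: tseries_simps)
  also have "\<dots> = (x \<otimes>\<^bsub>S\<^esub> y) \<otimes>\<^bsub>S\<^esub> z" by (rule S.m_assoc[OF x(1) y(1) z(1), symmetric])
  finally have "x = z" using y z by (simp del: tseries_simps)
  then show "x \<in> Units S" using x y z by (auto simp: Units_def simp del: tseries_simps)
qed

end

end

section \<open>Cyclic towers\<close>

lemma (in divring) commute_of_conjugate:
  assumes "u \<in> carrier R" "u \<noteq> \<zero>" "x \<in> carrier R" "u \<otimes> x \<otimes> inv u = x"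
  shows "u \<otimes> x = x \<otimes> u"
proof -
  have "u \<otimes> x = (u \<otimes> x \<otimes> inv u) \<otimes> u" using assms(1-3) by (simp add: m_assoc)
  then show ?thesis using assms(4) by simp
qed

locale cyclic_tower = divring h for h :: "('a,'m) ring_scheme" (structure) +
  fixes k kk :: "'a set" and hs :: "nat \<Rightarrow> 'a set" and \<sigma> :: "nat \<Rightarrow> 'a \<Rightarrow> 'a" and d :: "nat \<Rightarrow> nat"
  assumes k: "subdivring k h" and hs: "\<And>n. subdivring (hs n) h" and khs: "\<And>n. k \<subseteq> hs n"
    and hs_Suc: "\<And>n. hs n \<subseteq> hs (Suc n)" and hs_Un: "(\<Union>n. hs n) = carrier h"
    and outr: "\<And>n. outer (h\<lparr>carrier := hs n\<rparr>) k" and galo: "\<And>n. galois (h\<lparr>carrier := hs n\<rparr>) k"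
    and deg: "\<And>n. left_degree h k (hs n) (d n)"
    and \<sigma>Gal: "\<And>n. \<sigma> n \<in> carrier (Gal (h\<lparr>carrier := hs n\<rparr>) k)"
    and \<sigma>gen: "\<And>n. carrier (Gal (h\<lparr>carrier := hs n\<rparr>) k) = generate (Gal (h\<lparr>carrier := hs n\<rparr>) k) {\<sigma> n}"
    and \<sigma>_restr: "\<And>m n x. m \<le> n \<Longrightarrow> x \<in> hs m \<Longrightarrow> \<sigma> n x = \<sigma> m x"
    and kk: "subdivring kk h" and kkZ: "kk \<subseteq> ring_center (h\<lparr>carrier := k\<rparr>)"
begin

lemma hs_mono: "m \<le> n \<Longrightarrow> hs m \<subseteq> hs n" using lift_Suc_mono_le[of hs] hs_Suc by blast

lemma hsc [simp]: "x \<in> hs n \<Longrightarrow> x \<in> carrier h" using hs_Un by auto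

lemma hn_divring: "divring (h\<lparr>carrier := hs n\<rparr>)" by (rule subdivring_divring[OF hs])

lemma kkk: "x \<in> kk \<Longrightarrow> x \<in> k" using kkZ by (auto simp: ring_center_def)

lemma \<sigma>_facts:
  shows "x \<in> hs n \<Longrightarrow> \<sigma> n x \<in> hs n" "x \<in> k \<Longrightarrow> \<sigma> n x = x" "\<sigma> n \<one> = \<one>"
    "x \<in> hs n \<Longrightarrow> y \<in> hs n \<Longrightarrow> \<sigma> n (x \<otimes> y) = \<sigma> n x \<otimes> \<sigma> n y"
    "x \<in> hs n \<Longrightarrow> y \<in> hs n \<Longrightarrow> \<sigma> n (x \<oplus> y) = \<sigma> n x \<oplus> \<sigma> n y"
  using Gal_closed[OF \<sigma>Gal, of x n] Gal_fix[OF \<sigma>Gal, of x n] ring_hom_mult[OF Gal_hom[OF \<sigma>Gal[of n]], of x y]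
    ring_hom_add[OF Gal_hom[OF \<sigma>Gal[of n]], of x y] ring_hom_one[OF Gal_hom[OF \<sigma>Gal[of n]]] by auto

text \<open>An element fixed by a generator is fixed by the whole generated group, by induction on
  generation.\<close>

lemma \<sigma>_fixed: "{x \<in> hs n. \<sigma> n x = x} = k"
proof
  show "k \<subseteq> {x \<in> hs n. \<sigma> n x = x}" using khs \<sigma>_facts(2) by auto
  interpret D: divring "h\<lparr>carrier := hs n\<rparr>" by (rule hn_divring)
  let ?G = "Gal (h\<lparr>carrier := hs n\<rparr>) k"
  interpret G: group ?G by (rule Gal_group) (use D.ring_axioms khs in auto)
  show "{x \<in> hs n. \<sigma> n x = x} \<subseteq> k"
  proof
    fix x assume "x \<in> {x \<in> hs n. \<sigma> n x = x}"
    then have x: "x \<in> hs n" "\<sigma> n x = x" by auto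
    have "g x = x" if "g \<in> generate ?G {\<sigma> n}" for g
      using that
    proof (induction rule: generate.induct)
      case one then show ?case using x by simp
    next
      case (incl g) then show ?case using x by simp
    next
      case (inv g)
      then have g: "g = \<sigma> n" by simp
      have "(inv\<^bsub>?G\<^esub> g \<otimes>\<^bsub>?G\<^esub> g) x = \<one>\<^bsub>?G\<^esub> x" using G.l_inv[OF \<sigma>Gal[of n]] g by (simp del: Gal_simps)
      then show ?case using x g by (simp add: compose_def)
    next
      case (eng g1 g2) then show ?case using x by (simp add: compose_def)
    qed
    then show "x \<in> k" using galo[of n] x(1) \<sigma>gen[of n] unfolding galois_def by auto
  qed
qed

lemma order_facts:
  shows "0 < d n" "x \<in> hs n \<Longrightarrow> (\<sigma> n ^^ d n) x = x"
    and "(\<And>x. x \<in> hs n \<Longrightarrow> (\<sigma> n ^^ m) x = x) \<Longrightarrow> d n dvd m"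
proof -
  interpret D: divring "h\<lparr>carrier := hs n\<rparr>" by (rule hn_divring)
  obtain B where B: "finite B" "card B = d n" "B \<subseteq> hs n"
     "\<forall>a \<in> B \<rightarrow> k. (\<Oplus>b\<in>B. a b \<otimes> b) = \<zero> \<longrightarrow> (\<forall>b\<in>B. a b = \<zero>)"
     "\<forall>x\<in>hs n. \<exists>a \<in> B \<rightarrow> k. x = (\<Oplus>b\<in>B. a b \<otimes> b)"
    using deg[of n] unfolding left_degree_def by blast
  have fs: "(\<Oplus>\<^bsub>h\<lparr>carrier := hs n\<rparr>\<^esub>b\<in>B. a b \<otimes> b) = (\<Oplus>b\<in>B. a b \<otimes> b)" if "a \<in> B \<rightarrow> k" for a
    by (rule finsum_carrier_update[OF _ B(1)])
       (use subdivringE(1,6)[OF hs] B(3) khs[of n] that in \<open>auto simp: Pi_iff subset_eq\<close>)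
  have s: "\<sigma> n \<in> ring_iso (h\<lparr>carrier := hs n\<rparr>) (h\<lparr>carrier := hs n\<rparr>)" using \<sigma>Gal[of n] by (simp add: Gal_iff)
  note * = D.cyclic_outer_order[OF s _ outr B(1), unfolded B(2)]
  have 1: "{x \<in> carrier (h\<lparr>carrier := hs n\<rparr>). \<sigma> n x = x} = k" using \<sigma>_fixed by simp
  have 2: "B \<subseteq> carrier (h\<lparr>carrier := hs n\<rparr>)" using B(3) by simp
  have 3: "\<forall>b\<in>B. a b = \<zero>\<^bsub>h\<lparr>carrier := hs n\<rparr>\<^esub>"
    if "a \<in> B \<rightarrow> k" "(\<Oplus>\<^bsub>h\<lparr>carrier := hs n\<rparr>\<^esub>b\<in>B. a b \<otimes>\<^bsub>h\<lparr>carrier := hs n\<rparr>\<^esub> b) = \<zero>\<^bsub>h\<lparr>carrier := hs n\<rparr>\<^esub>" for a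
    using B(4) fs[OF that(1)] that by simp
  have 4: "\<exists>a\<in>B \<rightarrow> k. x = (\<Oplus>\<^bsub>h\<lparr>carrier := hs n\<rparr>\<^esub>b\<in>B. a b \<otimes>\<^bsub>h\<lparr>carrier := hs n\<rparr>\<^esub> b)"
    if x: "x \<in> carrier (h\<lparr>carrier := hs n\<rparr>)" for x
  proof -
    obtain a where "a \<in> B \<rightarrow> k" "x = (\<Oplus>b\<in>B. a b \<otimes> b)" using bspec[OF B(5), of x] x by auto
    then show ?thesis using fs by (intro bexI[of _ a]) auto
  qed
  show "0 < d n" by (rule *(1)[OF 1 2 3 4])
  show "(\<sigma> n ^^ d n) x = x" if "x \<in> hs n" by (rule *(2)[OF 1 2 3 4]) (use that in simp_all)
  show "d n dvd m" if "\<And>x. x \<in> hs n \<Longrightarrow> (\<sigma> n ^^ m) x = x" by (rule *(3)[OF 1 2 3 4]) (use that in simp_all)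
qed

lemma \<sigma>_pow_facts:
  shows "x \<in> hs n \<Longrightarrow> (\<sigma> n ^^ j) x \<in> hs n" "x \<in> k \<Longrightarrow> (\<sigma> n ^^ j) x = x" "(\<sigma> n ^^ j) \<one> = \<one>"
    "x \<in> hs n \<Longrightarrow> y \<in> hs n \<Longrightarrow> (\<sigma> n ^^ j) (x \<otimes> y) = (\<sigma> n ^^ j) x \<otimes> (\<sigma> n ^^ j) y"
    "x \<in> hs n \<Longrightarrow> y \<in> hs n \<Longrightarrow> (\<sigma> n ^^ j) (x \<oplus> y) = (\<sigma> n ^^ j) x \<oplus> (\<sigma> n ^^ j) y"
proof -
  show 1: "(\<sigma> n ^^ j) x \<in> hs n" if "x \<in> hs n" for x j using that by (induction j) (auto simp: \<sigma>_facts)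
  show "x \<in> k \<Longrightarrow> (\<sigma> n ^^ j) x = x" "(\<sigma> n ^^ j) \<one> = \<one>" by (induction j) (auto simp: \<sigma>_facts)
  show "x \<in> hs n \<Longrightarrow> y \<in> hs n \<Longrightarrow> (\<sigma> n ^^ j) (x \<otimes> y) = (\<sigma> n ^^ j) x \<otimes> (\<sigma> n ^^ j) y"
    "x \<in> hs n \<Longrightarrow> y \<in> hs n \<Longrightarrow> (\<sigma> n ^^ j) (x \<oplus> y) = (\<sigma> n ^^ j) x \<oplus> (\<sigma> n ^^ j) y"
    by (induction j) (auto simp: \<sigma>_facts 1)
qed

lemma \<sigma>_pow_restr: "m \<le> n \<Longrightarrow> x \<in> hs m \<Longrightarrow> (\<sigma> n ^^ j) x = (\<sigma> m ^^ j) x"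
  by (induction j) (auto simp: \<sigma>_restr \<sigma>_pow_facts)

text \<open>The power of \<open>\<sigma> (Suc n)\<close> with exponent \<open>d (Suc n)\<close> is
  trivial on the smaller field, where it is that power of \<open>\<sigma> n\<close>, whose order is
  \<open>d n\<close>.\<close>

lemma d_dvd: "d n dvd d (Suc n)"
proof (rule order_facts(3))
  fix x assume x: "x \<in> hs n"
  then have "(\<sigma> n ^^ d (Suc n)) x = (\<sigma> (Suc n) ^^ d (Suc n)) x" using \<sigma>_pow_restr[of n "Suc n" x] by simp
  then show "(\<sigma> n ^^ d (Suc n)) x = x" using order_facts(2)[of x "Suc n"] x hs_Suc by auto
qed

text \<open>Only commutation with \<open>k\<close> is assumed. Conjugation by \<open>x\<close> is an
  inner automorphism fixing \<open>k\<close>, so outerness of each \<open>hs n\<close> makes it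
  trivial there, and these fields exhaust \<open>h\<close>.\<close>

lemma kk_central: assumes x: "x \<in> kk" and y: "y \<in> carrier h" shows "x \<otimes> y = y \<otimes> x"
proof (cases "x = \<zero>")
  case True then show ?thesis using y by simp
next
  case False
  obtain n where n: "y \<in> hs n" using y hs_Un by auto
  interpret D: divring "h\<lparr>carrier := hs n\<rparr>" by (rule hn_divring)
  have xn: "x \<in> hs n" "x \<in> carrier h" using kkk[OF x] khs[of n] by auto
  have i: "inv\<^bsub>h\<lparr>carrier := hs n\<rparr>\<^esub> x = inv x" by (rule subdivring_inv_eq[OF hs xn(1) False])
  have U: "x \<in> Units (h\<lparr>carrier := hs n\<rparr>)" using D.nz_Units[of x] xn False by simp
  have "x \<otimes> z \<otimes> inv x = z" if z: "z \<in> k" for z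
  proof -
    have zc: "z \<in> carrier h" using z khs[of n] by auto
    have "x \<otimes> z = z \<otimes> x" using kkZ x z by (auto simp: ring_center_def)
    then show ?thesis using xn False zc by (simp add: m_assoc)
  qed
  then have "x \<otimes> y \<otimes> inv x = y" using outr[of n] U n i unfolding outer_def by auto
  then show ?thesis using commute_of_conjugate[OF xn(2) False y] by simp
qed

text \<open>Iteration takes natural exponents; reducing an integer modulo the order gives the
  negative powers without an inverse map.\<close>

definition ipow :: "nat \<Rightarrow> int \<Rightarrow> 'a \<Rightarrow> 'a" where
  "ipow m i x = (\<sigma> m ^^ nat (i mod int (d m))) x"

lemma \<sigma>_pow_mod: "x \<in> hs m \<Longrightarrow> (\<sigma> m ^^ (j mod d m)) x = (\<sigma> m ^^ j) x"
proof -
  assume x: "x \<in> hs m"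
  have "(\<sigma> m ^^ j) x = (\<sigma> m ^^ (j mod d m)) ((\<sigma> m ^^ (j div d m * d m)) x)"
    by (metis comp_apply funpow_add mod_div_mult_eq)
  also have "(\<sigma> m ^^ (j div d m * d m)) x = x"
    using funpow_dvd_id[of "hs m" "d m" "\<sigma> m"] order_facts(2) x by auto
  finally show ?thesis by simp
qed

lemma ipow_nat: "x \<in> hs m \<Longrightarrow> ipow m (int j) x = (\<sigma> m ^^ j) x"
  using \<sigma>_pow_mod by (simp add: ipow_def nat_mod_distrib)

lemma ipow_dvd: "int (d m) dvd i \<Longrightarrow> ipow m i x = x"
  by (simp add: ipow_def)

lemma ipow_add: "x \<in> hs m \<Longrightarrow> ipow m (i + j) x = ipow m i (ipow m j x)"
proof -
  assume x: "x \<in> hs m"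
  define a b where "a = nat (i mod int (d m))" and "b = nat (j mod int (d m))"
  have ab: "int a = i mod int (d m)" "int b = j mod int (d m)" using order_facts(1)[of m] by (auto simp: a_def b_def)
  have "(i + j) mod int (d m) = int ((a + b) mod d m)"
    by (simp add: zmod_int ab mod_add_eq)
  then have "ipow m (i + j) x = (\<sigma> m ^^ ((a + b) mod d m)) x" by (simp add: ipow_def)
  also have "\<dots> = (\<sigma> m ^^ (a + b)) x" by (rule \<sigma>_pow_mod[OF x])
  finally show ?thesis by (simp add: ipow_def funpow_add a_def b_def)
qed

end

section \<open>The action of rational powers of the common variable\<close>

locale tower_limit = cyclic_tower +
  fixes l :: "nat \<Rightarrow> nat"
  assumes l: "\<And>n. 0 < l n" "\<And>n. l n dvd l (Suc n)" "\<And>n. d n dvd (l (Suc n) div l n - 1)" "\<And>n. d n dvd l n"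
begin

abbreviation "r n \<equiv> l (Suc n) div l n"

lemma l_Suc: "l (Suc n) = l n * r n" using l(2) by simp

lemma r_pos: "0 < r n" using l(1)[of "Suc n"] l_Suc[of n] by (metis mult_0_right neq0_conv)

text \<open>On \<open>hs m\<close> the generator of the next level acts as
  \<open>\<sigma> m\<close>, whose order divides \<open>r m - 1\<close>; the factor
  \<open>r m\<close> in the exponent is therefore invisible there.\<close>

lemma ipow_lift: assumes x: "x \<in> hs m" shows "ipow (Suc m) (i * int (r m)) x = ipow m i x"
proof -
  define a where "a = nat ((i * int (r m)) mod int (d (Suc m)))"
  have a: "int a = (i * int (r m)) mod int (d (Suc m))" using order_facts(1)[of "Suc m"] by (auto simp: a_def)
  have "int (a mod d m) = (i * int (r m)) mod int (d m)"
    using d_dvd[of m] by (simp add: zmod_int a mod_mod_cancel)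
  also have "\<dots> = i mod int (d m)"
  proof -
    have "int (d m) dvd int (r m) - 1" using l(3)[of m] r_pos[of m]
      by (metis int_dvd_int_iff of_nat_1 of_nat_diff Suc_leI One_nat_def)
    then have "int (d m) dvd i * int (r m) - i" by (metis dvd_mult mult.right_neutral right_diff_distrib)
    then show ?thesis by (simp add: mod_eq_dvd_iff)
  qed
  finally have am: "a mod d m = nat (i mod int (d m))" by (metis nat_int)
  have "ipow (Suc m) (i * int (r m)) x = (\<sigma> (Suc m) ^^ a) x" by (simp add: ipow_def a_def)
  also have "\<dots> = (\<sigma> m ^^ a) x" using \<sigma>_pow_restr[of m "Suc m" x] x by simp
  also have "\<dots> = (\<sigma> m ^^ (a mod d m)) x" using \<sigma>_pow_mod[OF x] by simp
  finally show ?thesis by (simp add: am ipow_def)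
qed

definition lr :: "nat \<Rightarrow> rat" where "lr n = of_nat (l n)"

lemma lr_pos [simp]: "0 < lr n" "lr n \<noteq> 0" using l(1)[of n] by (auto simp: lr_def)

lemma lr_Suc: "lr (Suc n) = lr n * of_nat (r n)"
  by (metis l_Suc lr_def of_nat_mult)

definition "idx s x m \<longleftrightarrow> x \<in> hs m \<and> s * lr m \<in> \<int>"

text \<open>If \<open>s\<close> times \<open>l m\<close> is an integer, \<open>T^s\<close> is that
  power of the variable of level \<open>m\<close>, and conjugation by it is the same power of
  \<open>\<sigma> m\<close> on \<open>hs m\<close>. The least admissible level is an arbitrary
  choice; where there is none, the identity is the default.\<close>

definition \<tau> :: "rat \<Rightarrow> 'a \<Rightarrow> 'a" where
  "\<tau> s x = (if \<exists>m. idx s x m then ipow (LEAST m. idx s x m) \<lfloor>s * lr (LEAST m. idx s x m)\<rfloor> x else x)"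

definition "\<Gamma> = {s. \<exists>m. s * lr m \<in> \<int>}"

lemma Ints_Suc: "s * lr m \<in> \<int> \<Longrightarrow> s * lr (Suc m) \<in> \<int>"
  using Ints_mult[of "s * lr m" "of_nat (r m)"] by (simp add: lr_Suc mult.assoc)

lemma Ints_mono: "m \<le> n \<Longrightarrow> s * lr m \<in> \<int> \<Longrightarrow> s * lr n \<in> \<int>"
  by (induction n rule: dec_induct) (auto intro: Ints_Suc)

lemma floor_Suc: "s * lr m \<in> \<int> \<Longrightarrow> \<lfloor>s * lr (Suc m)\<rfloor> = \<lfloor>s * lr m\<rfloor> * int (r m)"
proof -
  assume "s * lr m \<in> \<int>"
  then obtain i where i: "s * lr m = of_int i" by (auto elim: Ints_cases)
  then have "s * lr (Suc m) = of_int (i * int (r m))" by (simp add: lr_Suc mult.assoc[symmetric])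
  then show ?thesis using i by (simp only: floor_of_int)
qed

text \<open>Every admissible level gives the same value: going up one level multiplies the exponent
  by \<open>r m\<close>, which \<open>ipow_lift\<close> absorbs.\<close>

lemma \<tau>_eq: assumes "idx s x m" shows "\<tau> s x = ipow m \<lfloor>s * lr m\<rfloor> x"
proof -
  define m0 where "m0 = (LEAST m. idx s x m)"
  have 0: "idx s x m0" unfolding m0_def by (rule LeastI[of _ m]) (rule assms)
  have le: "m0 \<le> m" unfolding m0_def by (rule Least_le) (rule assms)
  have "idx s x m \<and> ipow m \<lfloor>s * lr m\<rfloor> x = ipow m0 \<lfloor>s * lr m0\<rfloor> x" using le
  proof (induction m rule: dec_induct)
    case base show ?case using 0 by simp
  next
    case (step m)
    then have "idx s x (Suc m)" using hs_Suc Ints_Suc by (auto simp: idx_def)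
    moreover have "ipow (Suc m) \<lfloor>s * lr (Suc m)\<rfloor> x = ipow m \<lfloor>s * lr m\<rfloor> x"
      using step.IH ipow_lift floor_Suc by (auto simp: idx_def)
    ultimately show ?case using step by simp
  qed
  then show ?thesis using assms by (auto simp: \<tau>_def m0_def)
qed

lemma common_level:
  assumes "s \<in> \<Gamma>" "t \<in> \<Gamma>" "x \<in> carrier h" "y \<in> carrier h"
  obtains m where "s * lr m \<in> \<int>" "t * lr m \<in> \<int>" "x \<in> hs m" "y \<in> hs m"
proof -
  obtain a b c e where "s * lr a \<in> \<int>" "t * lr b \<in> \<int>" "x \<in> hs c" "y \<in> hs e"
    using assms unfolding \<Gamma>_def hs_Un[symmetric] by blast
  moreover define N where "N = max (max a b) (max c e)"
  then have "a \<le> N" "b \<le> N" "c \<le> N" "e \<le> N" by auto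
  ultimately have "s * lr N \<in> \<int>" "t * lr N \<in> \<int>" "x \<in> hs N" "y \<in> hs N"
    using Ints_mono hs_mono by blast+
  then show thesis by (rule that)
qed

lemma \<tau>_outside: "s \<notin> \<Gamma> \<Longrightarrow> \<tau> s x = x"
  by (auto simp: \<tau>_def \<Gamma>_def idx_def)

lemma \<tau>_props:
  shows "x \<in> carrier h \<Longrightarrow> \<tau> s x \<in> carrier h"
    and "x \<in> carrier h \<Longrightarrow> y \<in> carrier h \<Longrightarrow> \<tau> s (x \<oplus> y) = \<tau> s x \<oplus> \<tau> s y"
    and "x \<in> carrier h \<Longrightarrow> y \<in> carrier h \<Longrightarrow> \<tau> s (x \<otimes> y) = \<tau> s x \<otimes> \<tau> s y"
    and "\<tau> s \<one> = \<one>"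
    and "s \<in> \<int> \<Longrightarrow> x \<in> carrier h \<Longrightarrow> \<tau> s x = x"
    and "s \<in> \<Gamma> \<Longrightarrow> t \<in> \<Gamma> \<Longrightarrow> x \<in> carrier h \<Longrightarrow> \<tau> (s + t) x = \<tau> s (\<tau> t x)"
    and "x \<in> kk \<Longrightarrow> \<tau> s x = x"
proof -
  show "\<tau> s x \<in> carrier h" if x: "x \<in> carrier h"
  proof (cases "s \<in> \<Gamma>")
    case True
    obtain m where "s * lr m \<in> \<int>" "x \<in> hs m" using common_level[OF True True x x] by blast
    then show ?thesis using \<tau>_eq[of s x m] hsc[OF \<sigma>_pow_facts(1)[of x m]] by (auto simp: idx_def ipow_def)
  qed (use x \<tau>_outside in auto)
  show "\<tau> s (x \<oplus> y) = \<tau> s x \<oplus> \<tau> s y" if x: "x \<in> carrier h" "y \<in> carrier h"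
  proof (cases "s \<in> \<Gamma>")
    case True
    obtain m where "s * lr m \<in> \<int>" "x \<in> hs m" "y \<in> hs m" using common_level[OF True True x] by blast
    then show ?thesis using \<tau>_eq[of s _ m] \<sigma>_pow_facts(5)[of x m y] subdivringE(7)[OF hs[of m]] by (simp add: idx_def ipow_def)
  qed (use \<tau>_outside in auto)
  show "\<tau> s (x \<otimes> y) = \<tau> s x \<otimes> \<tau> s y" if x: "x \<in> carrier h" "y \<in> carrier h"
  proof (cases "s \<in> \<Gamma>")
    case True
    obtain m where "s * lr m \<in> \<int>" "x \<in> hs m" "y \<in> hs m" using common_level[OF True True x] by blast
    then show ?thesis using \<tau>_eq[of s _ m] \<sigma>_pow_facts(4)[of x m y] subdivringE(6)[OF hs[of m]] by (simp add: idx_def ipow_def)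
  qed (use \<tau>_outside in auto)
  show fixk: "\<tau> s x = x" if "x \<in> kk" for x
    unfolding \<tau>_def ipow_def using \<sigma>_pow_facts(2)[OF kkk[OF that]] by simp
  show "\<tau> s \<one> = \<one>" by (rule fixk) (rule subdivringE(4)[OF kk])
  show "\<tau> s x = x" if s: "s \<in> \<int>" and x: "x \<in> carrier h"
  proof -
    have G: "s \<in> \<Gamma>" using s Ints_mult[OF s, of "lr 0"] by (auto simp: \<Gamma>_def lr_def)
    obtain m where m: "s * lr m \<in> \<int>" "x \<in> hs m" using common_level[OF G G x x] by blast
    obtain i where "s = of_int i" using s by (auto elim: Ints_cases)
    then have "s * lr m = of_int (i * int (l m))" by (simp add: lr_def)
    then have "\<lfloor>s * lr m\<rfloor> = i * int (l m)" by (simp only: floor_of_int)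
    \<comment> \<open>For integral \<open>s\<close> the exponent is a multiple of
      \<open>l m\<close>, hence of the order \<open>d m\<close>: this is why \<open>T\<close>
      commutes with the coefficients.\<close>
    then have "int (d m) dvd \<lfloor>s * lr m\<rfloor>" using l(4)[of m] by simp
    then show ?thesis using \<tau>_eq[of s x m] m ipow_dvd by (simp add: idx_def)
  qed
  show "\<tau> (s + t) x = \<tau> s (\<tau> t x)" if s: "s \<in> \<Gamma>" "t \<in> \<Gamma>" and x: "x \<in> carrier h"
  proof -
    obtain m where m: "s * lr m \<in> \<int>" "t * lr m \<in> \<int>" "x \<in> hs m" using common_level[OF s x x] by blast
    have t: "\<tau> t x = ipow m \<lfloor>t * lr m\<rfloor> x" using \<tau>_eq[of t x m] m by (simp add: idx_def)
    then have "\<tau> t x \<in> hs m" using \<sigma>_pow_facts(1)[OF m(3)] by (simp add: ipow_def)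
    then have "\<tau> s (\<tau> t x) = ipow m \<lfloor>s * lr m\<rfloor> (\<tau> t x)" using \<tau>_eq[of s _ m] m by (simp add: idx_def)
    moreover have "(s + t) * lr m \<in> \<int>" using m by (simp add: distrib_right)
    then have "\<tau> (s + t) x = ipow m \<lfloor>(s + t) * lr m\<rfloor> x" using \<tau>_eq[of "s + t" x m] m by (simp add: idx_def)
    moreover have "\<lfloor>(s + t) * lr m\<rfloor> = \<lfloor>s * lr m\<rfloor> + \<lfloor>t * lr m\<rfloor>" using m(1,2) by (auto elim!: Ints_cases simp: distrib_right)
    ultimately show ?thesis using ipow_add[OF m(3)] t by simp
  qed
qed

sublocale twisted_series h "carrier h" \<Gamma> \<tau>
proof unfold_locales
  show "subdivring (carrier h) h" using carrier_is_subring by (intro subdivringI) auto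
  show "0 \<in> \<Gamma>" by (simp add: \<Gamma>_def)
  show "s + t \<in> \<Gamma>" if st: "s \<in> \<Gamma>" "t \<in> \<Gamma>" for s t
  proof -
    obtain m where "s * lr m \<in> \<int>" "t * lr m \<in> \<int>" using common_level[OF st one_closed one_closed] by blast
    then show ?thesis unfolding \<Gamma>_def by (auto intro!: exI[of _ m] simp: distrib_right)
  qed
  show "- s \<in> \<Gamma>" if "s \<in> \<Gamma>" for s using that by (auto simp: \<Gamma>_def)
qed (use \<tau>_props in auto)

end

section \<open>Fields of fractions\<close>

text \<open>\<open>P\<close> is the graph of an isomorphism between a subring of \<open>H\<close>
  and a subring of \<open>E\<close>, with \<open>P_ore\<close> the left Ore condition and
  \<open>P_gen\<close> saying that \<open>H\<close> is generated by the first subring. A relation is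
  used because the skew polynomials of all levels are joined in it.\<close>

locale fraction_pair = H: divring H + E: divring E for H (structure) and E (structure) +
  fixes P :: "('a \<times> 'c) set"
  assumes P_sub: "\<And>x y. (x,y) \<in> P \<Longrightarrow> x \<in> carrier H \<and> y \<in> carrier E"
    and P_one: "(\<one>\<^bsub>H\<^esub>, \<one>\<^bsub>E\<^esub>) \<in> P"
    and P_add: "\<And>x y x' y'. (x,y) \<in> P \<Longrightarrow> (x',y') \<in> P \<Longrightarrow> (x \<oplus>\<^bsub>H\<^esub> x', y \<oplus>\<^bsub>E\<^esub> y') \<in> P"
    and P_neg: "\<And>x y. (x,y) \<in> P \<Longrightarrow> (\<ominus>\<^bsub>H\<^esub> x, \<ominus>\<^bsub>E\<^esub> y) \<in> P"
    and P_mult: "\<And>x y x' y'. (x,y) \<in> P \<Longrightarrow> (x',y') \<in> P \<Longrightarrow> (x \<otimes>\<^bsub>H\<^esub> x', y \<otimes>\<^bsub>E\<^esub> y') \<in> P"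
    and P_zero: "\<And>x y. (x,y) \<in> P \<Longrightarrow> x = \<zero>\<^bsub>H\<^esub> \<longleftrightarrow> y = \<zero>\<^bsub>E\<^esub>"
    and P_ore: "\<And>p p' q q'. (p,p') \<in> P \<Longrightarrow> (q,q') \<in> P \<Longrightarrow> q \<noteq> \<zero>\<^bsub>H\<^esub> \<Longrightarrow>
        \<exists>a a' b b'. (a,a') \<in> P \<and> (b,b') \<in> P \<and> a \<noteq> \<zero>\<^bsub>H\<^esub> \<and> a \<otimes>\<^bsub>H\<^esub> p = b \<otimes>\<^bsub>H\<^esub> q"
    and P_gen: "\<And>D. subdivring D H \<Longrightarrow> fst ` P \<subseteq> D \<Longrightarrow> carrier H \<subseteq> D"
begin

lemma P_eq: assumes "(a,a') \<in> P" "(b,b') \<in> P" shows "a = b \<longleftrightarrow> a' = b'"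
proof -
  have "(a \<ominus>\<^bsub>H\<^esub> b, a' \<ominus>\<^bsub>E\<^esub> b') \<in> P" using P_add[OF assms(1) P_neg[OF assms(2)]] by (simp add: a_minus_def)
  then show ?thesis using P_zero P_sub[OF assms(1)] P_sub[OF assms(2)] by (metis H.r_right_minus_eq E.r_right_minus_eq)
qed

text \<open>The graph of the embedding of \<open>H\<close> into \<open>E\<close>. Its definition is symmetric in the two
  components, so single-valuedness and injectivity are the same statement \<open>Gr_eq\<close>.\<close>

definition "Gr x y \<longleftrightarrow> x \<in> carrier H \<and> y \<in> carrier E \<and>
  (\<exists>q q' p p'. (q,q') \<in> P \<and> (p,p') \<in> P \<and> q \<noteq> \<zero>\<^bsub>H\<^esub> \<and> q \<otimes>\<^bsub>H\<^esub> x = p \<and> q' \<otimes>\<^bsub>E\<^esub> y = p')"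

text \<open>The Ore condition is stated in \<open>H\<close> alone; as \<open>P\<close> matches
  equalities on the two sides, the same multipliers solve the equation in \<open>E\<close>.\<close>

lemma ore_pair:
  assumes "(p,p') \<in> P" "(q,q') \<in> P" "q \<noteq> \<zero>\<^bsub>H\<^esub>"
  obtains a a' b b' where "(a,a') \<in> P" "(b,b') \<in> P" "a \<noteq> \<zero>\<^bsub>H\<^esub>" "a \<otimes>\<^bsub>H\<^esub> p = b \<otimes>\<^bsub>H\<^esub> q" "a' \<otimes>\<^bsub>E\<^esub> p' = b' \<otimes>\<^bsub>E\<^esub> q'"
proof -
  obtain a a' b b' where *: "(a,a') \<in> P" "(b,b') \<in> P" "a \<noteq> \<zero>\<^bsub>H\<^esub>" "a \<otimes>\<^bsub>H\<^esub> p = b \<otimes>\<^bsub>H\<^esub> q"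
    using P_ore[OF assms] by blast
  then show thesis using that P_eq[OF P_mult[OF *(1) assms(1)] P_mult[OF *(2) assms(2)]] by blast
qed

text \<open>The Ore condition applied to the two denominators gives a common left multiple, which
  serves both fractions on both sides.\<close>

lemma Gr_common:
  assumes "Gr x y" "Gr x2 y2"
  obtains m m' u u' v v' where "(m,m') \<in> P" "(u,u') \<in> P" "(v,v') \<in> P" "m \<noteq> \<zero>\<^bsub>H\<^esub>" "m' \<noteq> \<zero>\<^bsub>E\<^esub>"
    "m \<otimes>\<^bsub>H\<^esub> x = u" "m' \<otimes>\<^bsub>E\<^esub> y = u'" "m \<otimes>\<^bsub>H\<^esub> x2 = v" "m' \<otimes>\<^bsub>E\<^esub> y2 = v'"
proof -
  obtain q q' p p' where q: "(q,q') \<in> P" "(p,p') \<in> P" "q \<noteq> \<zero>\<^bsub>H\<^esub>" "q \<otimes>\<^bsub>H\<^esub> x = p" "q' \<otimes>\<^bsub>E\<^esub> y = p'"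
    using assms(1) unfolding Gr_def by blast
  obtain s s' t t' where s: "(s,s') \<in> P" "(t,t') \<in> P" "s \<noteq> \<zero>\<^bsub>H\<^esub>" "s \<otimes>\<^bsub>H\<^esub> x2 = t" "s' \<otimes>\<^bsub>E\<^esub> y2 = t'"
    using assms(2) unfolding Gr_def by blast
  obtain a a' b b' where ab: "(a,a') \<in> P" "(b,b') \<in> P" "a \<noteq> \<zero>\<^bsub>H\<^esub>" "a \<otimes>\<^bsub>H\<^esub> q = b \<otimes>\<^bsub>H\<^esub> s" "a' \<otimes>\<^bsub>E\<^esub> q' = b' \<otimes>\<^bsub>E\<^esub> s'"
    using ore_pair[OF q(1) s(1,3)] by blast
  note c = P_sub[OF q(1)] P_sub[OF s(1)] P_sub[OF ab(1)] P_sub[OF ab(2)] assms[unfolded Gr_def]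
  have m: "(a \<otimes>\<^bsub>H\<^esub> q, a' \<otimes>\<^bsub>E\<^esub> q') \<in> P" by (rule P_mult[OF ab(1) q(1)])
  have nz: "a \<otimes>\<^bsub>H\<^esub> q \<noteq> \<zero>\<^bsub>H\<^esub>" using c ab(3) q(3) by simp
  show thesis
  proof (rule that[OF m P_mult[OF ab(1) q(2)] P_mult[OF ab(2) s(2)] nz])
    show "a' \<otimes>\<^bsub>E\<^esub> q' \<noteq> \<zero>\<^bsub>E\<^esub>" using P_zero[OF m] nz by simp
    show "a \<otimes>\<^bsub>H\<^esub> q \<otimes>\<^bsub>H\<^esub> x = a \<otimes>\<^bsub>H\<^esub> p" "a' \<otimes>\<^bsub>E\<^esub> q' \<otimes>\<^bsub>E\<^esub> y = a' \<otimes>\<^bsub>E\<^esub> p'"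
      using c q by (auto simp: H.m_assoc E.m_assoc)
    show "a \<otimes>\<^bsub>H\<^esub> q \<otimes>\<^bsub>H\<^esub> x2 = b \<otimes>\<^bsub>H\<^esub> t" "a' \<otimes>\<^bsub>E\<^esub> q' \<otimes>\<^bsub>E\<^esub> y2 = b' \<otimes>\<^bsub>E\<^esub> t'"
      unfolding ab(4,5) using c s by (auto simp: H.m_assoc E.m_assoc)
  qed
qed

lemma Gr_eq: assumes "Gr x y" "Gr x2 y2" shows "x = x2 \<longleftrightarrow> y = y2"
proof -
  obtain m m' u u' v v' where m: "(m,m') \<in> P" "(u,u') \<in> P" "(v,v') \<in> P" "m \<noteq> \<zero>\<^bsub>H\<^esub>" "m' \<noteq> \<zero>\<^bsub>E\<^esub>"
    "m \<otimes>\<^bsub>H\<^esub> x = u" "m' \<otimes>\<^bsub>E\<^esub> y = u'" "m \<otimes>\<^bsub>H\<^esub> x2 = v" "m' \<otimes>\<^bsub>E\<^esub> y2 = v'" using Gr_common[OF assms] by blast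
  have "x = x2 \<longleftrightarrow> u = v"
    using m P_sub[OF m(1)] assms H.m_lcancel_nz[of x x2 m] by (auto simp: Gr_def)
  moreover have "y = y2 \<longleftrightarrow> u' = v'"
    using m P_sub[OF m(1)] assms E.m_lcancel_nz[of y y2 m'] by (auto simp: Gr_def)
  ultimately show ?thesis using P_eq[OF m(2,3)] by simp
qed

lemma Gr_add: assumes "Gr x y" "Gr x2 y2" shows "Gr (x \<oplus>\<^bsub>H\<^esub> x2) (y \<oplus>\<^bsub>E\<^esub> y2)"
proof -
  obtain m m' u u' v v' where m: "(m,m') \<in> P" "(u,u') \<in> P" "(v,v') \<in> P" "m \<noteq> \<zero>\<^bsub>H\<^esub>" "m' \<noteq> \<zero>\<^bsub>E\<^esub>"
    "m \<otimes>\<^bsub>H\<^esub> x = u" "m' \<otimes>\<^bsub>E\<^esub> y = u'" "m \<otimes>\<^bsub>H\<^esub> x2 = v" "m' \<otimes>\<^bsub>E\<^esub> y2 = v'" using Gr_common[OF assms] by blast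
  have "m \<otimes>\<^bsub>H\<^esub> (x \<oplus>\<^bsub>H\<^esub> x2) = u \<oplus>\<^bsub>H\<^esub> v" "m' \<otimes>\<^bsub>E\<^esub> (y \<oplus>\<^bsub>E\<^esub> y2) = u' \<oplus>\<^bsub>E\<^esub> v'"
    using m P_sub[OF m(1)] assms by (auto simp: H.r_distr E.r_distr Gr_def)
  then show ?thesis using P_add[OF m(2,3)] m assms unfolding Gr_def by blast
qed

text \<open>For left fractions with \<open>q x = p\<close> and \<open>s x2 = t\<close>, choose
  \<open>a p = b s\<close>; then \<open>a q\<close> is a denominator of the product and
  \<open>b t\<close> its numerator.\<close>

lemma Gr_mult: assumes "Gr x y" "Gr x2 y2" shows "Gr (x \<otimes>\<^bsub>H\<^esub> x2) (y \<otimes>\<^bsub>E\<^esub> y2)"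
proof -
  obtain q q' p p' where q: "(q,q') \<in> P" "(p,p') \<in> P" "q \<noteq> \<zero>\<^bsub>H\<^esub>" "q \<otimes>\<^bsub>H\<^esub> x = p" "q' \<otimes>\<^bsub>E\<^esub> y = p'"
    using assms(1) unfolding Gr_def by blast
  obtain s s' t t' where s: "(s,s') \<in> P" "(t,t') \<in> P" "s \<noteq> \<zero>\<^bsub>H\<^esub>" "s \<otimes>\<^bsub>H\<^esub> x2 = t" "s' \<otimes>\<^bsub>E\<^esub> y2 = t'"
    using assms(2) unfolding Gr_def by blast
  obtain a a' b b' where ab: "(a,a') \<in> P" "(b,b') \<in> P" "a \<noteq> \<zero>\<^bsub>H\<^esub>" "a \<otimes>\<^bsub>H\<^esub> p = b \<otimes>\<^bsub>H\<^esub> s" "a' \<otimes>\<^bsub>E\<^esub> p' = b' \<otimes>\<^bsub>E\<^esub> s'"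
    using ore_pair[OF q(2) s(1,3)] by blast
  note c = P_sub[OF q(1)] P_sub[OF q(2)] P_sub[OF s(1)] P_sub[OF ab(1)] P_sub[OF ab(2)] assms[unfolded Gr_def]
  have "(a \<otimes>\<^bsub>H\<^esub> q) \<otimes>\<^bsub>H\<^esub> (x \<otimes>\<^bsub>H\<^esub> x2) = (a \<otimes>\<^bsub>H\<^esub> (q \<otimes>\<^bsub>H\<^esub> x)) \<otimes>\<^bsub>H\<^esub> x2" using c by (simp add: H.m_assoc)
  also have "\<dots> = b \<otimes>\<^bsub>H\<^esub> t" unfolding q(4) ab(4) using c s by (simp add: H.m_assoc)
  finally have 1: "(a \<otimes>\<^bsub>H\<^esub> q) \<otimes>\<^bsub>H\<^esub> (x \<otimes>\<^bsub>H\<^esub> x2) = b \<otimes>\<^bsub>H\<^esub> t" .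
  have "(a' \<otimes>\<^bsub>E\<^esub> q') \<otimes>\<^bsub>E\<^esub> (y \<otimes>\<^bsub>E\<^esub> y2) = (a' \<otimes>\<^bsub>E\<^esub> (q' \<otimes>\<^bsub>E\<^esub> y)) \<otimes>\<^bsub>E\<^esub> y2" using c by (simp add: E.m_assoc)
  also have "\<dots> = b' \<otimes>\<^bsub>E\<^esub> t'" unfolding q(5) ab(5) using c s by (simp add: E.m_assoc)
  finally have 2: "(a' \<otimes>\<^bsub>E\<^esub> q') \<otimes>\<^bsub>E\<^esub> (y \<otimes>\<^bsub>E\<^esub> y2) = b' \<otimes>\<^bsub>E\<^esub> t'" .
  have nz: "a \<otimes>\<^bsub>H\<^esub> q \<noteq> \<zero>\<^bsub>H\<^esub>" using c ab(3) q(3) by simp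
  have "x \<otimes>\<^bsub>H\<^esub> x2 \<in> carrier H" "y \<otimes>\<^bsub>E\<^esub> y2 \<in> carrier E" using c by auto
  then show ?thesis using P_mult[OF ab(1) q(1)] P_mult[OF ab(2) s(2)] 1 2 nz unfolding Gr_def by blast
qed

lemma Gr_P: assumes "(x,y) \<in> P" shows "Gr x y"
  unfolding Gr_def using P_one assms P_sub[OF assms] H.one_not_zero H.l_one E.l_one by blast

lemma Gr_inv: assumes "Gr x y" "x \<noteq> \<zero>\<^bsub>H\<^esub>" shows "Gr (inv\<^bsub>H\<^esub> x) (inv\<^bsub>E\<^esub> y)"
proof -
  obtain q q' p p' where q: "(q,q') \<in> P" "(p,p') \<in> P" "q \<noteq> \<zero>\<^bsub>H\<^esub>" "q \<otimes>\<^bsub>H\<^esub> x = p" "q' \<otimes>\<^bsub>E\<^esub> y = p'"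
    using assms(1) unfolding Gr_def by blast
  note c = P_sub[OF q(1)] assms(1)[unfolded Gr_def]
  have p: "p \<noteq> \<zero>\<^bsub>H\<^esub>" using q assms(2) c by auto
  then have "p' \<noteq> \<zero>\<^bsub>E\<^esub>" using P_zero[OF q(2)] by simp
  then have y: "y \<noteq> \<zero>\<^bsub>E\<^esub>" using q c by auto
  have "p \<otimes>\<^bsub>H\<^esub> inv\<^bsub>H\<^esub> x = q" "p' \<otimes>\<^bsub>E\<^esub> inv\<^bsub>E\<^esub> y = q'"
    using c assms(2) y unfolding q(4,5)[symmetric] by (auto simp: H.m_assoc E.m_assoc)
  moreover have "inv\<^bsub>H\<^esub> x \<in> carrier H" "inv\<^bsub>E\<^esub> y \<in> carrier E" using c assms(2) y by auto
  ultimately show ?thesis unfolding Gr_def using q p by blast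
qed

text \<open>The elements that have an image form a division subring containing the generators, so
  \<open>P_gen\<close> makes it everything.\<close>

lemma Gr_total: assumes "x \<in> carrier H" shows "\<exists>y. Gr x y"
proof -
  let ?D = "{x. \<exists>y. Gr x y}"
  have neg1: "Gr (\<ominus>\<^bsub>H\<^esub> \<one>\<^bsub>H\<^esub>) (\<ominus>\<^bsub>E\<^esub> \<one>\<^bsub>E\<^esub>)" by (rule Gr_P[OF P_neg[OF P_one]])
  have "subring ?D H"
  proof (rule H.subringI)
    show "?D \<subseteq> carrier H" by (auto simp: Gr_def)
    show "\<one>\<^bsub>H\<^esub> \<in> ?D" using Gr_P[OF P_one] by auto
    show "\<ominus>\<^bsub>H\<^esub> x \<in> ?D" if x: "x \<in> ?D" for x
    proof -
      obtain y where y: "Gr x y" using x by auto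
      have "\<ominus>\<^bsub>H\<^esub> x = \<ominus>\<^bsub>H\<^esub> \<one>\<^bsub>H\<^esub> \<otimes>\<^bsub>H\<^esub> x" using y by (simp add: Gr_def H.l_minus)
      then show ?thesis using Gr_mult[OF neg1 y] by auto
    qed
  qed (use Gr_mult Gr_add in blast)+
  then have "subdivring ?D H" using Gr_inv by (intro H.subdivringI) auto
  then have "carrier H \<subseteq> ?D" by (rule P_gen) (use Gr_P in force)
  then show ?thesis using assms by auto
qed

definition "\<Theta> x = (THE y. Gr x y)"

lemma \<Theta>: assumes "x \<in> carrier H" shows "Gr x (\<Theta> x)"
proof -
  have "\<exists>!y. Gr x y" using Gr_total[OF assms] Gr_eq by blast
  then show ?thesis unfolding \<Theta>_def by (rule theI')
qed

lemma \<Theta>_eq: assumes "Gr x y" shows "\<Theta> x = y"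
  using \<Theta>[of x] Gr_eq[of x "\<Theta> x" x y] assms unfolding Gr_def[of x y] by blast

lemma \<Theta>_hom: "\<Theta> \<in> ring_hom H E"
proof (rule ring_hom_memI)
  fix x y assume x: "x \<in> carrier H" and y: "y \<in> carrier H"
  show "\<Theta> x \<in> carrier E" using \<Theta>[OF x] by (simp add: Gr_def)
  show "\<Theta> (x \<otimes>\<^bsub>H\<^esub> y) = \<Theta> x \<otimes>\<^bsub>E\<^esub> \<Theta> y" by (rule \<Theta>_eq[OF Gr_mult[OF \<Theta>[OF x] \<Theta>[OF y]]])
  show "\<Theta> (x \<oplus>\<^bsub>H\<^esub> y) = \<Theta> x \<oplus>\<^bsub>E\<^esub> \<Theta> y" by (rule \<Theta>_eq[OF Gr_add[OF \<Theta>[OF x] \<Theta>[OF y]]])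
next
  show "\<Theta> \<one>\<^bsub>H\<^esub> = \<one>\<^bsub>E\<^esub>" by (rule \<Theta>_eq[OF Gr_P[OF P_one]])
qed

lemma \<Theta>_inj: "inj_on \<Theta> (carrier H)"
  by (rule inj_onI) (use \<Theta> Gr_eq in blast)

text \<open>The Ore condition, iterated over a finite family; this is the clearing of denominators
  for linear disjointness.\<close>

lemma common_denominator:
  assumes "finite B" "\<And>b. b \<in> B \<Longrightarrow> x b \<in> carrier H"
  shows "\<exists>m m'. (m,m') \<in> P \<and> m \<noteq> \<zero>\<^bsub>H\<^esub> \<and> (\<forall>b\<in>B. \<exists>u u'. (u,u') \<in> P \<and> m \<otimes>\<^bsub>H\<^esub> x b = u)"
  using assms
proof (induction B rule: finite_induct)
  case empty then show ?case using P_one H.one_not_zero by blast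
next
  case (insert c B)
  obtain q q' where q: "(q,q') \<in> P" "q \<noteq> \<zero>\<^bsub>H\<^esub>" "\<And>b. b \<in> B \<Longrightarrow> \<exists>u u'. (u,u') \<in> P \<and> q \<otimes>\<^bsub>H\<^esub> x b = u"
    using insert.IH insert.prems by blast
  have xc: "x b \<in> carrier H" if "b \<in> insert c B" for b using insert.prems that by blast
  obtain s s' t t' where s: "(s,s') \<in> P" "(t,t') \<in> P" "s \<noteq> \<zero>\<^bsub>H\<^esub>" "s \<otimes>\<^bsub>H\<^esub> x c = t"
    using \<Theta>[OF xc[of c]] unfolding Gr_def by blast
  obtain a a' b b' where ab: "(a,a') \<in> P" "(b,b') \<in> P" "a \<noteq> \<zero>\<^bsub>H\<^esub>" "a \<otimes>\<^bsub>H\<^esub> q = b \<otimes>\<^bsub>H\<^esub> s" "a' \<otimes>\<^bsub>E\<^esub> q' = b' \<otimes>\<^bsub>E\<^esub> s'"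
    using ore_pair[OF q(1) s(1,3)] by blast
  note c = P_sub[OF q(1)] P_sub[OF s(1)] P_sub[OF ab(1)] P_sub[OF ab(2)]
  have "\<exists>u u'. (u,u') \<in> P \<and> a \<otimes>\<^bsub>H\<^esub> q \<otimes>\<^bsub>H\<^esub> x e = u" if e: "e \<in> insert c B" for e
  proof (cases "e = c")
    case True
    have "a \<otimes>\<^bsub>H\<^esub> q \<otimes>\<^bsub>H\<^esub> x c = b \<otimes>\<^bsub>H\<^esub> t" unfolding ab(4) using c xc[of c] s(4) by (simp add: H.m_assoc)
    then show ?thesis using True P_mult[OF ab(2) s(2)] by blast
  next
    case False
    then obtain u u' where u: "(u,u') \<in> P" "q \<otimes>\<^bsub>H\<^esub> x e = u" using q(3)[of e] e by blast
    then have "a \<otimes>\<^bsub>H\<^esub> q \<otimes>\<^bsub>H\<^esub> x e = a \<otimes>\<^bsub>H\<^esub> u" using c xc[OF e] by (simp add: H.m_assoc)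
    then show ?thesis using P_mult[OF ab(1) u(1)] by blast
  qed
  moreover have "a \<otimes>\<^bsub>H\<^esub> q \<noteq> \<zero>\<^bsub>H\<^esub>" using c ab(3) q(2) by simp
  ultimately show ?case using P_mult[OF ab(1) q(1)] by blast
qed

end

section \<open>Skew polynomials as series with rational exponents\<close>

lemma skewpoly_simps [simp]:
  "\<one>\<^bsub>skewpoly R K s\<^esub> = (\<lambda>i. if i = 0 then \<one>\<^bsub>R\<^esub> else \<zero>\<^bsub>R\<^esub>)" "\<zero>\<^bsub>skewpoly R K s\<^esub> = (\<lambda>i. \<zero>\<^bsub>R\<^esub>)"
  "p \<oplus>\<^bsub>skewpoly R K s\<^esub> q = (\<lambda>i. p i \<oplus>\<^bsub>R\<^esub> q i)"
  "(p \<otimes>\<^bsub>skewpoly R K s\<^esub> q) n = (\<Oplus>\<^bsub>R\<^esub>i\<in>{..n}. p i \<otimes>\<^bsub>R\<^esub> (s ^^ i) (q (n - i)))"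
  by (simp_all add: skewpoly_def)

lemma skewpoly_carrier:
  "p \<in> carrier (skewpoly R K s) \<longleftrightarrow> (\<forall>i. p i \<in> K) \<and> (\<exists>N. \<forall>i\<ge>N. p i = \<zero>\<^bsub>R\<^esub>)"
proof -
  have "finite {i. p i \<noteq> \<zero>\<^bsub>R\<^esub>} \<longleftrightarrow> (\<exists>N. \<forall>i\<ge>N. p i = \<zero>\<^bsub>R\<^esub>)"
    unfolding finite_nat_set_iff_bounded by (auto simp: not_less[symmetric])
  then show ?thesis by (simp add: skewpoly_def)
qed

context tower_limit
begin

abbreviation "Rn n \<equiv> skewpoly h (hs n) (\<sigma> n)"

lemma hns: "\<zero> \<in> hs n" "\<one> \<in> hs n" "x \<in> hs n \<Longrightarrow> \<ominus> x \<in> hs n" "x \<in> hs n \<Longrightarrow> y \<in> hs n \<Longrightarrow> x \<otimes> y \<in> hs n"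
  "x \<in> hs n \<Longrightarrow> y \<in> hs n \<Longrightarrow> x \<oplus> y \<in> hs n" "x \<in> hs n \<Longrightarrow> x \<noteq> \<zero> \<Longrightarrow> inv x \<in> hs n"
  using subdivringE[OF hs[of n]] by auto

lemma Rn_hs: "p \<in> carrier (Rn n) \<Longrightarrow> p i \<in> hs n" by (simp add: skewpoly_carrier)

lemma Rn_c [simp]: "p \<in> carrier (Rn n) \<Longrightarrow> p i \<in> carrier h" by (rule hsc[OF Rn_hs])

lemma \<sigma>_pow_c [simp]: "x \<in> hs n \<Longrightarrow> (\<sigma> n ^^ j) x \<in> carrier h" by (rule hsc[OF \<sigma>_pow_facts(1)])

lemma \<sigma>_pow_zero [simp]: "(\<sigma> n ^^ j) \<zero> = \<zero>"
proof -
  have "(\<sigma> n ^^ j) \<zero> \<oplus> (\<sigma> n ^^ j) \<zero> = (\<sigma> n ^^ j) \<zero>" using \<sigma>_pow_facts(5)[of \<zero> n \<zero> j] hns by simp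
  then show ?thesis using \<sigma>_pow_c[OF hns(1)[of n], of j] by simp
qed

lemma Rn_add: "p \<in> carrier (Rn n) \<Longrightarrow> q \<in> carrier (Rn n) \<Longrightarrow> p \<oplus>\<^bsub>Rn n\<^esub> q \<in> carrier (Rn n)"
proof -
  assume p: "p \<in> carrier (Rn n)" and q: "q \<in> carrier (Rn n)"
  then obtain N M where "\<forall>i\<ge>N. p i = \<zero>" "\<forall>i\<ge>M. q i = \<zero>" by (auto simp: skewpoly_carrier)
  then have "\<forall>i\<ge>max N M. (p \<oplus>\<^bsub>Rn n\<^esub> q) i = \<zero>" by simp
  moreover have "(p \<oplus>\<^bsub>Rn n\<^esub> q) i \<in> hs n" for i using Rn_hs[OF p] Rn_hs[OF q] hns(5) by simp
  ultimately show ?thesis unfolding skewpoly_carrier by blast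
qed

lemma Rn_neg: "p \<in> carrier (Rn n) \<Longrightarrow> (\<lambda>i. \<ominus> p i) \<in> carrier (Rn n)"
  using hns(3)[of _ n] unfolding skewpoly_carrier by (metis minus_zero)

lemma Rn_zero: "\<zero>\<^bsub>Rn n\<^esub> \<in> carrier (Rn n)" and Rn_one: "\<one>\<^bsub>Rn n\<^esub> \<in> carrier (Rn n)"
  using hns(1,2)[of n] by (auto simp: skewpoly_carrier intro: exI[of _ 1])

lemma Rn_mult: "p \<in> carrier (Rn n) \<Longrightarrow> q \<in> carrier (Rn n) \<Longrightarrow> p \<otimes>\<^bsub>Rn n\<^esub> q \<in> carrier (Rn n)"
proof -
  assume p: "p \<in> carrier (Rn n)" and q: "q \<in> carrier (Rn n)"
  then obtain N M where NM: "\<forall>i\<ge>N. p i = \<zero>" "\<forall>i\<ge>M. q i = \<zero>" by (auto simp: skewpoly_carrier)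
  have "(p \<otimes>\<^bsub>Rn n\<^esub> q) i \<in> hs n" for i
    unfolding skewpoly_simps
    by (rule finsum_subring[OF subdivringE(1)[OF hs]]) (use Rn_hs[OF p] Rn_hs[OF q] hns(4) \<sigma>_pow_facts(1) in auto)
  moreover have "(p \<otimes>\<^bsub>Rn n\<^esub> q) i = \<zero>" if i: "i \<ge> N + M" for i
    unfolding skewpoly_simps
  proof (rule add.finprod_one_eqI)
    fix j assume "j \<in> {..i}"
    show "p j \<otimes> (\<sigma> n ^^ j) (q (i - j)) = \<zero>"
    proof (cases "j \<ge> N")
      case True then show ?thesis using NM(1) \<sigma>_pow_c[OF Rn_hs[OF q]] by simp
    next
      case False
      then have "q (i - j) = \<zero>" using NM(2) i by auto
      then show ?thesis using p by simp
    qed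
  qed
  ultimately show ?thesis unfolding skewpoly_carrier by blast
qed

text \<open>The monomial \<open>t\<^sub>n^i\<close> is sent to the exponent \<open>i / l\<^sub>n\<close>, so that \<open>T = t\<^sub>n^l\<^sub>n\<close> has exponent \<open>1\<close>
  for every \<open>n\<close>.\<close>

definition \<iota> :: "nat \<Rightarrow> (nat \<Rightarrow> 'a) \<Rightarrow> rat \<Rightarrow> 'a" where
  "\<iota> n p s = (if s * lr n \<in> \<int> \<and> 0 \<le> s then p (nat \<lfloor>s * lr n\<rfloor>) else \<zero>)"

lemma \<iota>_grid: "\<iota> n p (of_nat i / lr n) = p i"
  using less_imp_le[OF lr_pos(1)[of n]] by (simp add: \<iota>_def)

lemma \<iota>_support: assumes "\<iota> n p s \<noteq> \<zero>" obtains i where "s = of_nat i / lr n" "p i \<noteq> \<zero>"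
proof -
  have s: "s * lr n \<in> \<int>" "0 \<le> s" "p (nat \<lfloor>s * lr n\<rfloor>) \<noteq> \<zero>" using assms by (auto simp: \<iota>_def split: if_splits)
  obtain i where i: "s * lr n = of_int i" using s(1) by (auto elim: Ints_cases)
  have "0 \<le> s * lr n" using s(2) lr_pos(1)[of n] by (simp add: less_imp_le)
  then have "0 \<le> i" using i by simp
  then have "s * lr n = of_nat (nat i)" using i by simp
  then have "s = of_nat (nat i) / lr n" by (simp add: field_simps)
  moreover have "p (nat i) \<noteq> \<zero>" using s(3) i by simp
  ultimately show thesis by (rule that)
qed

lemma grid_\<Gamma>: "of_nat i / lr n \<in> \<Gamma>" unfolding \<Gamma>_def by (auto intro!: exI[of _ n])

lemma \<iota>_closed: assumes p: "p \<in> carrier (Rn n)" shows "\<iota> n p \<in> carrier S"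
  unfolding tseries_carrier
proof (intro conjI allI impI)
  show "\<iota> n p s \<in> carrier h" for s using p by (simp add: \<iota>_def)
  show "s \<in> \<Gamma>" if "\<iota> n p s \<noteq> \<zero>" for s using \<iota>_support[OF that] grid_\<Gamma> by metis
  obtain N where N: "\<forall>i\<ge>N. p i = \<zero>" using p by (auto simp: skewpoly_carrier)
  have "{s. \<iota> n p s \<noteq> \<zero> \<and> s \<le> x} \<subseteq> (\<lambda>i. of_nat i / lr n) ` {..<N}" for x
  proof
    fix s assume "s \<in> {s. \<iota> n p s \<noteq> \<zero> \<and> s \<le> x}"
    then obtain i where i: "s = of_nat i / lr n" "p i \<noteq> \<zero>" using \<iota>_support by blast
    then have "i < N" using N by (metis not_less)
    then show "s \<in> (\<lambda>i. of_nat i / lr n) ` {..<N}" using i by auto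
  qed
  then show "finite {s. \<iota> n p s \<noteq> \<zero> \<and> s \<le> x}" for x using finite_subset by blast
qed

lemma \<iota>_add: "p \<in> carrier (Rn n) \<Longrightarrow> q \<in> carrier (Rn n) \<Longrightarrow> \<iota> n (p \<oplus>\<^bsub>Rn n\<^esub> q) = \<iota> n p \<oplus>\<^bsub>S\<^esub> \<iota> n q"
  by (auto simp: \<iota>_def)

lemma \<iota>_neg: "p \<in> carrier (Rn n) \<Longrightarrow> \<iota> n (\<lambda>i. \<ominus> p i) = \<ominus>\<^bsub>S\<^esub> \<iota> n p"
  by (auto simp: S_minus[OF \<iota>_closed] \<iota>_def)

lemma \<iota>_one: "\<iota> n \<one>\<^bsub>Rn n\<^esub> = \<one>\<^bsub>S\<^esub>"
proof
  fix s
  show "\<iota> n \<one>\<^bsub>Rn n\<^esub> s = \<one>\<^bsub>S\<^esub> s"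
  proof (cases "s = 0")
    case False
    have "\<iota> n \<one>\<^bsub>Rn n\<^esub> s = \<zero>"
    proof (rule ccontr)
      assume "\<iota> n \<one>\<^bsub>Rn n\<^esub> s \<noteq> \<zero>"
      then obtain i where "s = of_nat i / lr n" "\<one>\<^bsub>Rn n\<^esub> i \<noteq> \<zero>" by (rule \<iota>_support)
      then show False using False by (auto split: if_splits)
    qed
    then show ?thesis using False by simp
  qed (simp add: \<iota>_def)
qed

lemma \<tau>_grid: "x \<in> hs n \<Longrightarrow> \<tau> (of_nat i / lr n) x = (\<sigma> n ^^ i) x"
proof -
  assume x: "x \<in> hs n"
  have "idx (of_nat i / lr n) x n" using x by (simp add: idx_def)
  then have "\<tau> (of_nat i / lr n) x = ipow n \<lfloor>of_nat i / lr n * lr n\<rfloor> x" by (rule \<tau>_eq)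
  then show ?thesis using ipow_nat[OF x] by simp
qed

lemma \<iota>_mult:
  assumes p: "p \<in> carrier (Rn n)" and q: "q \<in> carrier (Rn n)"
  shows "\<iota> n (p \<otimes>\<^bsub>Rn n\<^esub> q) = \<iota> n p \<otimes>\<^bsub>S\<^esub> \<iota> n q"
proof
  fix t
  show "\<iota> n (p \<otimes>\<^bsub>Rn n\<^esub> q) t = (\<iota> n p \<otimes>\<^bsub>S\<^esub> \<iota> n q) t"
  proof (cases "\<exists>N. t = of_nat N / lr n")
    case True
    then obtain N where N: "t = of_nat N / lr n" by blast
    let ?g = "\<lambda>i. of_nat i / lr n"
    have inj: "inj_on ?g {..N}" by (auto simp: inj_on_def)
    have diff: "t - ?g i = ?g (N - i)" if "i \<le> N" for i using that N by (simp add: of_nat_diff diff_divide_distrib)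
    have "(\<iota> n p \<otimes>\<^bsub>S\<^esub> \<iota> n q) t = (\<Oplus>s\<in>?g ` {..N}. \<iota> n p s \<otimes> \<tau> s (\<iota> n q (t - s)))"
    proof (rule mult_eq[OF \<iota>_closed[OF p] \<iota>_closed[OF q]])
      fix s assume s: "\<iota> n p s \<noteq> \<zero>" "\<iota> n q (t - s) \<noteq> \<zero>"
      obtain i where i: "s = ?g i" using \<iota>_support[OF s(1)] by blast
      obtain j where j: "t - s = ?g j" using \<iota>_support[OF s(2)] by blast
      have "of_nat N / lr n = of_nat (i + j) / lr n" using i j N by (simp add: add_divide_distrib algebra_simps)
      then have "(of_nat N :: rat) = of_nat (i + j)" by simp
      then have "i \<le> N" by (simp only: of_nat_eq_iff)
      then show "s \<in> ?g ` {..N}" using i by auto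
    qed auto
    also have "\<dots> = (\<Oplus>i\<in>{..N}. \<iota> n p (?g i) \<otimes> \<tau> (?g i) (\<iota> n q (t - ?g i)))"
      using inj \<iota>_closed[OF p] \<iota>_closed[OF q] by (intro finsum_reindex) auto
    also have "\<dots> = (\<Oplus>i\<in>{..N}. p i \<otimes> (\<sigma> n ^^ i) (q (N - i)))"
    proof (rule finsum_cong')
      fix i assume "i \<in> {..N}"
      then have "\<iota> n q (t - ?g i) = q (N - i)" using diff[of i] \<iota>_grid by (metis atMost_iff)
      then show "\<iota> n p (?g i) \<otimes> \<tau> (?g i) (\<iota> n q (t - ?g i)) = p i \<otimes> (\<sigma> n ^^ i) (q (N - i))"
        using \<tau>_grid[OF Rn_hs[OF q]] \<iota>_grid[of n p i] by (simp only:)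
    qed (use p Rn_hs[OF q] in auto)
    finally show ?thesis unfolding N \<iota>_grid by simp
  next
    case False
    have "\<iota> n (p \<otimes>\<^bsub>Rn n\<^esub> q) t = \<zero>"
      using False \<iota>_support[of n "p \<otimes>\<^bsub>Rn n\<^esub> q" t] by blast
    moreover have "(\<iota> n p \<otimes>\<^bsub>S\<^esub> \<iota> n q) t = \<zero>"
    proof (rule ccontr)
      assume "(\<iota> n p \<otimes>\<^bsub>S\<^esub> \<iota> n q) t \<noteq> \<zero>"
      then obtain s where s: "\<iota> n p s \<noteq> \<zero>" "\<iota> n q (t - s) \<noteq> \<zero>" by (rule mult_support)
      obtain i where i: "s = of_nat i / lr n" using \<iota>_support[OF s(1)] by blast
      obtain j where j: "t - s = of_nat j / lr n" using \<iota>_support[OF s(2)] by blast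
      have "t = of_nat (i + j) / lr n" using i j by (simp add: add_divide_distrib algebra_simps)
      then show False using False by blast
    qed
    ultimately show ?thesis by simp
  qed
qed

lemma \<iota>_zero_iff: "p \<in> carrier (Rn n) \<Longrightarrow> \<iota> n p = \<zero>\<^bsub>S\<^esub> \<longleftrightarrow> p = \<zero>\<^bsub>Rn n\<^esub>"
proof
  assume "\<iota> n p = \<zero>\<^bsub>S\<^esub>"
  then have "p i = \<zero>" for i using \<iota>_grid[of n p i] by simp
  then show "p = \<zero>\<^bsub>Rn n\<^esub>" by auto
next
  assume "p = \<zero>\<^bsub>Rn n\<^esub>" then show "\<iota> n p = \<zero>\<^bsub>S\<^esub>" by (auto simp: \<iota>_def)
qed

lemma stretch_closed: assumes p: "p \<in> carrier (Rn n)" shows "stretch h (r n) p \<in> carrier (Rn (Suc n))"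
proof -
  obtain N where N: "\<forall>i\<ge>N. p i = \<zero>" using p by (auto simp: skewpoly_carrier)
  have "stretch h (r n) p i = \<zero>" if "i \<ge> N * r n" for i
    using N that r_pos[of n] div_le_mono[OF that, of "r n"] by (auto simp: stretch_def)
  moreover have "stretch h (r n) p i \<in> hs (Suc n)" for i
    using Rn_hs[OF p] hs_Suc[of n] hns(1) by (auto simp: stretch_def)
  ultimately show ?thesis unfolding skewpoly_carrier by blast
qed

text \<open>Exponent \<open>i\<close> at level \<open>n\<close> and exponent \<open>i * r n\<close>
  at the next level name the same rational number, since \<open>l (Suc n)\<close> is
  \<open>l n * r n\<close>. Hence the \<open>\<iota> n\<close> are compatible with the transition
  maps.\<close>

lemma \<iota>_stretch: "\<iota> (Suc n) (stretch h (r n) p) = \<iota> n p"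
proof
  fix s
  show "\<iota> (Suc n) (stretch h (r n) p) s = \<iota> n p s"
  proof (cases "\<exists>i. s = of_nat i / lr n")
    case True
    then obtain i where i: "s = of_nat i / lr n" by blast
    have "s = of_nat (i * r n) / lr (Suc n)" using i r_pos[of n] by (simp add: lr_Suc)
    then have "\<iota> (Suc n) (stretch h (r n) p) s = stretch h (r n) p (i * r n)" by (simp only: \<iota>_grid)
    also have "\<dots> = p i" using r_pos[of n] by (simp add: stretch_def)
    finally show ?thesis unfolding i \<iota>_grid .
  next
    case False
    have "\<iota> n p s = \<zero>" using False \<iota>_support[of n p s] by blast
    moreover have "\<iota> (Suc n) (stretch h (r n) p) s = \<zero>"
    proof (rule ccontr)
      assume "\<iota> (Suc n) (stretch h (r n) p) s \<noteq> \<zero>"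
      then obtain i where i: "s = of_nat i / lr (Suc n)" "stretch h (r n) p i \<noteq> \<zero>" by (rule \<iota>_support)
      then have "r n dvd i" by (auto simp: stretch_def split: if_splits)
      then obtain j where "i = r n * j" by auto
      then have "s = of_nat j / lr n" using i r_pos[of n] by (simp add: lr_Suc)
      then show False using False by blast
    qed
    ultimately show ?thesis by simp
  qed
qed

end

section \<open>The embedding of the direct limit into the twisted series\<close>

locale skew_limit = tower_limit +
  fixes H :: "('u,'v) ring_scheme" and \<psi>
  assumes lim: "is_skew_limit h hs \<sigma> l H \<psi>"
begin

sublocale H: divring H
  using lim unfolding is_skew_limit_def division_ring_iff_divring by auto

sublocale Sd: divring S by (rule S_divring)

lemma \<psi>_hom: "\<psi> n \<in> ring_hom (Rn n) H" and \<psi>_inj: "inj_on (\<psi> n) (carrier (Rn n))"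
  and \<psi>_stretch: "p \<in> carrier (Rn n) \<Longrightarrow> \<psi> (Suc n) (stretch h (r n) p) = \<psi> n p"
  and \<psi>_Un: "(\<Union>n. gen_divring H (\<psi> n ` carrier (Rn n))) = carrier H"
  using lim unfolding is_skew_limit_def by auto

lemma \<psi>_facts:
  assumes "p \<in> carrier (Rn n)" "q \<in> carrier (Rn n)"
  shows "\<psi> n p \<in> carrier H" "\<psi> n (p \<otimes>\<^bsub>Rn n\<^esub> q) = \<psi> n p \<otimes>\<^bsub>H\<^esub> \<psi> n q"
    "\<psi> n (p \<oplus>\<^bsub>Rn n\<^esub> q) = \<psi> n p \<oplus>\<^bsub>H\<^esub> \<psi> n q"
  using ring_hom_closed[OF \<psi>_hom assms(1)] ring_hom_mult[OF \<psi>_hom assms] ring_hom_add[OF \<psi>_hom assms] by auto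

lemma \<psi>_one: "\<psi> n \<one>\<^bsub>Rn n\<^esub> = \<one>\<^bsub>H\<^esub>" using ring_hom_one[OF \<psi>_hom] .

lemma \<psi>_zero: "\<psi> n \<zero>\<^bsub>Rn n\<^esub> = \<zero>\<^bsub>H\<^esub>"
proof -
  have "\<zero>\<^bsub>Rn n\<^esub> \<oplus>\<^bsub>Rn n\<^esub> \<zero>\<^bsub>Rn n\<^esub> = \<zero>\<^bsub>Rn n\<^esub>" by simp
  then have "\<psi> n \<zero>\<^bsub>Rn n\<^esub> \<oplus>\<^bsub>H\<^esub> \<psi> n \<zero>\<^bsub>Rn n\<^esub> = \<psi> n \<zero>\<^bsub>Rn n\<^esub>"
    using \<psi>_facts(3)[OF Rn_zero Rn_zero, of n] by metis
  then show ?thesis using \<psi>_facts(1)[OF Rn_zero Rn_zero, of n] H.add.r_cancel_one by blast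
qed

lemma \<psi>_zero_iff: "p \<in> carrier (Rn n) \<Longrightarrow> \<psi> n p = \<zero>\<^bsub>H\<^esub> \<longleftrightarrow> p = \<zero>\<^bsub>Rn n\<^esub>"
  using \<psi>_inj[of n] \<psi>_zero[of n] Rn_zero[of n] by (metis inj_onD)

lemma \<psi>_neg: "p \<in> carrier (Rn n) \<Longrightarrow> \<psi> n (\<lambda>i. \<ominus> p i) = \<ominus>\<^bsub>H\<^esub> \<psi> n p"
proof -
  assume p: "p \<in> carrier (Rn n)"
  have "(\<lambda>i. \<ominus> p i) \<oplus>\<^bsub>Rn n\<^esub> p = \<zero>\<^bsub>Rn n\<^esub>" using p by (simp add: l_neg)
  then have "\<psi> n (\<lambda>i. \<ominus> p i) \<oplus>\<^bsub>H\<^esub> \<psi> n p = \<zero>\<^bsub>H\<^esub>" using \<psi>_facts(3)[OF Rn_neg[OF p] p] \<psi>_zero by metis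
  then show ?thesis using \<psi>_facts(1)[OF p p] \<psi>_facts(1)[OF Rn_neg[OF p] p] H.minus_equality by metis
qed

definition "P = {(\<psi> n p, \<iota> n p) | n p. p \<in> carrier (Rn n)}"

lemma P_I: "p \<in> carrier (Rn n) \<Longrightarrow> (\<psi> n p, \<iota> n p) \<in> P" by (auto simp: P_def)

text \<open>Both \<open>\<psi>\<close> and \<open>\<iota>\<close> are compatible with stretching, so
  finitely many elements of different levels can be compared at one level.\<close>

lemma level_lift:
  assumes "n \<le> m" "p \<in> carrier (Rn n)"
  shows "\<exists>p'\<in>carrier (Rn m). \<psi> m p' = \<psi> n p \<and> \<iota> m p' = \<iota> n p"
  using assms(1)
proof (induction m rule: dec_induct)
  case base then show ?case using assms by auto
next
  case (step m)
  then obtain p' where p': "p' \<in> carrier (Rn m)" "\<psi> m p' = \<psi> n p" "\<iota> m p' = \<iota> n p" by blast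
  then show ?case using stretch_closed[OF p'(1)] \<psi>_stretch[OF p'(1)] \<iota>_stretch[of m p'] by (metis (no_types))
qed

lemma P_pair:
  assumes "(x,y) \<in> P" "(x',y') \<in> P"
  obtains n p q where "p \<in> carrier (Rn n)" "q \<in> carrier (Rn n)" "x = \<psi> n p" "y = \<iota> n p" "x' = \<psi> n q" "y' = \<iota> n q"
proof -
  obtain n p m q where p: "p \<in> carrier (Rn n)" "x = \<psi> n p" "y = \<iota> n p"
    and q: "q \<in> carrier (Rn m)" "x' = \<psi> m q" "y' = \<iota> m q" using assms by (auto simp: P_def)
  obtain p' q' where "p' \<in> carrier (Rn (max n m))" "\<psi> (max n m) p' = \<psi> n p" "\<iota> (max n m) p' = \<iota> n p"
    "q' \<in> carrier (Rn (max n m))" "\<psi> (max n m) q' = \<psi> m q" "\<iota> (max n m) q' = \<iota> m q"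
    using level_lift[OF max.cobounded1 p(1), of m] level_lift[OF max.cobounded2 q(1), of n] by blast
  then show thesis using that[of p' "max n m" q'] p q by simp
qed

definition "pmon c j = (\<lambda>i::nat. if i = j then c else \<zero>)"

lemma pmon_closed: "c \<in> hs n \<Longrightarrow> pmon c j \<in> carrier (Rn n)"
  using hns(1)[of n] unfolding skewpoly_carrier pmon_def
  by (intro conjI exI[of _ "Suc j"]) auto

lemma pmon_mult:
  assumes c: "c \<in> hs n" and q: "q \<in> carrier (Rn n)"
  shows "(pmon c j \<otimes>\<^bsub>Rn n\<^esub> q) i = (if j \<le> i then c \<otimes> (\<sigma> n ^^ j) (q (i - j)) else \<zero>)"
proof (cases "j \<le> i")
  case True
  have "(\<Oplus>m\<in>{..i}. pmon c j m \<otimes> (\<sigma> n ^^ m) (q (i - m))) = pmon c j j \<otimes> (\<sigma> n ^^ j) (q (i - j))"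
    by (rule finsum_delta) (use True c \<sigma>_pow_c[OF Rn_hs[OF q]] in \<open>auto simp: pmon_def\<close>)
  then show ?thesis using True by (simp add: pmon_def)
next
  case False
  have "(\<Oplus>m\<in>{..i}. pmon c j m \<otimes> (\<sigma> n ^^ m) (q (i - m))) = \<zero>"
    by (rule add.finprod_one_eqI) (use False \<sigma>_pow_c[OF Rn_hs[OF q]] in \<open>auto simp: pmon_def\<close>)
  then show ?thesis using False by simp
qed

text \<open>One step of division with the divisor on the right: a left multiple of \<open>q\<close>
  is subtracted that matches the coefficient of \<open>p\<close> at \<open>N\<close>. The identity
  is stated through \<open>\<psi> n\<close>, in \<open>H\<close>, where the ring laws are at
  hand.\<close>

lemma division_step:
  assumes p: "p \<in> carrier (Rn n)" "\<And>i. i \<ge> Suc N \<Longrightarrow> p i = \<zero>"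
    and q: "q \<in> carrier (Rn n)" "\<And>i. i \<ge> Suc M \<Longrightarrow> q i = \<zero>" "q M \<noteq> \<zero>" and MN: "M \<le> N"
  shows "\<exists>e\<in>carrier (Rn n). \<exists>p'\<in>carrier (Rn n). (\<forall>i\<ge>N. p' i = \<zero>) \<and> \<psi> n p = \<psi> n p' \<oplus>\<^bsub>H\<^esub> \<psi> n e \<otimes>\<^bsub>H\<^esub> \<psi> n q"
proof -
  define j where "j = N - M"
  \<comment> \<open>Multiplying \<open>q\<close> by the power \<open>j\<close> of the variable on
    the left twists its leading coefficient, so the quotient \<open>c\<close> is taken with respect
    to this \<open>v\<close>.\<close>
  define v where "v = (\<sigma> n ^^ j) (q M)"
  have v: "v \<in> hs n" using \<sigma>_pow_facts(1)[OF Rn_hs[OF q(1)]] by (simp add: v_def)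
  have vnz: "v \<noteq> \<zero>"
  proof
    assume z: "v = \<zero>"
    have qM: "q M \<in> hs n" using Rn_hs[OF q(1)] .
    have "\<one> = (\<sigma> n ^^ j) (q M \<otimes> inv (q M))" using q(3) qM \<sigma>_pow_facts(3) by simp
    also have "\<dots> = v \<otimes> (\<sigma> n ^^ j) (inv (q M))" using \<sigma>_pow_facts(4)[OF qM hns(6)[OF qM q(3)]] by (simp add: v_def)
    also have "\<dots> = \<zero>" using z \<sigma>_pow_c[OF hns(6)[OF qM q(3)]] by simp
    finally show False by simp
  qed
  define c where "c = p N \<otimes> inv v"
  have c: "c \<in> hs n" using Rn_hs[OF p(1)] hns(4,6) v vnz by (simp add: c_def)
  have cv: "c \<otimes> v = p N" using p(1) v vnz by (simp add: c_def m_assoc)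
  define e where "e = pmon c j"
  have e: "e \<in> carrier (Rn n)" using pmon_closed[OF c] by (simp add: e_def)
  have eq: "e \<otimes>\<^bsub>Rn n\<^esub> q \<in> carrier (Rn n)" by (rule Rn_mult[OF e q(1)])
  define p' where "p' = p \<oplus>\<^bsub>Rn n\<^esub> (\<lambda>i. \<ominus> (e \<otimes>\<^bsub>Rn n\<^esub> q) i)"
  have p': "p' \<in> carrier (Rn n)" unfolding p'_def by (rule Rn_add[OF p(1) Rn_neg[OF eq]])
  have "p' i = \<zero>" if i: "i \<ge> N" for i
  proof (cases "i = N")
    case True
    have "(e \<otimes>\<^bsub>Rn n\<^esub> q) N = p N" unfolding e_def pmon_mult[OF c q(1)]
      using MN cv by (simp add: j_def v_def)
    then show ?thesis using True p(1) by (simp add: p'_def r_neg del: skewpoly_simps(4))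
  next
    case False
    then have "q (i - j) = \<zero>" using i q(2)[of "i - j"] MN by (simp add: j_def)
    then have "(e \<otimes>\<^bsub>Rn n\<^esub> q) i = \<zero>" unfolding e_def pmon_mult[OF c q(1)] using c by simp
    then show ?thesis using False i p(2)[of i] by (simp add: p'_def del: skewpoly_simps(4))
  qed
  moreover have "p' \<oplus>\<^bsub>Rn n\<^esub> e \<otimes>\<^bsub>Rn n\<^esub> q = p"
    using Rn_c[OF p(1)] Rn_c[OF eq] by (auto simp: p'_def a_assoc l_neg simp del: skewpoly_simps(4))
  then have "\<psi> n p = \<psi> n p' \<oplus>\<^bsub>H\<^esub> \<psi> n e \<otimes>\<^bsub>H\<^esub> \<psi> n q"
    using \<psi>_facts(3)[OF p' eq] \<psi>_facts(2)[OF e q(1)] by metis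
  ultimately show ?thesis using e p' by blast
qed

text \<open>The Euclidean algorithm, by induction on the sum of two strict degree bounds. A
  remainder replaces the polynomial of larger bound, and a common left multiple for the new pair is
  turned into one for the old pair.\<close>

lemma ore_aux:
  assumes "p \<in> carrier (Rn n)" "\<And>i. i \<ge> N \<Longrightarrow> p i = \<zero>" "q \<in> carrier (Rn n)" "\<And>i. i \<ge> M \<Longrightarrow> q i = \<zero>" "\<psi> n q \<noteq> \<zero>\<^bsub>H\<^esub>"
  shows "\<exists>a\<in>carrier (Rn n). \<exists>b\<in>carrier (Rn n). \<psi> n a \<noteq> \<zero>\<^bsub>H\<^esub> \<and> \<psi> n a \<otimes>\<^bsub>H\<^esub> \<psi> n p = \<psi> n b \<otimes>\<^bsub>H\<^esub> \<psi> n q"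
  using assms
proof (induction "N + M" arbitrary: p q N M rule: less_induct)
  case less
  note p = less.prems(1,2) and q = less.prems(3-5)
  note pc = \<psi>_facts(1)[OF p(1) p(1)] and qc = \<psi>_facts(1)[OF q(1) q(1)]
  have qnz: "q \<noteq> \<zero>\<^bsub>Rn n\<^esub>" using q(3) \<psi>_zero by auto
  show ?case
  proof (cases "p = \<zero>\<^bsub>Rn n\<^esub>")
    case True
    then have "\<psi> n p = \<zero>\<^bsub>H\<^esub>" using \<psi>_zero by simp
    then have "\<psi> n \<one>\<^bsub>Rn n\<^esub> \<noteq> \<zero>\<^bsub>H\<^esub> \<and> \<psi> n \<one>\<^bsub>Rn n\<^esub> \<otimes>\<^bsub>H\<^esub> \<psi> n p = \<psi> n \<zero>\<^bsub>Rn n\<^esub> \<otimes>\<^bsub>H\<^esub> \<psi> n q"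
      using qc by (simp add: \<psi>_one \<psi>_zero del: skewpoly_simps)
    then show ?thesis using Rn_one Rn_zero by blast
  next
    case pnz: False
    then have N0: "N \<noteq> 0" using p(2) by auto
    have M0: "M \<noteq> 0" using q(2) qnz by auto
    obtain N' M' where N': "N = Suc N'" and M': "M = Suc M'" using N0 M0 by (meson not0_implies_Suc)
    consider "p N' = \<zero>" | "q M' = \<zero>" | "p N' \<noteq> \<zero>" "q M' \<noteq> \<zero>" "M' \<le> N'" | "p N' \<noteq> \<zero>" "q M' \<noteq> \<zero>" "N' \<le> M'"
      by linarith
    then show ?thesis
    proof cases
      case 1
      have "p i = \<zero>" if "i \<ge> N'" for i using that 1 p(2)[of i] N' by (cases "i = N'") auto
      then show ?thesis using less.hyps[of N' M p q] p q N' by simp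
    next
      case 2
      have "q i = \<zero>" if "i \<ge> M'" for i using that 2 q(2)[of i] M' by (cases "i = M'") auto
      then show ?thesis using less.hyps[of N M' p q] p q M' by simp
    next
      case 3
      obtain e p' where e: "e \<in> carrier (Rn n)" "p' \<in> carrier (Rn n)" "\<And>i. i \<ge> N' \<Longrightarrow> p' i = \<zero>"
        "\<psi> n p = \<psi> n p' \<oplus>\<^bsub>H\<^esub> \<psi> n e \<otimes>\<^bsub>H\<^esub> \<psi> n q"
        using division_step[OF p(1) _ q(1) _ 3(2,3)] p(2) q(2) N' M' by blast
      obtain a b where ab: "a \<in> carrier (Rn n)" "b \<in> carrier (Rn n)" "\<psi> n a \<noteq> \<zero>\<^bsub>H\<^esub>" "\<psi> n a \<otimes>\<^bsub>H\<^esub> \<psi> n p' = \<psi> n b \<otimes>\<^bsub>H\<^esub> \<psi> n q"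
        using less.hyps[of N' M p' q] e q N' by auto
      have c: "\<psi> n a \<in> carrier H" "\<psi> n b \<in> carrier H" "\<psi> n e \<in> carrier H" "\<psi> n p' \<in> carrier H"
        using \<psi>_facts(1) ab e by auto
      define b' where "b' = b \<oplus>\<^bsub>Rn n\<^esub> a \<otimes>\<^bsub>Rn n\<^esub> e"
      have b': "b' \<in> carrier (Rn n)" unfolding b'_def by (intro Rn_add Rn_mult ab e)
      have "\<psi> n b' = \<psi> n b \<oplus>\<^bsub>H\<^esub> \<psi> n a \<otimes>\<^bsub>H\<^esub> \<psi> n e"
        unfolding b'_def using \<psi>_facts(3)[OF ab(2) Rn_mult[OF ab(1) e(1)]] \<psi>_facts(2)[OF ab(1) e(1)] by metis
      then have "\<psi> n a \<otimes>\<^bsub>H\<^esub> \<psi> n p = \<psi> n b' \<otimes>\<^bsub>H\<^esub> \<psi> n q"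
        unfolding e(4) using c qc ab(4) by (simp add: H.r_distr H.l_distr H.m_assoc)
      then show ?thesis using ab b' by blast
    next
      case 4
      obtain e q' where e: "e \<in> carrier (Rn n)" "q' \<in> carrier (Rn n)" "\<And>i. i \<ge> M' \<Longrightarrow> q' i = \<zero>"
        "\<psi> n q = \<psi> n q' \<oplus>\<^bsub>H\<^esub> \<psi> n e \<otimes>\<^bsub>H\<^esub> \<psi> n p"
        using division_step[OF q(1) _ p(1) _ 4(1,3)] p(2) q(2) N' M' by blast
      have c: "\<psi> n e \<in> carrier H" "\<psi> n q' \<in> carrier H" using \<psi>_facts(1) e by auto
      show ?thesis
      proof (cases "\<psi> n q' = \<zero>\<^bsub>H\<^esub>")
        case True
        \<comment> \<open>With no remainder, \<open>q\<close> is the multiple \<open>e p\<close>, so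
          \<open>e\<close> and \<open>\<one>\<close> are the multipliers; the induction hypothesis
          could not be applied to a zero divisor.\<close>
        then have eq: "\<psi> n q = \<psi> n e \<otimes>\<^bsub>H\<^esub> \<psi> n p" using e(4) c pc by simp
        then have "\<psi> n e \<noteq> \<zero>\<^bsub>H\<^esub>" using q(3) pc by auto
        moreover have "\<psi> n e \<otimes>\<^bsub>H\<^esub> \<psi> n p = \<psi> n \<one>\<^bsub>Rn n\<^esub> \<otimes>\<^bsub>H\<^esub> \<psi> n q" using eq qc by (simp add: \<psi>_one del: skewpoly_simps)
        ultimately show ?thesis using e(1) Rn_one by blast
      next
        case False
        obtain a b where ab: "a \<in> carrier (Rn n)" "b \<in> carrier (Rn n)" "\<psi> n a \<noteq> \<zero>\<^bsub>H\<^esub>" "\<psi> n a \<otimes>\<^bsub>H\<^esub> \<psi> n p = \<psi> n b \<otimes>\<^bsub>H\<^esub> \<psi> n q'"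
          using less.hyps[of N M' p q'] e p M' False by auto
        have c2: "\<psi> n a \<in> carrier H" "\<psi> n b \<in> carrier H" using \<psi>_facts(1) ab by auto
        define a' where "a' = a \<oplus>\<^bsub>Rn n\<^esub> b \<otimes>\<^bsub>Rn n\<^esub> e"
        have a': "a' \<in> carrier (Rn n)" unfolding a'_def by (intro Rn_add Rn_mult ab e)
        have a'e: "\<psi> n a' = \<psi> n a \<oplus>\<^bsub>H\<^esub> \<psi> n b \<otimes>\<^bsub>H\<^esub> \<psi> n e"
          unfolding a'_def using \<psi>_facts(3)[OF ab(1) Rn_mult[OF ab(2) e(1)]] \<psi>_facts(2)[OF ab(2) e(1)] by metis
        have main: "\<psi> n a' \<otimes>\<^bsub>H\<^esub> \<psi> n p = \<psi> n b \<otimes>\<^bsub>H\<^esub> \<psi> n q"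
          unfolding e(4) a'e using c c2 pc ab(4) by (simp add: H.r_distr H.l_distr H.m_assoc)
        \<comment> \<open>The new multiplier \<open>a + b e\<close> might vanish by cancellation.
          Then \<open>b q\<close> would vanish, hence \<open>b\<close>, and finally
          \<open>a\<close>, contrary to its choice.\<close>
        have "\<psi> n a' \<noteq> \<zero>\<^bsub>H\<^esub>"
        proof
          assume z: "\<psi> n a' = \<zero>\<^bsub>H\<^esub>"
          then have "\<psi> n b \<otimes>\<^bsub>H\<^esub> \<psi> n q = \<zero>\<^bsub>H\<^esub>" using main pc by simp
          then have "\<psi> n b = \<zero>\<^bsub>H\<^esub>" using H.integral_nz[OF c2(2) qc] q(3) by simp
          then show False using z a'e c c2 ab(3) by simp
        qed
        then show ?thesis using a' ab(2) main by blast
      qed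
    qed
  qed
qed

text \<open>Two pairs are lifted to a common level, where the Euclidean algorithm gives the Ore
  condition. Generation is the last clause of \<open>is_skew_limit\<close>.\<close>

sublocale FP: fraction_pair H S P
proof unfold_locales
  show "x \<in> carrier H \<and> y \<in> carrier S" if "(x,y) \<in> P" for x y
    using that \<psi>_facts(1) \<iota>_closed by (auto simp: P_def simp del: tseries_simps)
  show "(\<one>\<^bsub>H\<^esub>, \<one>\<^bsub>S\<^esub>) \<in> P" using P_I[OF Rn_one[of 0]] \<psi>_one \<iota>_one by metis
  show "(x \<oplus>\<^bsub>H\<^esub> x', y \<oplus>\<^bsub>S\<^esub> y') \<in> P" "(x \<otimes>\<^bsub>H\<^esub> x', y \<otimes>\<^bsub>S\<^esub> y') \<in> P" if xy: "(x,y) \<in> P" "(x',y') \<in> P" for x y x' y'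
  proof -
    obtain n p q where *: "p \<in> carrier (Rn n)" "q \<in> carrier (Rn n)" "x = \<psi> n p" "y = \<iota> n p" "x' = \<psi> n q" "y' = \<iota> n q"
      using P_pair[OF xy] by blast
    show "(x \<oplus>\<^bsub>H\<^esub> x', y \<oplus>\<^bsub>S\<^esub> y') \<in> P"
      using P_I[OF Rn_add[OF *(1,2)]] \<psi>_facts(3)[OF *(1,2)] \<iota>_add[OF *(1,2)] * by metis
    show "(x \<otimes>\<^bsub>H\<^esub> x', y \<otimes>\<^bsub>S\<^esub> y') \<in> P"
      using P_I[OF Rn_mult[OF *(1,2)]] \<psi>_facts(2)[OF *(1,2)] \<iota>_mult[OF *(1,2)] * by metis
  qed
  show "(\<ominus>\<^bsub>H\<^esub> x, \<ominus>\<^bsub>S\<^esub> y) \<in> P" if xy: "(x,y) \<in> P" for x y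
  proof -
    obtain n p where *: "p \<in> carrier (Rn n)" "x = \<psi> n p" "y = \<iota> n p" using xy by (auto simp: P_def)
    show ?thesis using P_I[OF Rn_neg[OF *(1)]] \<psi>_neg[OF *(1)] \<iota>_neg[OF *(1)] * by metis
  qed
  show "x = \<zero>\<^bsub>H\<^esub> \<longleftrightarrow> y = \<zero>\<^bsub>S\<^esub>" if xy: "(x,y) \<in> P" for x y
  proof -
    obtain n p where *: "p \<in> carrier (Rn n)" "x = \<psi> n p" "y = \<iota> n p" using xy by (auto simp: P_def)
    show ?thesis unfolding *(2,3) \<psi>_zero_iff[OF *(1)] \<iota>_zero_iff[OF *(1)] by (rule refl)
  qed
  show "\<exists>a a' b b'. (a,a') \<in> P \<and> (b,b') \<in> P \<and> a \<noteq> \<zero>\<^bsub>H\<^esub> \<and> a \<otimes>\<^bsub>H\<^esub> x = b \<otimes>\<^bsub>H\<^esub> x'"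
    if xy: "(x,y) \<in> P" "(x',y') \<in> P" "x' \<noteq> \<zero>\<^bsub>H\<^esub>" for x y x' y'
  proof -
    obtain n p q where *: "p \<in> carrier (Rn n)" "q \<in> carrier (Rn n)" "x = \<psi> n p" "y = \<iota> n p" "x' = \<psi> n q" "y' = \<iota> n q"
      using P_pair[OF xy(1,2)] by blast
    obtain N M where "\<And>i. i \<ge> N \<Longrightarrow> p i = \<zero>" "\<And>i. i \<ge> M \<Longrightarrow> q i = \<zero>" using *(1,2) by (auto simp: skewpoly_carrier)
    then obtain a b where "a\<in>carrier (Rn n)" "b\<in>carrier (Rn n)" "\<psi> n a \<noteq> \<zero>\<^bsub>H\<^esub>" "\<psi> n a \<otimes>\<^bsub>H\<^esub> x = \<psi> n b \<otimes>\<^bsub>H\<^esub> x'"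
      using ore_aux[OF *(1) _ *(2), of N M] xy(3) * by blast
    then show ?thesis using P_I by blast
  qed
  show "carrier H \<subseteq> D" if "subdivring D H" "fst ` P \<subseteq> D" for D
  proof -
    have "\<psi> n ` carrier (Rn n) \<subseteq> D" for n using that(2) P_I by force
    then have "gen_divring H (\<psi> n ` carrier (Rn n)) \<subseteq> D" for n using that(1) unfolding gen_divring_def by blast
    then show ?thesis unfolding \<psi>_Un[symmetric] by blast
  qed
qed

abbreviation "\<Theta> \<equiv> FP.\<Theta>"

lemma \<Theta>_\<psi>: "p \<in> carrier (Rn n) \<Longrightarrow> \<Theta> (\<psi> n p) = \<iota> n p"
  by (rule FP.\<Theta>_eq[OF FP.Gr_P[OF P_I]])

definition "H' = \<Theta> ` carrier H"

lemma H'_subdivring: "subdivring H' S"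
proof -
  note hom = ring_hom_closed[OF FP.\<Theta>_hom] ring_hom_mult[OF FP.\<Theta>_hom] ring_hom_add[OF FP.\<Theta>_hom] ring_hom_one[OF FP.\<Theta>_hom]
  interpret hr: ring_hom_ring H S \<Theta>
    by (rule ring_hom_ringI2[OF H.ring_axioms S_ring FP.\<Theta>_hom])
  show ?thesis
  proof (rule Sd.subdivringI)
    show "subring H' S" unfolding H'_def by (rule hr.img_is_subring[OF H.carrier_is_subring])
    fix y assume y: "y \<in> H'" "y \<noteq> \<zero>\<^bsub>S\<^esub>"
    then obtain x where x: "x \<in> carrier H" "y = \<Theta> x" by (auto simp: H'_def)
    have "x \<noteq> \<zero>\<^bsub>H\<^esub>" using x y hr.hom_zero by auto
    then have ix: "inv\<^bsub>H\<^esub> x \<in> carrier H" "x \<otimes>\<^bsub>H\<^esub> inv\<^bsub>H\<^esub> x = \<one>\<^bsub>H\<^esub>" using x by auto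
    have "y \<otimes>\<^bsub>S\<^esub> \<Theta> (inv\<^bsub>H\<^esub> x) = \<one>\<^bsub>S\<^esub>" using hom(2)[OF x(1) ix(1)] ix(2) hom(4) x by (simp del: tseries_simps)
    then have "inv\<^bsub>S\<^esub> y = \<Theta> (inv\<^bsub>H\<^esub> x)" using hom(1)[OF x(1)] hom(1)[OF ix(1)] x by (intro Sd.inv_unique_nz) auto
    then show "inv\<^bsub>S\<^esub> y \<in> H'" using ix by (auto simp: H'_def)
  qed
qed

end

section \<open>Laurent series over \<open>kk\<close> inside the twisted series\<close>

context tower_limit
begin

text \<open>The field \<open>kk((T))\<close> written with rational indices. Since
  \<open>\<tau>\<close> fixes \<open>kk\<close>, its untwisted product agrees with the twisted one
  of \<open>S\<close>.\<close>

abbreviation "Z \<equiv> tseries h kk (\<int>) (\<lambda>s x. x)"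

sublocale Zs: twisted_series h kk "\<int>" "\<lambda>s x. x"
  by unfold_locales (use kk in auto)

lemma Ints_\<Gamma>: "s \<in> \<int> \<Longrightarrow> s \<in> \<Gamma>" using Ints_mult[of s "lr 0"] by (auto simp: \<Gamma>_def lr_def)

lemma Z_sub: "f \<in> carrier Z \<Longrightarrow> f \<in> carrier S"
  using subdivringE(2)[OF kk] Ints_\<Gamma> by (auto simp: tseries_carrier subset_eq)

lemma Z_mult: assumes "f \<in> carrier Z" "g \<in> carrier Z" shows "f \<otimes>\<^bsub>S\<^esub> g = f \<otimes>\<^bsub>Z\<^esub> g"
proof
  fix t
  have "\<tau> s (g (t - s)) = g (t - s)" for s using \<tau>_props(7)[OF Zs.SK[OF assms(2)]] .
  then show "(f \<otimes>\<^bsub>S\<^esub> g) t = (f \<otimes>\<^bsub>Z\<^esub> g) t" by (simp add: tseries_mult)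
qed

lemma Z_neg: assumes "f \<in> carrier Z" shows "\<ominus>\<^bsub>S\<^esub> f = \<ominus>\<^bsub>Z\<^esub> f"
  using S_minus[OF Z_sub[OF assms]] Zs.S_minus[OF assms] by simp

lemma Z_inv: assumes "f \<in> carrier Z" "f \<noteq> \<zero>\<^bsub>Z\<^esub>" shows "inv\<^bsub>S\<^esub> f = inv\<^bsub>Z\<^esub> f" "inv\<^bsub>Z\<^esub> f \<in> carrier Z"
proof -
  interpret Zd: divring Z by (rule Zs.S_divring)
  interpret Sd: divring S by (rule S_divring)
  show i: "inv\<^bsub>Z\<^esub> f \<in> carrier Z" using assms by simp
  have "f \<otimes>\<^bsub>S\<^esub> inv\<^bsub>Z\<^esub> f = f \<otimes>\<^bsub>Z\<^esub> inv\<^bsub>Z\<^esub> f" by (rule Z_mult[OF assms(1) i])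
  also have "\<dots> = \<one>\<^bsub>Z\<^esub>" using assms by (simp del: tseries_simps)
  finally have "f \<otimes>\<^bsub>S\<^esub> inv\<^bsub>Z\<^esub> f = \<one>\<^bsub>S\<^esub>" by simp
  then show "inv\<^bsub>S\<^esub> f = inv\<^bsub>Z\<^esub> f" using Z_sub assms i by (intro Sd.inv_unique_nz) auto
qed

text \<open>Reversing the summation index compares the two products term by term. Integral exponents
  act trivially on \<open>h\<close>, \<open>\<tau>\<close> fixes the coefficients in
  \<open>kk\<close>, and \<open>kk\<close> is central in \<open>h\<close>.\<close>

lemma Z_central: assumes f: "f \<in> carrier Z" and g: "g \<in> carrier S" shows "f \<otimes>\<^bsub>S\<^esub> g = g \<otimes>\<^bsub>S\<^esub> f"
proof
  fix t
  have f': "f \<in> carrier S" by (rule Z_sub[OF f])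
  let ?A = "{s. f s \<noteq> \<zero> \<and> g (t - s) \<noteq> \<zero>}"
  have fin: "finite ?A" by (rule mult_support_finite[OF f' g])
  have inj: "inj_on (\<lambda>s. t - s) ?A" by (auto simp: inj_on_def)
  have "(g \<otimes>\<^bsub>S\<^esub> f) t = (\<Oplus>s\<in>(\<lambda>s. t - s) ` ?A. g s \<otimes> \<tau> s (f (t - s)))"
  proof (rule mult_eq[OF g f'])
    fix s assume "g s \<noteq> \<zero>" "f (t - s) \<noteq> \<zero>"
    then show "s \<in> (\<lambda>s. t - s) ` ?A" by (intro image_eqI[of _ _ "t - s"]) auto
  qed (use fin in auto)
  also have "\<dots> = (\<Oplus>s\<in>?A. g (t - s) \<otimes> \<tau> (t - s) (f (t - (t - s))))"
    using inj f' g by (intro finsum_reindex) auto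
  also have "\<dots> = (\<Oplus>s\<in>?A. f s \<otimes> \<tau> s (g (t - s)))"
  proof (rule finsum_cong')
    fix s assume s: "s \<in> ?A"
    have "s \<in> \<int>" using Zs.S\<Gamma>[OF f] s by auto
    then have "\<tau> s (g (t - s)) = g (t - s)" using \<tau>_props(5) g by simp
    moreover have "\<tau> (t - s) (f s) = f s" using \<tau>_props(7)[OF Zs.SK[OF f]] .
    ultimately show "g (t - s) \<otimes> \<tau> (t - s) (f (t - (t - s))) = f s \<otimes> \<tau> s (g (t - s))"
      using kk_central[OF Zs.SK[OF f, of s], of "g (t - s)"] g by simp
  qed (use f' g in auto)
  also have "\<dots> = (f \<otimes>\<^bsub>S\<^esub> g) t" by (rule mult_eq[OF f' g fin, symmetric]) auto
  finally show "(f \<otimes>\<^bsub>S\<^esub> g) t = (g \<otimes>\<^bsub>S\<^esub> f) t" by simp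
qed

abbreviation "LL \<equiv> laurent h kk"

definition \<eta> :: "(rat \<Rightarrow> 'a) \<Rightarrow> int \<Rightarrow> 'a" where "\<eta> f i = f (of_int i)"

lemma LL_carrier: "f \<in> carrier LL \<longleftrightarrow> (\<forall>i. f i \<in> kk) \<and> (\<exists>N. \<forall>i<N. f i = \<zero>)" by (simp add: laurent_def)

lemma LL_simps:
  "\<one>\<^bsub>LL\<^esub> = (\<lambda>i. if i = 0 then \<one> else \<zero>)" "\<zero>\<^bsub>LL\<^esub> = (\<lambda>i. \<zero>)" "f \<oplus>\<^bsub>LL\<^esub> g = (\<lambda>i. f i \<oplus> g i)"
  "(f \<otimes>\<^bsub>LL\<^esub> g) n = (\<Oplus>i\<in>{i. f i \<noteq> \<zero> \<and> g (n - i) \<noteq> \<zero>}. f i \<otimes> g (n - i))"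
  by (simp_all add: laurent_def)

lemma \<eta>_iso: "\<eta> \<in> ring_iso Z LL"
proof (rule ring_iso_memI)
  show "\<eta> f \<in> carrier LL" if f: "f \<in> carrier Z" for f
  proof -
    obtain a where a: "\<And>s. f s \<noteq> \<zero> \<Longrightarrow> a \<le> s" using Zs.lower_bound[OF f] by blast
    have "\<eta> f i = \<zero>" if "i < \<lfloor>a\<rfloor>" for i
      using a[of "of_int i"] that by (auto simp: \<eta>_def) linarith
    then show ?thesis using Zs.SK[OF f] unfolding LL_carrier by (auto simp: \<eta>_def)
  qed
  show "\<eta> (f \<oplus>\<^bsub>Z\<^esub> g) = \<eta> f \<oplus>\<^bsub>LL\<^esub> \<eta> g" for f g by (auto simp: \<eta>_def LL_simps)
  show "\<eta> \<one>\<^bsub>Z\<^esub> = \<one>\<^bsub>LL\<^esub>" by (auto simp: \<eta>_def LL_simps)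
  show "\<eta> (f \<otimes>\<^bsub>Z\<^esub> g) = \<eta> f \<otimes>\<^bsub>LL\<^esub> \<eta> g" if f: "f \<in> carrier Z" and g: "g \<in> carrier Z" for f g
  proof
    fix n
    let ?A = "{i. \<eta> f i \<noteq> \<zero> \<and> \<eta> g (n - i) \<noteq> \<zero>}"
    have img: "{s. f s \<noteq> \<zero> \<and> g (of_int n - s) \<noteq> \<zero>} = of_int ` ?A"
    proof
      show "{s. f s \<noteq> \<zero> \<and> g (of_int n - s) \<noteq> \<zero>} \<subseteq> of_int ` ?A"
      proof
        fix s assume s: "s \<in> {s. f s \<noteq> \<zero> \<and> g (of_int n - s) \<noteq> \<zero>}"
        then have "s \<in> \<int>" using Zs.S\<Gamma>[OF f] by auto
        then obtain i where "s = of_int i" by (auto elim: Ints_cases)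
        then show "s \<in> of_int ` ?A" using s by (auto simp: \<eta>_def)
      qed
    qed (auto simp: \<eta>_def)
    have "\<eta> (f \<otimes>\<^bsub>Z\<^esub> g) n = (\<Oplus>s\<in>of_int ` ?A. f s \<otimes> g (of_int n - s))"
      by (simp add: \<eta>_def[of "f \<otimes>\<^bsub>Z\<^esub> g"] tseries_mult img)
    also have "\<dots> = (\<Oplus>i\<in>?A. f (of_int i) \<otimes> g (of_int n - of_int i))"
      using f g by (intro finsum_reindex) (auto simp: inj_on_def)
    also have "\<dots> = (\<eta> f \<otimes>\<^bsub>LL\<^esub> \<eta> g) n" by (simp add: LL_simps \<eta>_def)
    finally show "\<eta> (f \<otimes>\<^bsub>Z\<^esub> g) n = (\<eta> f \<otimes>\<^bsub>LL\<^esub> \<eta> g) n" .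
  qed
  show "bij_betw \<eta> (carrier Z) (carrier LL)"
    unfolding bij_betw_def
  proof
    show "inj_on \<eta> (carrier Z)"
    proof (rule inj_onI)
      fix f g assume f: "f \<in> carrier Z" and g: "g \<in> carrier Z" and eq: "\<eta> f = \<eta> g"
      show "f = g"
      proof
        fix s
        show "f s = g s"
        proof (cases "s \<in> \<int>")
          case True
          then obtain i where "s = of_int i" by (auto elim: Ints_cases)
          then show ?thesis using fun_cong[OF eq, of i] by (simp add: \<eta>_def)
        next
          case False
          then have "f s = \<zero>" "g s = \<zero>" using Zs.S\<Gamma>[OF f, of s] Zs.S\<Gamma>[OF g, of s] by blast+
          then show ?thesis by simp
        qed
      qed
    qed
    show "\<eta> ` carrier Z = carrier LL"
    proof
      show "\<eta> ` carrier Z \<subseteq> carrier LL" using \<open>\<And>f. f \<in> carrier Z \<Longrightarrow> \<eta> f \<in> carrier LL\<close> by auto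
      show "carrier LL \<subseteq> \<eta> ` carrier Z"
      proof
        fix f assume f: "f \<in> carrier LL"
        obtain N where N: "\<forall>i<N. f i = \<zero>" using f by (auto simp: LL_carrier)
        define g where "g s = (if s \<in> \<int> then f \<lfloor>s\<rfloor> else \<zero>)" for s :: rat
        have gs: "\<exists>i. s = of_int i \<and> i \<ge> N" if gs: "g s \<noteq> \<zero>" for s
        proof -
          have "s \<in> \<int>" "f \<lfloor>s\<rfloor> \<noteq> \<zero>" using gs by (auto simp: g_def split: if_splits)
          then show ?thesis using N by (auto elim!: Ints_cases simp: not_less[symmetric])
        qed
        have "{s. g s \<noteq> \<zero> \<and> s \<le> x} \<subseteq> of_int ` {N..\<lfloor>x\<rfloor>}" for x
        proof
          fix s assume "s \<in> {s. g s \<noteq> \<zero> \<and> s \<le> x}"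
          then obtain i where "s = of_int i" "i \<ge> N" "s \<le> x" using gs by blast
          then show "s \<in> of_int ` {N..\<lfloor>x\<rfloor>}" by (auto simp: le_floor_iff)
        qed
        then have "finite {s. g s \<noteq> \<zero> \<and> s \<le> x}" for x by (rule finite_subset) auto
        moreover have "g s \<in> kk" for s using f subdivringE(3)[OF kk] by (auto simp: g_def LL_carrier)
        moreover have "s \<in> \<int>" if "g s \<noteq> \<zero>" for s using that by (auto simp: g_def split: if_splits)
        ultimately have "g \<in> carrier Z" by (simp add: tseries_carrier)
        moreover have "\<eta> g = f" by (auto simp: \<eta>_def g_def)
        ultimately show "f \<in> \<eta> ` carrier Z" by blast
      qed
    qed
  qed
qed

lemma LL_ring: "ring LL"
proof -
  \<comment> \<open>The result on images under an isomorphism replaces the zero of the target by the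
    image of the old zero; here this is the zero already present.\<close>
  have "ring (LL\<lparr>ring.zero := \<eta> \<zero>\<^bsub>Z\<^esub>\<rparr>)" by (rule Zs.S.ring_iso_imp_img_ring[OF \<eta>_iso])
  moreover have "LL\<lparr>ring.zero := \<eta> \<zero>\<^bsub>Z\<^esub>\<rparr> = LL" by (simp add: laurent_def fun_eq_iff \<eta>_def)
  ultimately show ?thesis by simp
qed

lemma LL_divring: "divring LL"
  by (rule divring_image[OF Zs.S_ring LL_ring \<eta>_iso order_refl Zs.S_divring])

end

section \<open>Linear disjointness\<close>

lemma (in ring) finsum_product:
  assumes "finite A" "finite B" "\<And>a b. a \<in> A \<Longrightarrow> b \<in> B \<Longrightarrow> f a b \<in> carrier R"
  shows "(\<Oplus>a\<in>A. \<Oplus>b\<in>B. f a b) = (\<Oplus>x\<in>A \<times> B. f (fst x) (snd x))"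
  using assms(1,3)
proof (induction A rule: finite_induct)
  case empty then show ?case by simp
next
  case (insert a A)
  have eq: "insert a A \<times> B = Pair a ` B \<union> A \<times> B" by auto
  have "(\<Oplus>x\<in>insert a A \<times> B. f (fst x) (snd x)) =
      (\<Oplus>x\<in>Pair a ` B. f (fst x) (snd x)) \<oplus> (\<Oplus>x\<in>A \<times> B. f (fst x) (snd x))"
    unfolding eq using insert assms(2) by (intro finsum_Un_disjoint) auto
  also have "(\<Oplus>x\<in>Pair a ` B. f (fst x) (snd x)) = (\<Oplus>b\<in>B. f a b)"
    using insert by (subst finsum_reindex) (auto simp: inj_on_def)
  also have "(\<Oplus>x\<in>A \<times> B. f (fst x) (snd x)) = (\<Oplus>a\<in>A. \<Oplus>b\<in>B. f a b)" using insert by simp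
  finally show ?case using insert by (subst finsum_insert) auto
qed

text \<open>A left \<open>K\<close>-linear functional on the span of the \<open>c j\<close> with
  value \<open>\<one>\<close> at \<open>c j0\<close>, given by its values \<open>\<phi> j\<close>;
  respecting all relations replaces linearity. The induction extends it by one vector at a
  time.\<close>

lemma (in divring) functional_exists_insert:
  assumes K: "subdivring K R" and J: "finite J" "j0 \<notin> J" "\<And>j. j \<in> insert j0 J \<Longrightarrow> c j \<in> carrier R" "c j0 \<noteq> \<zero>"
  shows "\<exists>\<phi> \<in> insert j0 J \<rightarrow> K. \<phi> j0 = \<one> \<and>
    (\<forall>a \<in> insert j0 J \<rightarrow> K. (\<Oplus>j\<in>insert j0 J. a j \<otimes> c j) = \<zero> \<longrightarrow> (\<Oplus>j\<in>insert j0 J. a j \<otimes> \<phi> j) = \<zero>)"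
  using J
proof (induction J rule: finite_induct)
  case empty
  have Kc: "x \<in> carrier R" if "x \<in> K" for x using subdivringE(2)[OF K] that by auto
  have "a j0 = \<zero>" if a: "a \<in> {j0} \<rightarrow> K" "(\<Oplus>j\<in>{j0}. a j \<otimes> c j) = \<zero>" for a
  proof -
    have "a j0 \<in> carrier R" using a Kc by auto
    then show ?thesis using a(2) empty.prems integral_nz[of "a j0" "c j0"] by (simp add: finsum_insert)
  qed
  then have "(\<Oplus>j\<in>{j0}. a j \<otimes> \<one>) = \<zero>" if "a \<in> {j0} \<rightarrow> K" "(\<Oplus>j\<in>{j0}. a j \<otimes> c j) = \<zero>" for a
    using that by (intro add.finprod_one_eqI) (metis l_null one_closed singletonD)
  then show ?case using subdivringE(4)[OF K] by (intro bexI[of _ "\<lambda>_. \<one>"]) auto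
next
  case (insert j J)
  note Ks = subdivringE[OF K]
  have Kc: "x \<in> carrier R" if "x \<in> K" for x using Ks(2) that by auto
  define I where "I = insert j0 J"
  have I: "finite I" "j \<notin> I" "insert j0 (insert j J) = insert j I" "j0 \<in> I" using insert by (auto simp: I_def)
  have cc: "c i \<in> carrier R" if "i \<in> insert j I" for i using insert.prems that I by auto
  obtain \<phi> where \<phi>: "\<phi> \<in> I \<rightarrow> K" "\<phi> j0 = \<one>"
    and \<phi>a: "\<And>a. a \<in> I \<rightarrow> K \<Longrightarrow> (\<Oplus>j\<in>I. a j \<otimes> c j) = \<zero> \<Longrightarrow> (\<Oplus>j\<in>I. a j \<otimes> \<phi> j) = \<zero>"
  proof -
    have "\<exists>\<phi> \<in> I \<rightarrow> K. \<phi> j0 = \<one> \<and> (\<forall>a \<in> I \<rightarrow> K. (\<Oplus>j\<in>I. a j \<otimes> c j) = \<zero> \<longrightarrow> (\<Oplus>j\<in>I. a j \<otimes> \<phi> j) = \<zero>)"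
      unfolding I_def using insert by (intro insert.IH) auto
    then show thesis using that by blast
  qed
  have \<phi>K: "\<phi> i \<in> K" "\<phi> i \<in> carrier R" if "i \<in> I" for i using \<phi>(1) that Kc by auto
  have j0j: "j0 \<noteq> j" using I by auto
  show ?case
  proof (cases "\<exists>b\<in>I \<rightarrow> K. c j = (\<Oplus>i\<in>I. b i \<otimes> c i)")
    case True
    then obtain b where b: "b \<in> I \<rightarrow> K" "c j = (\<Oplus>i\<in>I. b i \<otimes> c i)" by blast
    have bK: "b i \<in> K" "b i \<in> carrier R" if "i \<in> I" for i using b(1) that Kc by auto
    \<comment> \<open>The new vector lies in the span of the others, so its value is forced by any
      expression for it.\<close>
    define v where "v = (\<Oplus>i\<in>I. b i \<otimes> \<phi> i)"
    have vK: "v \<in> K" unfolding v_def by (rule finsum_subring[OF Ks(1) I(1)]) (use bK \<phi>K Ks(6) in auto)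
    define \<phi>' where "\<phi>' = \<phi>(j := v)"
    have main: "(\<Oplus>i\<in>insert j I. a i \<otimes> \<phi>' i) = \<zero>"
      if a: "a \<in> insert j I \<rightarrow> K" and z: "(\<Oplus>i\<in>insert j I. a i \<otimes> c i) = \<zero>" for a
    proof -
      have aK: "a i \<in> K" "a i \<in> carrier R" if "i \<in> insert j I" for i using a that Kc by auto
      have gen: "a j \<otimes> (\<Oplus>i\<in>I. b i \<otimes> u i) \<oplus> (\<Oplus>i\<in>I. a i \<otimes> u i) = (\<Oplus>i\<in>I. (a j \<otimes> b i \<oplus> a i) \<otimes> u i)"
        if u: "\<And>i. i \<in> I \<Longrightarrow> u i \<in> carrier R" for u
      proof -
        have "a j \<otimes> (\<Oplus>i\<in>I. b i \<otimes> u i) = (\<Oplus>i\<in>I. a j \<otimes> (b i \<otimes> u i))"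
          using I aK bK u by (intro finsum_rdistr) auto
        then have "a j \<otimes> (\<Oplus>i\<in>I. b i \<otimes> u i) \<oplus> (\<Oplus>i\<in>I. a i \<otimes> u i) = (\<Oplus>i\<in>I. a j \<otimes> (b i \<otimes> u i) \<oplus> a i \<otimes> u i)"
          using I aK bK u by (simp add: finsum_addf Pi_def)
        also have "\<dots> = (\<Oplus>i\<in>I. (a j \<otimes> b i \<oplus> a i) \<otimes> u i)"
          using aK bK u by (intro finsum_cong') (auto simp: l_distr m_assoc)
        finally show ?thesis .
      qed
      have "(\<Oplus>i\<in>insert j I. a i \<otimes> c i) = a j \<otimes> c j \<oplus> (\<Oplus>i\<in>I. a i \<otimes> c i)"
        using I aK cc by (intro finsum_insert) auto
      also have "\<dots> = (\<Oplus>i\<in>I. (a j \<otimes> b i \<oplus> a i) \<otimes> c i)" unfolding b(2) by (rule gen) (use cc in auto)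
      finally have "(\<Oplus>i\<in>I. (a j \<otimes> b i \<oplus> a i) \<otimes> c i) = \<zero>" using z by simp
      then have "(\<Oplus>i\<in>I. (a j \<otimes> b i \<oplus> a i) \<otimes> \<phi> i) = \<zero>"
        by (rule \<phi>a[rotated]) (use aK bK Ks(6,7) in auto)
      then have s: "a j \<otimes> v \<oplus> (\<Oplus>i\<in>I. a i \<otimes> \<phi> i) = \<zero>" unfolding v_def using gen[of \<phi>] \<phi>K by simp
      have "(\<Oplus>i\<in>insert j I. a i \<otimes> \<phi>' i) = a j \<otimes> \<phi>' j \<oplus> (\<Oplus>i\<in>I. a i \<otimes> \<phi>' i)"
        using I aK \<phi>K vK Kc by (intro finsum_insert) (auto simp: \<phi>'_def)
      also have "(\<Oplus>i\<in>I. a i \<otimes> \<phi>' i) = (\<Oplus>i\<in>I. a i \<otimes> \<phi> i)"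
        using I aK \<phi>K by (intro finsum_cong') (auto simp: \<phi>'_def)
      finally show ?thesis using s by (simp add: \<phi>'_def)
    qed
    have "\<phi>' \<in> insert j I \<rightarrow> K" "\<phi>' j0 = \<one>" using \<phi>K \<phi>(2) vK j0j by (auto simp: \<phi>'_def)
    then show ?thesis unfolding I(3) using main by blast
  next
    case False
    \<comment> \<open>The new vector is outside the span and occurs in no relation with nonzero
      coefficient, so its value is free; zero is chosen.\<close>
    define \<phi>' where "\<phi>' = \<phi>(j := \<zero>)"
    have main: "(\<Oplus>i\<in>insert j I. a i \<otimes> \<phi>' i) = \<zero>"
      if a: "a \<in> insert j I \<rightarrow> K" and z: "(\<Oplus>i\<in>insert j I. a i \<otimes> c i) = \<zero>" for a
    proof -
      have aK: "a i \<in> K" "a i \<in> carrier R" if "i \<in> insert j I" for i using a that Kc by auto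
      define s where "s = (\<Oplus>i\<in>I. a i \<otimes> c i)"
      have sc: "s \<in> carrier R" using aK cc by (auto simp: s_def)
      have e: "a j \<otimes> c j \<oplus> s = \<zero>"
        using z I aK cc unfolding s_def by (subst (asm) finsum_insert) auto
      have aj: "a j = \<zero>"
      proof (rule ccontr)
        assume nz: "a j \<noteq> \<zero>"
        define p where "p = \<ominus> (inv (a j))"
        have p: "p \<in> K" "p \<in> carrier R" using nz aK[of j] Ks(5,8) Kc by (auto simp: p_def)
        have "\<ominus> s = a j \<otimes> c j" using e sc aK[of j] cc[of j] by (metis a_comm insertI1 m_closed minus_equality)
        then have "inv (a j) \<otimes> (\<ominus> s) = c j" using nz aK[of j] cc[of j] by (simp add: m_assoc[symmetric])
        then have "c j = p \<otimes> s" using nz aK[of j] sc by (simp add: p_def l_minus r_minus)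
        also have "\<dots> = (\<Oplus>i\<in>I. p \<otimes> (a i \<otimes> c i))" unfolding s_def using I p aK cc by (intro finsum_rdistr) auto
        also have "\<dots> = (\<Oplus>i\<in>I. (p \<otimes> a i) \<otimes> c i)" using p aK cc by (intro finsum_cong') (auto simp: m_assoc)
        finally have "c j = (\<Oplus>i\<in>I. (p \<otimes> a i) \<otimes> c i)" .
        moreover have "(\<lambda>i. p \<otimes> a i) \<in> I \<rightarrow> K" using p aK Ks(6) by auto
        ultimately have "\<exists>b\<in>I \<rightarrow> K. c j = (\<Oplus>i\<in>I. b i \<otimes> c i)" by (intro bexI[of _ "\<lambda>i. p \<otimes> a i"])
        then show False using False by blast
      qed
      then have "s = \<zero>" using e sc cc[of j] by simp
      then have z': "(\<Oplus>i\<in>I. a i \<otimes> \<phi> i) = \<zero>" unfolding s_def by (rule \<phi>a[rotated]) (use aK in auto)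
      have "(\<Oplus>i\<in>insert j I. a i \<otimes> \<phi>' i) = a j \<otimes> \<phi>' j \<oplus> (\<Oplus>i\<in>I. a i \<otimes> \<phi>' i)"
        using I aK \<phi>K by (intro finsum_insert) (auto simp: \<phi>'_def)
      also have "(\<Oplus>i\<in>I. a i \<otimes> \<phi>' i) = (\<Oplus>i\<in>I. a i \<otimes> \<phi> i)"
        using I aK \<phi>K by (intro finsum_cong') (auto simp: \<phi>'_def)
      finally show ?thesis using z' aj by (simp add: \<phi>'_def)
    qed
    have "\<phi>' \<in> insert j I \<rightarrow> K" "\<phi>' j0 = \<one>" using \<phi>K \<phi>(2) Ks(3) j0j by (auto simp: \<phi>'_def)
    then show ?thesis unfolding I(3) using main by blast
  qed
qed

lemma (in divring) functional_exists:
  assumes "subdivring K R" "finite J" "\<And>j. j \<in> J \<Longrightarrow> c j \<in> carrier R" "j0 \<in> J" "c j0 \<noteq> \<zero>"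
  shows "\<exists>\<phi> \<in> J \<rightarrow> K. \<phi> j0 = \<one> \<and> (\<forall>a \<in> J \<rightarrow> K. (\<Oplus>j\<in>J. a j \<otimes> c j) = \<zero> \<longrightarrow> (\<Oplus>j\<in>J. a j \<otimes> \<phi> j) = \<zero>)"
  using functional_exists_insert[OF assms(1), of "J - {j0}" j0 c] assms by (simp add: insert_absorb)

lemma (in divring) gen_divring_subdivring:
  assumes "Y \<subseteq> carrier R" shows "subdivring (gen_divring R Y) R"
proof -
  have ne: "{K. subdivring K R \<and> Y \<subseteq> K} \<noteq> {}"
    using assms carrier_is_subring subdivringI[of "carrier R"] by auto
  have "subring (gen_divring R Y) R" unfolding gen_divring_def
    by (rule subring_Inter[OF _ ne]) (auto simp: subdivring_def)
  then show ?thesis by (rule subdivringI) (auto simp: gen_divring_def subdivring_def)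
qed

section \<open>Passage between subfields of the Laurent series and of the twisted series\<close>

context tower_limit
begin

definition "pull D = {f \<in> carrier Z. \<eta> f \<in> D}"

lemma \<eta>_facts:
  shows "f \<in> carrier Z \<Longrightarrow> \<eta> f \<in> carrier LL"
    "f \<in> carrier Z \<Longrightarrow> g \<in> carrier Z \<Longrightarrow> \<eta> (f \<otimes>\<^bsub>S\<^esub> g) = \<eta> f \<otimes>\<^bsub>LL\<^esub> \<eta> g"
    "\<eta> (f \<oplus>\<^bsub>S\<^esub> g) = \<eta> f \<oplus>\<^bsub>LL\<^esub> \<eta> g" "\<eta> \<one>\<^bsub>S\<^esub> = \<one>\<^bsub>LL\<^esub>" "\<eta> \<zero>\<^bsub>S\<^esub> = \<zero>\<^bsub>LL\<^esub>"
    "inj_on \<eta> (carrier Z)" "\<eta> ` carrier Z = carrier LL"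
  using ring_iso_memE[OF \<eta>_iso] by (auto simp: Z_mult \<eta>_def LL_simps fun_eq_iff bij_betw_def)

lemma Z_closed:
  shows "f \<in> carrier Z \<Longrightarrow> g \<in> carrier Z \<Longrightarrow> f \<otimes>\<^bsub>S\<^esub> g \<in> carrier Z"
    "f \<in> carrier Z \<Longrightarrow> g \<in> carrier Z \<Longrightarrow> f \<oplus>\<^bsub>S\<^esub> g \<in> carrier Z"
    "\<one>\<^bsub>S\<^esub> \<in> carrier Z" "\<zero>\<^bsub>S\<^esub> \<in> carrier Z"
    "f \<in> carrier Z \<Longrightarrow> \<ominus>\<^bsub>S\<^esub> f \<in> carrier Z"
    "f \<in> carrier Z \<Longrightarrow> f \<noteq> \<zero>\<^bsub>S\<^esub> \<Longrightarrow> inv\<^bsub>S\<^esub> f \<in> carrier Z"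
proof -
  assume "f \<in> carrier Z" "g \<in> carrier Z"
  then show "f \<otimes>\<^bsub>S\<^esub> g \<in> carrier Z" using Zs.S_mult_closed Z_mult by simp
next
  assume "f \<in> carrier Z" "g \<in> carrier Z"
  then show "f \<oplus>\<^bsub>S\<^esub> g \<in> carrier Z" using Zs.S_add_closed by simp
next
  show "\<one>\<^bsub>S\<^esub> \<in> carrier Z" "\<zero>\<^bsub>S\<^esub> \<in> carrier Z" using Zs.S.one_closed Zs.S.zero_closed by simp_all
next
  assume "f \<in> carrier Z"
  then show "\<ominus>\<^bsub>S\<^esub> f \<in> carrier Z" using Z_neg Zs.S.a_inv_closed by simp
next
  assume "f \<in> carrier Z" "f \<noteq> \<zero>\<^bsub>S\<^esub>"
  then show "inv\<^bsub>S\<^esub> f \<in> carrier Z" using Z_inv by simp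
qed

lemma \<eta>_neg: assumes f: "f \<in> carrier Z" shows "\<eta> (\<ominus>\<^bsub>S\<^esub> f) = \<ominus>\<^bsub>LL\<^esub> \<eta> f"
proof -
  interpret LLr: ring LL by (rule LL_ring)
  have "\<ominus>\<^bsub>S\<^esub> f \<oplus>\<^bsub>S\<^esub> f = \<zero>\<^bsub>S\<^esub>" by (rule S.l_neg[OF Z_sub[OF f]])
  then have "\<eta> (\<ominus>\<^bsub>S\<^esub> f) \<oplus>\<^bsub>LL\<^esub> \<eta> f = \<zero>\<^bsub>LL\<^esub>" using \<eta>_facts(3)[of "\<ominus>\<^bsub>S\<^esub> f" f] \<eta>_facts(5) by metis
  from LLr.minus_equality[OF this \<eta>_facts(1)[OF f] \<eta>_facts(1)[OF Z_closed(5)[OF f]]] show ?thesis by simp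
qed

lemma \<eta>_inv: assumes f: "f \<in> carrier Z" "f \<noteq> \<zero>\<^bsub>S\<^esub>" shows "\<eta> (inv\<^bsub>S\<^esub> f) = inv\<^bsub>LL\<^esub> \<eta> f"
proof -
  interpret LLr: divring LL by (rule LL_divring)
  interpret Sd: divring S by (rule S_divring)
  have "f \<otimes>\<^bsub>S\<^esub> inv\<^bsub>S\<^esub> f = \<one>\<^bsub>S\<^esub>" by (rule Sd.inv_nz(3)[OF Z_sub[OF f(1)] f(2)])
  then have "\<eta> f \<otimes>\<^bsub>LL\<^esub> \<eta> (inv\<^bsub>S\<^esub> f) = \<one>\<^bsub>LL\<^esub>"
    using \<eta>_facts(2)[OF f(1) Z_closed(6)[OF f]] \<eta>_facts(4) by metis
  from LLr.inv_unique_nz[OF \<eta>_facts(1)[OF f(1)] \<eta>_facts(1)[OF Z_closed(6)[OF f]] this] show ?thesis by simp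
qed

lemma \<eta>_zero_iff: "f \<in> carrier Z \<Longrightarrow> \<eta> f = \<zero>\<^bsub>LL\<^esub> \<longleftrightarrow> f = \<zero>\<^bsub>S\<^esub>"
  using \<eta>_facts(5,6) Z_closed(4) by (metis inj_onD)

lemma pull_subdivring: assumes D: "subdivring D LL" shows "subdivring (pull D) S"
proof -
  note Ds = subdivringE[OF D]
  interpret Sd: divring S by (rule S_divring)
  show ?thesis
  proof (rule Sd.subdivringI)
    show "subring (pull D) S"
    proof (rule S.subringI)
      show "pull D \<subseteq> carrier S" using Z_sub by (auto simp: pull_def)
      show "\<one>\<^bsub>S\<^esub> \<in> pull D" using Ds(4) \<eta>_facts(4) Z_closed(3) by (simp add: pull_def del: tseries_simps)
      fix f assume f: "f \<in> pull D"
      then have f1: "f \<in> carrier Z" "\<eta> f \<in> D" by (auto simp: pull_def)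
      show "\<ominus>\<^bsub>S\<^esub> f \<in> pull D" using f1 Z_closed(5) Ds(5) \<eta>_neg by (simp add: pull_def)
      fix g assume g: "g \<in> pull D"
      then have g1: "g \<in> carrier Z" "\<eta> g \<in> D" by (auto simp: pull_def)
      show "f \<otimes>\<^bsub>S\<^esub> g \<in> pull D" using f1 g1 Z_closed(1) Ds(6) \<eta>_facts(2) by (simp add: pull_def)
      show "f \<oplus>\<^bsub>S\<^esub> g \<in> pull D" using f1 g1 Z_closed(2) Ds(7) \<eta>_facts(3)[of f g] by (simp add: pull_def del: tseries_simps)
    qed
    fix f assume f: "f \<in> pull D" "f \<noteq> \<zero>\<^bsub>S\<^esub>"
    then have f1: "f \<in> carrier Z" "\<eta> f \<in> D" by (auto simp: pull_def)
    have "\<eta> f \<noteq> \<zero>\<^bsub>LL\<^esub>" using \<eta>_zero_iff[OF f1(1)] f(2) by simp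
    then have "inv\<^bsub>LL\<^esub> \<eta> f \<in> D" using Ds(8) f1 by simp
    then show "inv\<^bsub>S\<^esub> f \<in> pull D" using f1 f(2) Z_closed(6) \<eta>_inv by (simp add: pull_def)
  qed
qed

text \<open>Allows the minimality of \<open>kk(T)\<close>, a statement about subfields of
  \<open>LL\<close>, to be used for subfields of \<open>S\<close>.\<close>

lemma push_subdivring: assumes D: "subdivring D S" shows "subdivring (\<eta> ` (carrier Z \<inter> D)) LL"
proof -
  note Ds = subdivringE[OF D]
  interpret LLr: divring LL by (rule LL_divring)
  show ?thesis
  proof (rule LLr.subdivringI)
    show "subring (\<eta> ` (carrier Z \<inter> D)) LL"
    proof (rule LLr.subringI)
      show "\<eta> ` (carrier Z \<inter> D) \<subseteq> carrier LL" using \<eta>_facts(1) by auto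
      show "\<one>\<^bsub>LL\<^esub> \<in> \<eta> ` (carrier Z \<inter> D)" 
        by (rule image_eqI[of _ \<eta> "\<one>\<^bsub>S\<^esub>", OF \<eta>_facts(4)[symmetric]]) (use Ds(4) Z_closed(3) in \<open>simp del: tseries_simps\<close>)
      fix x assume "x \<in> \<eta> ` (carrier Z \<inter> D)"
      then obtain f where f: "f \<in> carrier Z" "f \<in> D" "x = \<eta> f" by auto
      show "\<ominus>\<^bsub>LL\<^esub> x \<in> \<eta> ` (carrier Z \<inter> D)" 
        unfolding f(3) by (rule image_eqI[of _ \<eta>, OF \<eta>_neg[OF f(1), symmetric]]) (use f Ds(5) Z_closed(5) in simp)
      fix y assume "y \<in> \<eta> ` (carrier Z \<inter> D)"
      then obtain g where g: "g \<in> carrier Z" "g \<in> D" "y = \<eta> g" by auto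
      show "x \<otimes>\<^bsub>LL\<^esub> y \<in> \<eta> ` (carrier Z \<inter> D)" 
        unfolding f(3) g(3)
        by (rule image_eqI[of _ \<eta>, OF \<eta>_facts(2)[OF f(1) g(1), symmetric]]) (use f g Ds(6) Z_closed(1) in simp)
      show "x \<oplus>\<^bsub>LL\<^esub> y \<in> \<eta> ` (carrier Z \<inter> D)" 
        unfolding f(3) g(3)
        by (rule image_eqI[of _ \<eta>, OF \<eta>_facts(3)[symmetric]]) (use f g Ds(7) Z_closed(2) in \<open>simp del: tseries_simps\<close>)
    qed
    fix x assume x: "x \<in> \<eta> ` (carrier Z \<inter> D)" "x \<noteq> \<zero>\<^bsub>LL\<^esub>"
    then obtain f where f: "f \<in> carrier Z" "f \<in> D" "x = \<eta> f" by auto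
    then have nz: "f \<noteq> \<zero>\<^bsub>S\<^esub>" using x(2) \<eta>_zero_iff[OF f(1)] by simp
    show "inv\<^bsub>LL\<^esub> x \<in> \<eta> ` (carrier Z \<inter> D)" unfolding f(3)
      by (rule image_eqI[of _ \<eta>, OF \<eta>_inv[OF f(1) nz, symmetric]]) (use f nz Ds(8) Z_closed(6) in simp)
  qed
qed

abbreviation "kt \<equiv> rat_funs h kk"
definition "F0 = pull kt"

lemma gens_carrier:
  "(\<lambda>c i. if i = 0 then c else \<zero>) ` kk \<union> {\<lambda>i. if i = 1 then \<one> else \<zero>} \<subseteq> carrier LL"
  using subdivringE(3,4)[OF kk] unfolding LL_carrier
  by (auto simp: LL_carrier intro: exI[of _ 0])

lemma kt_subdivring: "subdivring kt LL"
  unfolding rat_funs_def by (rule divring.gen_divring_subdivring[OF LL_divring gens_carrier])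

lemma gens_kt: "(\<lambda>c i. if i = 0 then c else \<zero>) ` kk \<union> {\<lambda>i. if i = 1 then \<one> else \<zero>} \<subseteq> kt"
  unfolding rat_funs_def gen_divring_def by blast

lemma kt_least: "subdivring D LL \<Longrightarrow> (\<lambda>c i. if i = 0 then c else \<zero>) ` kk \<union> {\<lambda>i. if i = 1 then \<one> else \<zero>} \<subseteq> D \<Longrightarrow> kt \<subseteq> D"
  unfolding rat_funs_def gen_divring_def by blast

lemma F0_subdivring: "subdivring F0 S"
  unfolding F0_def by (rule pull_subdivring[OF kt_subdivring])

lemma monom_Z: "c \<in> kk \<Longrightarrow> s \<in> \<int> \<Longrightarrow> monom_at c s \<in> carrier Z"
  using Zs.monom_closed[of c s] by (simp add: Zs.monom_at_def monom_at_def)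

lemma \<eta>_monom: "\<eta> (monom_at c (of_int j)) = (\<lambda>i. if i = j then c else \<zero>)"
  by (auto simp: \<eta>_def monom_at_def)

lemma monom_F0: assumes c: "c \<in> kk" shows "monom_at c (of_int j) \<in> F0"
proof -
  note Fs = subdivringE[OF F0_subdivring]
  note ks = subdivringE[OF kk]
  interpret Sd: divring S by (rule S_divring)
  have const: "monom_at c 0 \<in> F0" if "c \<in> kk" for c
    using gens_kt that monom_Z[OF that, of 0] \<eta>_monom[of c 0] by (auto simp: F0_def pull_def)
  have t: "monom_at \<one> 1 \<in> F0"
    using gens_kt monom_Z[OF ks(4), of 1] \<eta>_monom[of \<one> 1] by (auto simp: F0_def pull_def)
  have prod: "monom_at a s \<otimes>\<^bsub>S\<^esub> monom_at b u = monom_at (a \<otimes> b) (s + u)"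
    if "a \<in> kk" "b \<in> kk" "s \<in> \<int>" "u \<in> \<int>" for a b s u
  proof
    fix x
    have ac: "a \<in> carrier h" "b \<in> carrier h" using that ks(2) by auto
    have 1: "\<tau> s (monom_at b u (x - s)) = monom_at b u (x - s)"
      using \<tau>_props(7)[of _ s] that ks(3) by (simp add: monom_at_def)
    show "(monom_at a s \<otimes>\<^bsub>S\<^esub> monom_at b u) x = monom_at (a \<otimes> b) (s + u) x"
      unfolding monom_mult[OF ac(1) Ints_\<Gamma>[OF that(3)] monom_closed[OF ac(2) Ints_\<Gamma>[OF that(4)]]] 1
      using ac by (auto simp: monom_at_def)
  qed
  have one: "monom_at \<one> 0 = \<one>\<^bsub>S\<^esub>" by (auto simp: monom_at_def)
  have ti: "monom_at \<one> (- 1) \<in> F0"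
  proof -
    have "monom_at \<one> 1 \<otimes>\<^bsub>S\<^esub> monom_at \<one> (- 1) = \<one>\<^bsub>S\<^esub>" using prod[OF ks(4) ks(4), of 1 "-1"] one by (simp del: tseries_simps)
    moreover have "monom_at \<one> 1 \<in> carrier S" "monom_at \<one> (- 1) \<in> carrier S"
      using Z_sub[OF monom_Z[OF ks(4)]] by auto
    ultimately have "inv\<^bsub>S\<^esub> monom_at \<one> 1 = monom_at \<one> (- 1)" by (intro Sd.inv_unique_nz)
    moreover have "monom_at \<one> 1 \<noteq> \<zero>\<^bsub>S\<^esub>"
    proof
      assume "monom_at \<one> 1 = \<zero>\<^bsub>S\<^esub>"
      from fun_cong[OF this, of 1] show False by (simp add: monom_at_def)
    qed
    ultimately show ?thesis using Fs(8)[OF t] by simp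
  qed
  have pos: "monom_at \<one> (of_nat n) \<in> F0" and neg: "monom_at \<one> (- of_nat n) \<in> F0" for n
  proof (induction n)
    case 0
    show "monom_at \<one> (of_nat 0) \<in> F0" "monom_at \<one> (- of_nat 0) \<in> F0" using const[OF ks(4)] by simp_all
  next
    case (Suc n)
    show "monom_at \<one> (of_nat (Suc n)) \<in> F0" "monom_at \<one> (- of_nat (Suc n)) \<in> F0"
      using Fs(6)[OF t Suc(1)] Fs(6)[OF ti Suc(2)] prod[OF ks(4) ks(4), of 1 "of_nat n"] prod[OF ks(4) ks(4), of "-1" "- of_nat n"]
      by simp_all
  qed
  have "monom_at \<one> (of_int j) \<in> F0"
  proof (cases "0 \<le> j")
    case True then show ?thesis using pos[of "nat j"] by simp
  next
    case False then show ?thesis using neg[of "nat (- j)"] by simp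
  qed
  from Fs(6)[OF const[OF c] this] show ?thesis using prod[OF c ks(4), of 0 "of_int j"] c ks(2) by auto
qed

text \<open>Laurent polynomials over \<open>kk\<close> are rational functions; the support is
  removed one monomial at a time.\<close>

lemma finite_support_F0:
  assumes "finite A" "f \<in> carrier Z" "\<And>s. f s \<noteq> \<zero> \<Longrightarrow> s \<in> A"
  shows "f \<in> F0"
  using assms
proof (induction A arbitrary: f rule: finite_induct)
  case empty
  then have "f s = \<zero>" for s by blast
  then have "f = \<zero>\<^bsub>S\<^esub>" by auto
  then show ?case using subdivringE(3)[OF F0_subdivring] by simp
next
  case (insert a A)
  note Fs = subdivringE[OF F0_subdivring]
  have fc: "f s \<in> carrier h" for s using Zs.Sc[OF insert.prems(1)] .
  show ?case
  proof (cases "f a = \<zero>")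
    case True
    have "s \<in> A" if "f s \<noteq> \<zero>" for s using insert.prems(2)[OF that] that True by auto
    then show ?thesis using insert.IH[of f] insert.prems(1) by simp
  next
    case False
    then have "a \<in> \<int>" using Zs.S\<Gamma>[OF insert.prems(1)] by simp
    then obtain j where j: "a = of_int j" by (auto elim: Ints_cases)
    define g where "g = f(a := \<zero>)"
    have "{s. g s \<noteq> \<zero> \<and> s \<le> x} \<subseteq> {s. f s \<noteq> \<zero> \<and> s \<le> x}" for x by (auto simp: g_def)
    then have "finite {s. g s \<noteq> \<zero> \<and> s \<le> x}" for x using Zs.Sfin[OF insert.prems(1)] finite_subset by blast
    then have gZ: "g \<in> carrier Z" using Zs.SK[OF insert.prems(1)] Zs.S\<Gamma>[OF insert.prems(1)] subdivringE(3)[OF kk]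
      by (auto simp: tseries_carrier g_def)
    have "s \<in> A" if "g s \<noteq> \<zero>" for s using that insert.prems(2)[of s] by (auto simp: g_def split: if_splits)
    then have "g \<in> F0" using insert.IH[OF gZ] by blast
    moreover have "monom_at (f a) a \<in> F0" using monom_F0[OF Zs.SK[OF insert.prems(1)]] j by simp
    ultimately have "monom_at (f a) a \<oplus>\<^bsub>S\<^esub> g \<in> F0" using Fs(7) by simp
    moreover have "monom_at (f a) a \<oplus>\<^bsub>S\<^esub> g = f" using fc by (auto simp: monom_at_def g_def)
    ultimately show ?thesis by (simp del: tseries_simps)
  qed
qed

lemma S_finsum_apply:
  assumes "finite B" "\<And>b. b \<in> B \<Longrightarrow> f b \<in> carrier S"
  shows "(\<Oplus>\<^bsub>S\<^esub>b\<in>B. f b) t = (\<Oplus>b\<in>B. f b t)"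
  by (rule S.finsum_additive[OF ring_axioms assms(1), of f "carrier S" "\<lambda>g. g t"])
     (use assms(2) S_add_closed S.zero_closed in auto)

text \<open>Any \<open>kk\<close>-linear functional on the coefficients that does not kill a given coefficient turns
  a relation over skew polynomials into a relation over \<open>kk[t]\<close>.\<close>

lemma polynomial_relation_descends:
  assumes B: "finite B" "B \<subseteq> carrier Z" and q: "\<And>b. b \<in> B \<Longrightarrow> q b \<in> carrier (Rn n)"
    and rel: "(\<Oplus>\<^bsub>S\<^esub>b\<in>B. \<iota> n (q b) \<otimes>\<^bsub>S\<^esub> b) = \<zero>\<^bsub>S\<^esub>"
    and b0: "b0 \<in> B" "q b0 i0 \<noteq> \<zero>"
  shows "\<not> lin_indep S F0 B"
proof -
  have bZ: "b \<in> carrier Z" and bS: "b \<in> carrier S" if "b \<in> B" for b using B(2) that Z_sub by auto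
  have bkk: "b s \<in> kk" "b s \<in> carrier h" if "b \<in> B" for b s using Zs.SK[OF bZ[OF that]] subdivringE(2)[OF kk] by auto
  have "\<exists>N. \<forall>b\<in>B. \<forall>i\<ge>N. q b i = \<zero>"
  proof -
    have "\<forall>b\<in>B. \<exists>N. \<forall>i\<ge>N. q b i = \<zero>" using q by (auto simp: skewpoly_carrier)
    then obtain Nf where Nf: "\<And>b i. b \<in> B \<Longrightarrow> i \<ge> Nf b \<Longrightarrow> q b i = \<zero>" by metis
    have "q b i = \<zero>" if "b \<in> B" "i \<ge> Max (Nf ` B)" for b i
      using Nf[OF that(1)] that Max_ge[of "Nf ` B" "Nf b"] B(1) by (meson finite_imageI image_eqI le_trans)
    then show ?thesis by blast
  qed
  then obtain N where N: "\<And>b i. b \<in> B \<Longrightarrow> i \<ge> N \<Longrightarrow> q b i = \<zero>" by blast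
  have qc: "q b i \<in> carrier h" if "b \<in> B" for b i using q[OF that] by simp
  let ?g = "\<lambda>i::nat. (of_nat i :: rat) / lr n"
  let ?J = "B \<times> {..<N}"
  have i0N: "i0 < N" using N[OF b0(1), of i0] b0(2) by (meson not_less)
  \<comment> \<open>The coefficient of the relation at each exponent \<open>t\<close>, flattened
    over pairs of a basis element and a degree. As \<open>kk\<close> is central and fixed by the
    twist, it is a left \<open>kk\<close>-linear relation among the fixed coefficients
    \<open>q b i\<close>.\<close>
  have rel_t: "(\<Oplus>x\<in>?J. fst x (t - ?g (snd x)) \<otimes> q (fst x) (snd x)) = \<zero>" for t
  proof -
    have coef: "(\<iota> n (q b) \<otimes>\<^bsub>S\<^esub> b) t = (\<Oplus>i\<in>{..<N}. b (t - ?g i) \<otimes> q b i)" if b: "b \<in> B" for b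
    proof -
      have "(\<iota> n (q b) \<otimes>\<^bsub>S\<^esub> b) t = (\<Oplus>s\<in>?g ` {..<N}. \<iota> n (q b) s \<otimes> \<tau> s (b (t - s)))"
      proof (rule mult_eq[OF \<iota>_closed[OF q[OF b]] bS[OF b]])
        fix s assume "\<iota> n (q b) s \<noteq> \<zero>"
        then obtain i where i: "s = ?g i" "q b i \<noteq> \<zero>" by (rule \<iota>_support)
        then have "i < N" using N[OF b] by (meson not_less)
        then show "s \<in> ?g ` {..<N}" using i by auto
      qed auto
      also have "\<dots> = (\<Oplus>i\<in>{..<N}. \<iota> n (q b) (?g i) \<otimes> \<tau> (?g i) (b (t - ?g i)))"
        using \<iota>_closed[OF q[OF b]] bS[OF b] by (intro finsum_reindex) (auto simp: inj_on_def)
      also have "\<dots> = (\<Oplus>i\<in>{..<N}. b (t - ?g i) \<otimes> q b i)"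
      proof (rule finsum_cong')
        fix i
        have "\<tau> (?g i) (b (t - ?g i)) = b (t - ?g i)" by (rule \<tau>_props(7)[OF bkk(1)[OF b]])
        then show "\<iota> n (q b) (?g i) \<otimes> \<tau> (?g i) (b (t - ?g i)) = b (t - ?g i) \<otimes> q b i"
          using kk_central[OF bkk(1)[OF b] qc[OF b]] by (simp add: \<iota>_grid)
      qed (use bkk[OF b] qc[OF b] in auto)
      finally show ?thesis .
    qed
    have "(\<Oplus>\<^bsub>S\<^esub>b\<in>B. \<iota> n (q b) \<otimes>\<^bsub>S\<^esub> b) t = (\<Oplus>b\<in>B. (\<iota> n (q b) \<otimes>\<^bsub>S\<^esub> b) t)"
      by (rule S_finsum_apply[OF B(1)]) (use \<iota>_closed[OF q] bS in auto)
    also have "\<dots> = (\<Oplus>b\<in>B. \<Oplus>i\<in>{..<N}. b (t - ?g i) \<otimes> q b i)"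
      using coef bkk qc by (intro finsum_cong') auto
    also have "\<dots> = (\<Oplus>x\<in>?J. fst x (t - ?g (snd x)) \<otimes> q (fst x) (snd x))"
      using B(1) bkk qc by (intro finsum_product) auto
    finally show ?thesis using rel by simp
  qed
  \<comment> \<open>One functional, normalised at the given nonzero coefficient, handles the
    relations for all \<open>t\<close> at once.\<close>
  have "\<exists>\<phi> \<in> ?J \<rightarrow> kk. \<phi> (b0, i0) = \<one> \<and> (\<forall>a \<in> ?J \<rightarrow> kk. (\<Oplus>x\<in>?J. a x \<otimes> q (fst x) (snd x)) = \<zero> \<longrightarrow>
      (\<Oplus>x\<in>?J. a x \<otimes> \<phi> x) = \<zero>)"
    using functional_exists[OF kk, of ?J "\<lambda>x. q (fst x) (snd x)" "(b0, i0)"] B(1) qc b0 i0N by auto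
  then obtain \<phi> where \<phi>: "\<phi> \<in> ?J \<rightarrow> kk" "\<phi> (b0, i0) = \<one>"
    and \<phi>a: "\<And>a. a \<in> ?J \<rightarrow> kk \<Longrightarrow> (\<Oplus>x\<in>?J. a x \<otimes> q (fst x) (snd x)) = \<zero> \<Longrightarrow> (\<Oplus>x\<in>?J. a x \<otimes> \<phi> x) = \<zero>" by blast
  have \<phi>k: "\<phi> (b, i) \<in> kk" "\<phi> (b, i) \<in> carrier h" if "b \<in> B" "i < N" for b i
    using \<phi>(1) that subdivringE(2)[OF kk] by auto
  have rel2: "(\<Oplus>b\<in>B. \<Oplus>i\<in>{..<N}. b (t - ?g i) \<otimes> \<phi> (b, i)) = \<zero>" for t
  proof -
    have "(\<Oplus>x\<in>?J. fst x (t - ?g (snd x)) \<otimes> \<phi> x) = \<zero>"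
      by (rule \<phi>a[OF _ rel_t[of t]]) (use bkk in auto)
    moreover have "(\<Oplus>b\<in>B. \<Oplus>i\<in>{..<N}. b (t - ?g i) \<otimes> \<phi> (b, i)) = (\<Oplus>x\<in>?J. fst x (t - ?g (snd x)) \<otimes> \<phi> (fst x, snd x))"
      using B(1) bkk \<phi>k by (intro finsum_product) auto
    ultimately show ?thesis by simp
  qed
  \<comment> \<open>The grid of exponents is shifted so that the distinguished degree
    \<open>i0\<close> falls on exponent \<open>0\<close>, which is integral.\<close>
  let ?g' = "\<lambda>i::nat. ((of_nat i :: rat) - of_nat i0) / lr n"
  have inj': "inj_on ?g' {..<N}" by (auto simp: inj_on_def)
  have g'g: "?g' i = ?g i - ?g i0" for i by (simp add: diff_divide_distrib)
  \<comment> \<open>The image of \<open>q b\<close> under the functional, shifted and with only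
    integral exponents kept, so that it is a Laurent polynomial over \<open>kk\<close>.\<close>
  define C where "C b s = (if s \<in> \<int> \<and> s \<in> ?g' ` {..<N} then \<phi> (b, inv_into {..<N} ?g' s) else \<zero>)" for b s
  have Cg: "C b (?g' i) = (if ?g' i \<in> \<int> then \<phi> (b, i) else \<zero>)" if "i < N" for b i
    using that inv_into_f_f[OF inj', of i] unfolding C_def by auto
  have Cs: "s \<in> ?g' ` {..<N}" "s \<in> \<int>" if "C b s \<noteq> \<zero>" for b s using that by (auto simp: C_def split: if_splits)
  have CZ: "C b \<in> carrier Z" if b: "b \<in> B" for b
    unfolding tseries_carrier
  proof (intro conjI allI impI)
    show "C b s \<in> kk" for s
    proof (cases "C b s = \<zero>")
      case False
      then obtain i where "i < N" "s = ?g' i" using Cs(1) by blast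
      then show ?thesis using Cg[of i b] \<phi>k[OF b] subdivringE(3)[OF kk] by auto
    qed (use subdivringE(3)[OF kk] in simp)
    show "s \<in> \<int>" if "C b s \<noteq> \<zero>" for s using Cs(2)[OF that] .
    show "finite {s. C b s \<noteq> \<zero> \<and> s \<le> x}" for x
      by (rule finite_subset[of _ "?g' ` {..<N}"]) (use Cs(1) in auto)
  qed
  have CF: "C b \<in> F0" if "b \<in> B" for b
    by (rule finite_support_F0[OF _ CZ[OF that], of "?g' ` {..<N}"]) (use Cs(1) in auto)
  have "(\<Oplus>\<^bsub>S\<^esub>b\<in>B. C b \<otimes>\<^bsub>S\<^esub> b) = \<zero>\<^bsub>S\<^esub>"
  proof
    fix t
    have ap: "(\<Oplus>\<^bsub>S\<^esub>b\<in>B. C b \<otimes>\<^bsub>S\<^esub> b) t = (\<Oplus>b\<in>B. (C b \<otimes>\<^bsub>S\<^esub> b) t)"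
      by (rule S_finsum_apply[OF B(1)]) (use Z_sub[OF CZ] bS in auto)
    show "(\<Oplus>\<^bsub>S\<^esub>b\<in>B. C b \<otimes>\<^bsub>S\<^esub> b) t = \<zero>\<^bsub>S\<^esub> t"
    proof (cases "t \<in> \<int>")
      case True
      have "(C b \<otimes>\<^bsub>S\<^esub> b) t = (\<Oplus>i\<in>{..<N}. b (t + ?g i0 - ?g i) \<otimes> \<phi> (b, i))" if b: "b \<in> B" for b
      proof -
        have "(C b \<otimes>\<^bsub>S\<^esub> b) t = (\<Oplus>s\<in>?g' ` {..<N}. C b s \<otimes> \<tau> s (b (t - s)))"
          by (rule mult_eq[OF Z_sub[OF CZ[OF b]] bS[OF b]]) (use Cs(1) in auto)
        also have "\<dots> = (\<Oplus>i\<in>{..<N}. C b (?g' i) \<otimes> \<tau> (?g' i) (b (t - ?g' i)))"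
          using inj' Z_sub[OF CZ[OF b]] bS[OF b] by (intro finsum_reindex) auto
        also have "\<dots> = (\<Oplus>i\<in>{..<N}. b (t + ?g i0 - ?g i) \<otimes> \<phi> (b, i))"
        proof (rule finsum_cong')
          fix i assume "i \<in> {..<N}"
          then have i: "i < N" by simp
          have e: "t - ?g' i = t + ?g i0 - ?g i" by (simp add: g'g)
          have ta: "\<tau> (?g' i) (b (t - ?g' i)) = b (t - ?g' i)" by (rule \<tau>_props(7)[OF bkk(1)[OF b]])
          show "C b (?g' i) \<otimes> \<tau> (?g' i) (b (t - ?g' i)) = b (t + ?g i0 - ?g i) \<otimes> \<phi> (b, i)"
          proof (cases "?g' i \<in> \<int>")
            case True
            then have "C b (?g' i) = \<phi> (b, i)" using Cg[OF i] by simp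
            then show ?thesis unfolding ta unfolding e using kk_central[OF \<phi>k(1)[OF b i] bkk(2)[OF b]] by simp
          next
            case False
            \<comment> \<open>The discarded exponents contribute nothing at integral
              \<open>t\<close>: the difference is not integral, and \<open>b\<close> has integral
              support.\<close>
            have "t - ?g' i \<notin> \<int>" using False True Ints_diff[OF True, of "t - ?g' i"] by auto
            then have z: "b (t - ?g' i) = \<zero>" using Zs.S\<Gamma>[OF bZ[OF b]] by blast
            have "C b (?g' i) = \<zero>" using Cg[OF i] False by simp
            then show ?thesis unfolding ta unfolding e[symmetric] z using \<phi>k(2)[OF b i] by simp
          qed
        qed (use bkk[OF b] \<phi>k[OF b] in auto)
        finally show ?thesis .
      qed
      then have "(\<Oplus>b\<in>B. (C b \<otimes>\<^bsub>S\<^esub> b) t) = (\<Oplus>b\<in>B. \<Oplus>i\<in>{..<N}. b (t + ?g i0 - ?g i) \<otimes> \<phi> (b, i))"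
        using bkk \<phi>k by (intro finsum_cong') auto
      then show ?thesis using ap rel2[of "t + ?g i0"] by simp
    next
      case False
      have "(C b \<otimes>\<^bsub>S\<^esub> b) t = \<zero>" if "b \<in> B" for b
        using Zs.S\<Gamma>[OF Z_closed(1)[OF CZ[OF that] bZ[OF that]], of t] False by blast
      then have "(\<Oplus>b\<in>B. (C b \<otimes>\<^bsub>S\<^esub> b) t) = \<zero>" by (intro add.finprod_one_eqI) auto
      then show ?thesis using ap by simp
    qed
  qed
  moreover have "C b0 0 = \<one>" using Cg[OF i0N, of b0] \<phi>(2) by simp
  then have "C b0 \<noteq> \<zero>\<^bsub>S\<^esub>" by auto
  moreover have "C \<in> B \<rightarrow> F0" using CF by auto
  ultimately show ?thesis unfolding lin_indep_def using b0(1) by blast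
qed

end

section \<open>The compositum over the direct limit\<close>

text \<open>A finite power of an infinite set injects into the set, by repeated use of an injection
  of its square. Carrying the image along keeps the induction inside \<open>A\<close>.\<close>

lemma infinite_PiE_inj:
  assumes A: "infinite A" and B: "finite B"
  shows "\<exists>\<phi>. inj_on \<phi> (B \<rightarrow>\<^sub>E A) \<and> \<phi> ` (B \<rightarrow>\<^sub>E A) \<subseteq> A"
  using B
proof (induction B rule: finite_induct)
  case empty
  obtain a where "a \<in> A" using A by (metis finite.emptyI ex_in_conv)
  then show ?case by (intro exI[of _ "\<lambda>_. a"]) auto
next
  case (insert b B)
  then obtain \<phi> where \<phi>: "inj_on \<phi> (B \<rightarrow>\<^sub>E A)" "\<phi> ` (B \<rightarrow>\<^sub>E A) \<subseteq> A" by blast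
  have "|A \<times> A| \<le>o |A|" using card_of_Times_same_infinite[OF A] ordIso_iff_ordLeq by blast
  then obtain p where p: "inj_on p (A \<times> A)" "p ` (A \<times> A) \<subseteq> A" unfolding card_of_ordLeq[symmetric] by blast
  define \<phi>' where "\<phi>' f = p (f b, \<phi> (restrict f B))" for f
  have mem: "f b \<in> A" "restrict f B \<in> B \<rightarrow>\<^sub>E A" "\<phi> (restrict f B) \<in> A" if "f \<in> insert b B \<rightarrow>\<^sub>E A" for f
  proof -
    show "f b \<in> A" and r: "restrict f B \<in> B \<rightarrow>\<^sub>E A" using that by (auto simp: PiE_iff)
    then show "\<phi> (restrict f B) \<in> A" using \<phi>(2) by blast
  qed
  have "inj_on \<phi>' (insert b B \<rightarrow>\<^sub>E A)"
  proof (rule inj_onI)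
    fix f g assume f: "f \<in> insert b B \<rightarrow>\<^sub>E A" and g: "g \<in> insert b B \<rightarrow>\<^sub>E A" and e: "\<phi>' f = \<phi>' g"
    have "(f b, \<phi> (restrict f B)) = (g b, \<phi> (restrict g B))"
      using inj_onD[OF p(1) e[unfolded \<phi>'_def]] mem[OF f] mem[OF g] by auto
    then have fb: "f b = g b" and "restrict f B = restrict g B"
      using inj_onD[OF \<phi>(1)] mem[OF f] mem[OF g] by auto
    then have "f x = g x" if "x \<in> B" for x using that by (metis restrict_apply')
    then show "f = g" using fb f g by (intro PiE_ext[OF f g]) auto
  qed
  moreover have "\<phi>' ` (insert b B \<rightarrow>\<^sub>E A) \<subseteq> A" using mem p(2) by (auto simp: \<phi>'_def)
  ultimately show ?case by blast
qed

context skew_limit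
begin

lemma \<iota>_pmon: assumes c: "c \<in> hs n" shows "\<iota> n (pmon c j) = monom_at c (of_nat j / lr n)"
proof
  fix s
  show "\<iota> n (pmon c j) s = monom_at c (of_nat j / lr n) s"
  proof (cases "\<exists>i. s = of_nat i / lr n")
    case True
    then obtain i where "s = of_nat i / lr n" by blast
    then show ?thesis using \<iota>_grid[of n "pmon c j" i] by (auto simp: pmon_def monom_at_def)
  next
    case False
    then have "\<iota> n (pmon c j) s = \<zero>" using \<iota>_support[of n "pmon c j" s] by blast
    then show ?thesis using False by (auto simp: monom_at_def)
  qed
qed

lemma monom_H': "c \<in> hs n \<Longrightarrow> monom_at c (of_nat j / lr n) \<in> H'"
proof -
  assume c: "c \<in> hs n"
  have "\<Theta> (\<psi> n (pmon c j)) = monom_at c (of_nat j / lr n)"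
    using \<Theta>_\<psi>[OF pmon_closed[OF c]] \<iota>_pmon[OF c] by simp
  then show ?thesis using \<psi>_facts(1)[OF pmon_closed[OF c] pmon_closed[OF c]] unfolding H'_def by (metis image_eqI)
qed

text \<open>By minimality of \<open>kk(T)\<close> it suffices that the copy of \<open>H\<close>
  contains the constants of \<open>kk\<close> and \<open>T\<close>.\<close>

lemma F0_H': "F0 \<subseteq> H'"
proof -
  note ks = subdivringE[OF kk]
  have "kt \<subseteq> \<eta> ` (carrier Z \<inter> H')"
  proof (rule kt_least[OF push_subdivring[OF H'_subdivring]])
    have "(\<lambda>i. if i = 0 then c else \<zero>) \<in> \<eta> ` (carrier Z \<inter> H')" if c: "c \<in> kk" for c
    proof -
      have "monom_at c 0 \<in> H'" using monom_H'[of c 0 0] kkk[OF c] khs[of 0] by auto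
      moreover have "monom_at c 0 \<in> carrier Z" using monom_Z[OF c] by simp
      moreover have "\<eta> (monom_at c 0) = (\<lambda>i. if i = 0 then c else \<zero>)" using \<eta>_monom[of c 0] by simp
      ultimately show ?thesis by (metis IntI image_eqI)
    qed
    moreover have "(\<lambda>i. if i = 1 then \<one> else \<zero>) \<in> \<eta> ` (carrier Z \<inter> H')"
    proof -
      \<comment> \<open>At level \<open>0\<close>, \<open>T\<close> is the monomial of degree
        \<open>l 0\<close>.\<close>
      have "of_nat (l 0) / lr 0 = 1" using l(1)[of 0] by (simp add: lr_def)
      then have "monom_at \<one> 1 \<in> H'" using monom_H'[OF hns(2), of "l 0" 0] by metis
      moreover have "monom_at \<one> 1 \<in> carrier Z" using monom_Z[OF ks(4)] by simp
      moreover have "\<eta> (monom_at \<one> 1) = (\<lambda>i. if i = 1 then \<one> else \<zero>)" using \<eta>_monom[of \<one> 1] by simp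
      ultimately show ?thesis by (metis IntI image_eqI)
    qed
    ultimately show "(\<lambda>c i. if i = 0 then c else \<zero>) ` kk \<union> {\<lambda>i. if i = 1 then \<one> else \<zero>} \<subseteq> \<eta> ` (carrier Z \<inter> H')" by auto
  qed
  then show ?thesis using \<eta>_facts(6) unfolding F0_def pull_def inj_on_def by blast
qed

lemma common_level_P:
  assumes "finite B" "\<And>b. b \<in> B \<Longrightarrow> (u b, u' b) \<in> P"
  shows "\<exists>n q. \<forall>b\<in>B. q b \<in> carrier (Rn n) \<and> u' b = \<iota> n (q b)"
proof -
  have "\<exists>n p. p \<in> carrier (Rn n) \<and> u' b = \<iota> n p" if "b \<in> B" for b using assms(2)[OF that] by (auto simp: P_def)
  then obtain nf pf where f: "\<And>b. b \<in> B \<Longrightarrow> pf b \<in> carrier (Rn (nf b)) \<and> u' b = \<iota> (nf b) (pf b)" by metis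
  define n where "n = Max (nf ` B)"
  have "\<exists>p\<in>carrier (Rn n). u' b = \<iota> n p" if b: "b \<in> B" for b
  proof -
    have "nf b \<le> n" unfolding n_def using assms(1) b by (intro Max_ge) auto
    then show ?thesis using level_lift[of "nf b" n "pf b"] f[OF b] by metis
  qed
  then show ?thesis by metis
qed

lemma linearly_disjoint:
  assumes B: "finite B" "B \<subseteq> carrier Z" and ind: "lin_indep S F0 B"
  shows "lin_indep S H' B"
proof (rule ccontr)
  assume "\<not> lin_indep S H' B"
  then obtain a b0 where a: "a \<in> B \<rightarrow> H'" "(\<Oplus>\<^bsub>S\<^esub>b\<in>B. a b \<otimes>\<^bsub>S\<^esub> b) = \<zero>\<^bsub>S\<^esub>" and b0: "b0 \<in> B" "a b0 \<noteq> \<zero>\<^bsub>S\<^esub>"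
    unfolding lin_indep_def by blast
  have "\<exists>x\<in>carrier H. a b = \<Theta> x" if "b \<in> B" for b using a(1) that by (auto simp: H'_def)
  then obtain x where x: "\<And>b. b \<in> B \<Longrightarrow> x b \<in> carrier H" "\<And>b. b \<in> B \<Longrightarrow> a b = \<Theta> (x b)" by metis
  obtain m m' where m: "(m,m') \<in> P" "m \<noteq> \<zero>\<^bsub>H\<^esub>" "\<And>b. b \<in> B \<Longrightarrow> \<exists>u u'. (u,u') \<in> P \<and> m \<otimes>\<^bsub>H\<^esub> x b = u"
    using FP.common_denominator[OF B(1), of x] x(1) by blast
  have "\<forall>b\<in>B. \<exists>u'. (m \<otimes>\<^bsub>H\<^esub> x b, u') \<in> P" using m(3) by blast
  from bchoice[OF this] obtain u' where "\<forall>b\<in>B. (m \<otimes>\<^bsub>H\<^esub> x b, u' b) \<in> P" by (rule exE)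
  then have u: "\<And>b. b \<in> B \<Longrightarrow> (m \<otimes>\<^bsub>H\<^esub> x b, u' b) \<in> P" by (rule bspec)
  note mc = FP.P_sub[OF m(1)]
  have \<Theta>m: "\<Theta> m = m'" by (rule FP.\<Theta>_eq[OF FP.Gr_P[OF m(1)]])
  have m'nz: "m' \<noteq> \<zero>\<^bsub>S\<^esub>" using FP.P_zero[OF m(1)] m(2) by simp
  have ac: "a b \<in> carrier S" if "b \<in> B" for b using x[OF that] ring_hom_closed[OF FP.\<Theta>_hom] by simp
  have bc: "b \<in> carrier S" if "b \<in> B" for b using B(2) Z_sub that by auto
  have ma: "m' \<otimes>\<^bsub>S\<^esub> a b = u' b" if b: "b \<in> B" for b
  proof -
    have "\<Theta> (m \<otimes>\<^bsub>H\<^esub> x b) = m' \<otimes>\<^bsub>S\<^esub> a b" using ring_hom_mult[OF FP.\<Theta>_hom] mc x[OF b] \<Theta>m by simp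
    then show ?thesis using FP.\<Theta>_eq[OF FP.Gr_P[OF u[OF b]]] by simp
  qed
  obtain n q where q: "\<And>b. b \<in> B \<Longrightarrow> q b \<in> carrier (Rn n)" "\<And>b. b \<in> B \<Longrightarrow> u' b = \<iota> n (q b)"
  proof -
    have "\<exists>n q. \<forall>b\<in>B. q b \<in> carrier (Rn n) \<and> u' b = \<iota> n (q b)" by (rule common_level_P[OF B(1) u])
    then show thesis using that by blast
  qed
  have "(\<Oplus>\<^bsub>S\<^esub>b\<in>B. \<iota> n (q b) \<otimes>\<^bsub>S\<^esub> b) = (\<Oplus>\<^bsub>S\<^esub>b\<in>B. m' \<otimes>\<^bsub>S\<^esub> (a b \<otimes>\<^bsub>S\<^esub> b))"
  proof (rule S.finsum_cong')
    fix b assume b: "b \<in> B"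
    have "\<iota> n (q b) = m' \<otimes>\<^bsub>S\<^esub> a b" using ma[OF b] q(2)[OF b] by simp
    then show "\<iota> n (q b) \<otimes>\<^bsub>S\<^esub> b = m' \<otimes>\<^bsub>S\<^esub> (a b \<otimes>\<^bsub>S\<^esub> b)" using mc ac[OF b] bc[OF b] S.m_assoc by simp
  qed (use mc ac bc in auto)
  also have "\<dots> = m' \<otimes>\<^bsub>S\<^esub> (\<Oplus>\<^bsub>S\<^esub>b\<in>B. a b \<otimes>\<^bsub>S\<^esub> b)"
    using B(1) mc ac bc by (intro S.finsum_rdistr[symmetric]) auto
  also have "\<dots> = \<zero>\<^bsub>S\<^esub>" unfolding a(2) using mc by (intro S.r_null) auto
  finally have rel: "(\<Oplus>\<^bsub>S\<^esub>b\<in>B. \<iota> n (q b) \<otimes>\<^bsub>S\<^esub> b) = \<zero>\<^bsub>S\<^esub>" .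
  \<comment> \<open>The nonzero coefficient survives multiplication by the common denominator, so
    the polynomial relation is still nontrivial.\<close>
  have "m' \<otimes>\<^bsub>S\<^esub> a b0 \<noteq> \<zero>\<^bsub>S\<^esub>" using mc ac[OF b0(1)] m'nz b0(2) by (intro Sd.mult_nz) auto
  then have "\<iota> n (q b0) \<noteq> \<zero>\<^bsub>S\<^esub>" using ma[OF b0(1)] q(2)[OF b0(1)] by simp
  then have "q b0 \<noteq> \<zero>\<^bsub>Rn n\<^esub>" using \<iota>_zero_iff[OF q(1)[OF b0(1)]] by simp
  then obtain i0 where "q b0 i0 \<noteq> \<zero>" by auto
  then show False using polynomial_relation_descends[OF B q(1) rel b0(1)] ind by blast
qed

lemma infinite_H: "infinite (carrier H)"
proof
  assume fin: "finite (carrier H)"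
  let ?t = "\<lambda>j. \<psi> 0 (pmon \<one> j)"
  have c: "pmon \<one> j \<in> carrier (Rn 0)" for j by (rule pmon_closed[OF hns(2)])
  have inj: "inj ?t"
  proof (rule injI)
    fix i j assume "?t i = ?t j"
    then have "pmon \<one> i = pmon \<one> j" by (rule inj_onD[OF \<psi>_inj[of 0] _ c c])
    from fun_cong[OF this, of i] show "i = j" by (auto simp: pmon_def split: if_splits)
  qed
  have "range ?t \<subseteq> carrier H" using \<psi>_facts(1)[OF c c] by auto
  then have "finite (range ?t)" using fin by (rule finite_subset)
  then have "finite (UNIV :: nat set)" by (rule finite_imageD[OF _ inj])
  then show False by simp
qed

lemma SIGP_imp_IGP: assumes sigp: "SIGP h kk" shows "IGP H"
  unfolding IGP_def
proof (intro allI impI)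
  fix G :: "nat monoid" assume G: "group G \<and> finite (carrier G)"
  obtain L where L: "subdivring L LL" "kt \<subseteq> L" "galois (LL\<lparr>carrier := L\<rparr>) kt" "Gal (LL\<lparr>carrier := L\<rparr>) kt \<cong> G"
    using sigp G unfolding SIGP_def by blast
  interpret LLr: divring LL by (rule LL_divring)
  define L0 where "L0 = pull L"
  have L0: "subdivring L0 S" unfolding L0_def by (rule pull_subdivring[OF L(1)])
  have FL: "F0 \<subseteq> L0" using L(2) by (auto simp: F0_def L0_def pull_def)
  have L0Z: "L0 \<subseteq> carrier Z" by (auto simp: L0_def pull_def)
  have img: "\<eta> ` pull D = D" if "D \<subseteq> carrier LL" for D
  proof
    show "\<eta> ` pull D \<subseteq> D" by (auto simp: pull_def)
    show "D \<subseteq> \<eta> ` pull D"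
    proof
      fix x assume x: "x \<in> D"
      then have "x \<in> \<eta> ` carrier Z" using that \<eta>_facts(7) by auto
      then obtain f where "f \<in> carrier Z" "x = \<eta> f" by auto
      then show "x \<in> \<eta> ` pull D" using x by (auto simp: pull_def)
    qed
  qed
  have imgL: "\<eta> ` L0 = L" unfolding L0_def using img subdivringE(2)[OF L(1)] .
  have imgF: "\<eta> ` F0 = kt" unfolding F0_def using img subdivringE(2)[OF kt_subdivring] .
  let ?SL = "S\<lparr>carrier := L0\<rparr>" and ?LL = "LL\<lparr>carrier := L\<rparr>"
  have rSL: "ring ?SL" and rLL: "ring ?LL"
    using S.subring_is_ring[OF subdivringE(1)[OF L0]] LLr.subring_is_ring[OF subdivringE(1)[OF L(1)]] by auto
  have injL: "inj_on \<eta> L0" using \<eta>_facts(6) L0Z by (rule inj_on_subset)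
  have etaiso: "\<eta> \<in> ring_iso ?SL ?LL"
  proof (rule ring_iso_memI)
    fix x y assume "x \<in> carrier ?SL" "y \<in> carrier ?SL"
    then have x: "x \<in> L0" and y: "y \<in> L0" by auto
    show "\<eta> x \<in> carrier ?LL" using x imgL by auto
    show "\<eta> (x \<otimes>\<^bsub>?SL\<^esub> y) = \<eta> x \<otimes>\<^bsub>?LL\<^esub> \<eta> y" using \<eta>_facts(2) x y L0Z by auto
    show "\<eta> (x \<oplus>\<^bsub>?SL\<^esub> y) = \<eta> x \<oplus>\<^bsub>?LL\<^esub> \<eta> y" using \<eta>_facts(3)[of x y] by (simp del: tseries_simps)
  next
    show "\<eta> \<one>\<^bsub>?SL\<^esub> = \<one>\<^bsub>?LL\<^esub>" using \<eta>_facts(4) by (simp del: tseries_simps)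
    show "bij_betw \<eta> (carrier ?SL) (carrier ?LL)" using injL imgL by (simp add: bij_betw_def)
  qed
  have iso1: "Gal ?SL F0 \<cong> G"
    using Gal_iso_image[OF rSL rLL etaiso, of F0] FL imgF iso_trans[OF _ L(4)] by simp
  let ?th = "inv_into L0 \<eta>"
  \<comment> \<open>The Galois property is given for Laurent series and wanted for twisted series,
    so it is transported along the inverse of \<open>\<eta>\<close>.\<close>
  have thiso: "?th \<in> ring_iso ?LL ?SL" using ring_iso_set_sym[OF rSL etaiso] by simp
  have thF: "?th ` kt = F0" unfolding imgF[symmetric] using inv_into_image_cancel[OF injL FL] .
  have gal0: "galois ?SL F0"
    using galois_image[OF rLL rSL thiso, of kt] L(2,3) thF by simp
  obtain \<alpha> where "bij_betw \<alpha> (carrier (Gal ?SL F0)) (carrier G)" using iso1 unfolding is_iso_def iso_def by blast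
  then have finG: "finite (carrier (Gal ?SL F0))" using G bij_betw_finite by blast
  interpret CC: central_compositum S H' L0 F0
  proof unfold_locales
    show "x \<otimes>\<^bsub>S\<^esub> y = y \<otimes>\<^bsub>S\<^esub> x" if "x \<in> L0" "y \<in> carrier S" for x y
      by (rule Z_central) (use that L0Z in auto)
    show "lin_indep S H' B" if "finite B" "B \<subseteq> L0" "lin_indep S F0 B" for B
      by (rule linearly_disjoint) (use that L0Z in auto)
  qed (use H'_subdivring L0 F0_subdivring F0_H' FL finG gal0 in auto)
  obtain M B where M: "subdivring M S" "H' \<subseteq> M" "outer (S\<lparr>carrier := M\<rparr>) H'" "galois (S\<lparr>carrier := M\<rparr>) H'"
     "Gal (S\<lparr>carrier := M\<rparr>) H' \<cong> Gal ?SL F0" "finite B" "B \<subseteq> L0" "M = {(\<Oplus>\<^bsub>S\<^esub>b\<in>B. c b \<otimes>\<^bsub>S\<^esub> b) | c. c \<in> B \<rightarrow> H'}"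
    using CC.compositum_galois by blast
  let ?SM = "S\<lparr>carrier := M\<rparr>"
  have dSM: "divring ?SM" by (rule Sd.subdivring_divring[OF M(1)])
  then have rSM: "ring ?SM" by (rule divring.axioms)
  obtain \<phi> where \<phi>: "inj_on \<phi> (B \<rightarrow>\<^sub>E carrier H)" and "\<phi> ` (B \<rightarrow>\<^sub>E carrier H) \<subseteq> carrier H"
    using infinite_PiE_inj[OF infinite_H M(6)] by blast
  \<comment> \<open>Parametrises a set containing \<open>M\<close> by coefficient functions from
    \<open>B\<close> to \<open>H\<close>, of which there are no more than elements of
    \<open>H\<close>.\<close>
  define \<Xi> where "\<Xi> f = (\<Oplus>\<^bsub>S\<^esub>b\<in>B. \<Theta> (f b) \<otimes>\<^bsub>S\<^esub> b)" for f
  have Bz: "\<exists>f\<in>B \<rightarrow>\<^sub>E carrier H. y = \<Xi> f" if y: "y \<in> M" for y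
  proof -
    obtain c where c: "c \<in> B \<rightarrow> H'" "y = (\<Oplus>\<^bsub>S\<^esub>b\<in>B. c b \<otimes>\<^bsub>S\<^esub> b)" using y M(8) by blast
    have "\<exists>x\<in>carrier H. c b = \<Theta> x" if "b \<in> B" for b using c(1) that by (auto simp: H'_def)
    then obtain x where x: "\<And>b. b \<in> B \<Longrightarrow> x b \<in> carrier H \<and> c b = \<Theta> (x b)" by metis
    have Bc: "b \<in> carrier S" if "b \<in> B" for b using M(7) L0Z Z_sub that by blast
    have "y = \<Xi> (restrict x B)" unfolding c(2) \<Xi>_def
      using x Bc ring_hom_closed[OF FP.\<Theta>_hom] by (intro S.finsum_cong') (auto simp del: tseries_simps)
    then show ?thesis using x by (intro bexI[of _ "restrict x B"]) auto
  qed
  \<comment> \<open>Choosing one coefficient function for each element of \<open>M\<close> is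
    injective whether or not \<open>\<Xi>\<close> is; \<open>\<phi>\<close> then encodes that
    function as an element of \<open>H\<close>.\<close>
  define j where "j = \<phi> \<circ> inv_into (B \<rightarrow>\<^sub>E carrier H) \<Xi>"
  have Msub: "M \<subseteq> \<Xi> ` (B \<rightarrow>\<^sub>E carrier H)" using Bz by blast
  have injj: "inj_on j M" unfolding j_def
  proof (rule comp_inj_on)
    show "inj_on (inv_into (B \<rightarrow>\<^sub>E carrier H) \<Xi>) M" by (rule inj_on_inv_into[OF Msub])
    have "inv_into (B \<rightarrow>\<^sub>E carrier H) \<Xi> ` M \<subseteq> B \<rightarrow>\<^sub>E carrier H" using inv_into_into Msub by (metis (no_types, lifting) image_subsetI subsetD)
    then show "inj_on \<phi> (inv_into (B \<rightarrow>\<^sub>E carrier H) \<Xi> ` M)" using \<phi> inj_on_subset by blast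
  qed
  \<comment> \<open>The compositum with its structure moved onto elements of the type of
    \<open>H\<close>.\<close>
  define Q where "Q = image_ring j ?SM"
  have injj': "inj_on j (carrier ?SM)" using injj by simp
  have jiso: "j \<in> ring_iso ?SM Q" unfolding Q_def by (rule inj_imp_image_ring_iso[OF injj'])
  have rQ: "ring Q" unfolding Q_def by (rule ring.inj_imp_image_ring_is_ring[OF rSM injj'])
  have H'M: "H' \<subseteq> carrier ?SM" using M(2) by simp
  note T = rSM rQ jiso H'M
  define f where "f = j \<circ> \<Theta>"
  have fimg: "f ` carrier H = j ` H'" by (auto simp: f_def H'_def)
  have \<Theta>M: "\<Theta> \<in> ring_hom H ?SM"
    using FP.\<Theta>_hom H'M unfolding ring_hom_def H'_def by auto
  have "f \<in> ring_hom H Q" unfolding f_def using ring_hom_trans[OF \<Theta>M] jiso by (auto simp: ring_iso_def)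
  moreover have "inj_on f (carrier H)" unfolding f_def
    by (rule comp_inj_on[OF FP.\<Theta>_inj]) (use injj M(2) in \<open>auto simp: H'_def[symmetric] intro: inj_on_subset\<close>)
  moreover have "division_ring Q" unfolding division_ring_iff_divring by (rule divring_image[OF T dSM])
  moreover have "outer Q (f ` carrier H)" unfolding fimg by (rule outer_image[OF T M(3)])
  moreover have "galois Q (f ` carrier H)" unfolding fimg by (rule galois_image[OF T M(4)])
  moreover have "Gal Q (f ` carrier H) \<cong> G"
  proof -
    have "Gal ?SM H' \<cong> Gal Q (j ` H')" by (rule Gal_iso_image[OF T])
    then have "Gal Q (j ` H') \<cong> Gal ?SM H'" by (rule group.iso_sym[OF Gal_group[OF rSM H'M]])
    also note M(5) also note iso1
    finally show ?thesis unfolding fimg .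
  qed
  ultimately show "\<exists>(L :: 'u ring) f. division_ring L \<and> f \<in> ring_hom H L \<and> inj_on f (carrier H) \<and>
          outer L (f ` carrier H) \<and> galois L (f ` carrier H) \<and> Gal L (f ` carrier H) \<cong> G" by blast
qed

end

theorem theorem6:
  fixes h :: "('a,'m) ring_scheme" and k kk :: "'a set" and hs :: "nat \<Rightarrow> 'a set"
    and \<sigma> :: "nat \<Rightarrow> 'a \<Rightarrow> 'a" and d :: "nat \<Rightarrow> nat"
  assumes "division_ring h" and "subdivring k h"
    and "\<And>n. subdivring (hs n) h" and "\<And>n. k \<subseteq> hs n" and "\<And>n. hs n \<subseteq> hs (Suc n)"
    and "(\<Union>n. hs n) = carrier h"
    and "\<And>n. outer (h\<lparr>carrier := hs n\<rparr>) k" and "\<And>n. galois (h\<lparr>carrier := hs n\<rparr>) k"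
    and "\<And>n. left_degree h k (hs n) (d n)"
    and "\<And>n. \<sigma> n \<in> carrier (Gal (h\<lparr>carrier := hs n\<rparr>) k)"
    and "\<And>n. carrier (Gal (h\<lparr>carrier := hs n\<rparr>) k) = generate (Gal (h\<lparr>carrier := hs n\<rparr>) k) {\<sigma> n}"
    and "\<And>m n x. m \<le> n \<Longrightarrow> x \<in> hs m \<Longrightarrow> \<sigma> n x = \<sigma> m x"
    and "\<And>n. coprime (d (Suc n) div d n) (d n)"
    and "subdivring kk h" and "kk \<subseteq> ring_center (h\<lparr>carrier := k\<rparr>)"
  shows "(\<exists>l :: nat \<Rightarrow> nat. \<forall>n. 0 < l n \<and> l n dvd l (Suc n) \<and>
            d n dvd (l (Suc n) div l n - 1) \<and> d n dvd l n)
       \<and> (\<forall>l :: nat \<Rightarrow> nat. (\<forall>n. 0 < l n \<and> l n dvd l (Suc n) \<and>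
            d n dvd (l (Suc n) div l n - 1) \<and> d n dvd l n) \<longrightarrow>
          (\<forall>(H :: ('b,'c) ring_scheme) \<psi>. is_skew_limit h hs \<sigma> l H \<psi> \<longrightarrow>
              SIGP h kk \<longrightarrow> IGP H))"
proof -
  interpret cyclic_tower h k kk hs \<sigma> d
    using assms unfolding division_ring_iff_divring
    by (intro cyclic_tower.intro cyclic_tower_axioms.intro) auto
  show ?thesis
  proof (intro conjI allI impI)
    show "\<exists>l :: nat \<Rightarrow> nat. \<forall>n. 0 < l n \<and> l n dvd l (Suc n) \<and> d n dvd (l (Suc n) div l n - 1) \<and> d n dvd l n"
      by (rule coprime_chain_exists) (rule order_facts(1) d_dvd assms(13))+
    fix l :: "nat \<Rightarrow> nat" and H :: "('b,'c) ring_scheme" and \<psi>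
    assume l: "\<forall>n. 0 < l n \<and> l n dvd l (Suc n) \<and> d n dvd (l (Suc n) div l n - 1) \<and> d n dvd l n"
      and lim: "is_skew_limit h hs \<sigma> l H \<psi>" and sigp: "SIGP h kk"
    interpret skew_limit h k kk hs \<sigma> d l H \<psi>
      by unfold_locales (use l lim in auto)
    show "IGP H" by (rule SIGP_imp_IGP[OF sigp])
  qed
qed

end
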